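(* Let $r\ge1$, let $R$ be a Noetherian standard $\mathbb{N}^r$-graded ring such that $R_{\boldsymbol 0}=A$ is a local ring with maximal ideal $\mathfrak m$, and let $M$ be a finitely generated $\mathbb{Z}^r$-graded $R$-module. Assume that the residue field $A/\mathfrak m$ is infinite and let $s=s(M)$. Then there exists a complete reduction of length $s$ with respect to $M$ $$\{a_{ij}\in R_{\boldsymbol e_i} \mid i=1,\dots,r,\ j=1,\dots,s\}$$ such that for any $i_1,\dots,i_s\in\{1,\dots,r\}$, the sequence $a_{i_1 1},a_{i_2 2},\dots,a_{i_s s}$ is an $M$-filter-regular sequence. In particular, for any $\boldsymbol q=(q_1,\dots,q_r)\in\mathbb{N}^r$ such that $|\boldsymbol q|=s$, there exists a joint reduction of type $\boldsymbol q$ with respect to $M$ $$\{a_{ij}\in R_{\boldsymbol e_i}\mid i=1,\dots,r,\ j=1,\dots,q_i\}$$ such that $a_{11},a_{12},\dots,a_{1q_1},a_{21},\dots,a_{2q_2},\dots,a_{rq_r}$ is an $M$-filter-regular sequence.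
   Context: Notation: $\mathbb{N}$ contains $0$. $|\boldsymbol n|=n_1+\cdots+n_r$; $\boldsymbol e_i$ is the $i$th standard basis vector of $\mathbb{Z}^r$, $\boldsymbol e=(1,\dots,1)$. "For all $\boldsymbol n\gg\boldsymbol0$" means for all $\boldsymbol n$ with every entry sufficiently large. $[L]_{\boldsymbol n}$ is the degree $\boldsymbol n$ component. All rings are commutative. An $\mathbb{N}^r$-graded ring $R$ with $R_{\boldsymbol 0}=A$ is standard if it is generated over $A$ by $R_{\boldsymbol e_1},\dots,R_{\boldsymbol e_r}$ and $R_{\boldsymbol e_i}\ne(0)$ for all $i$. Set $R_{++}=R_{\boldsymbol e}R$. $\mathrm{Supp}_{++}(M)=\{P\in\mathrm{Spec}\,R : M_P\ne(0),\ P\text{ graded},\ R_{++}\not\subseteq P\}$. The spread of $M$ is $s(M)=\dim\mathrm{Supp}_{++}(M/\mathfrak mM)+1$, where the dimension is the supremum of lengths of chains of primes in the set and $\dim\emptyset=-1$. A homogeneous element $a\in R$ is $M$-filter-regular if $a\notin P$ for every $P\in\mathrm{Ass}_R(M)$ with $R_{++}\not\subseteq P$ (so any homogeneous element is $M$-filter-regular when there is no such $P$). A sequence $a_1,\dots,a_s$ of homogeneous elements is $M$-filter-regular if $a_i$ is $(M/(a_1,\dots,a_{i-1})M)$-filter-regular for all $i=1,\dots,s$. A set (indexed family) $\{a_{ij}\in R_{\boldsymbol e_i}\mid i=1,\dots,r,\ j=1,\dots,\ell\}$ is a complete reduction of length $\ell$ with respect to $M$ if $M_{\boldsymbol n}=[(a_{1j}a_{2j}\cdots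 a_{rj}\mid j=1,\dots,\ell)M]_{\boldsymbol n}$ for all $\boldsymbol n\gg\boldsymbol0$. A set (indexed family) $\{a_{ij}\in R_{\boldsymbol e_i}\mid i=1,\dots,r,\ j=1,\dots,q_i\}$ is a joint reduction of type $\boldsymbol q$ with respect to $M$ if $M_{\boldsymbol n}=[(a_{ij}\mid i=1,\dots,r,\ j=1,\dots,q_i)M]_{\boldsymbol n}$ for all $\boldsymbol n\gg\boldsymbol0$. The empty set is defined to be a complete reduction of length $0$ and a joint reduction of type $\boldsymbol 0$. *)

theory Defs
  imports
    "HOL-Algebra.Algebra"
    "HOL-Analysis.Finite_Cartesian_Product"
    "HOL-Library.Extended_Real"
begin

(* Multidegrees are vectors indexed by a finite linearly ordered type 'r, so r = CARD('r) and r >= 1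
   is automatic; the order of 'r is the order 1 < ... < r. The vector e_i is axis i 1, and
   e = (1,...,1) is 1. The order on vectors is componentwise. *)

section \<open>Modules\<close>

(* Both HOL.Modules and HOL-Algebra.Module have a locale called module; the one meant below is the
   module over a carrier-based ring. The mult and one fields of a module record carry no meaning. *)

definition gen_submodule ::
  "('a, 'x) ring_scheme \<Rightarrow> ('a, 'b, 'y) module_scheme \<Rightarrow> 'b set \<Rightarrow> 'b set"
  where "gen_submodule R M S = \<Inter>{N. submodule N R M \<and> S \<subseteq> N}"

definition finitely_generated_module ::
  "('a, 'x) ring_scheme \<Rightarrow> ('a, 'b, 'y) module_scheme \<Rightarrow> bool"
  where "finitely_generated_module R M \<longleftrightarrow>
    (\<exists>S\<subseteq>carrier M. finite S \<and> gen_submodule R M S = carrier M)"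

(* I M; here I need not be an ideal of R, e.g. it may be the maximal ideal of the subring A. *)
definition set_times_module ::
  "('a, 'x) ring_scheme \<Rightarrow> 'a set \<Rightarrow> ('a, 'b, 'y) module_scheme \<Rightarrow> 'b set"
  where "set_times_module R I M =
    gen_submodule R M {a \<odot>\<^bsub>M\<^esub> x | a x. a \<in> I \<and> x \<in> carrier M}"

definition quotient_module ::
  "('a, 'b, 'y) module_scheme \<Rightarrow> 'b set \<Rightarrow> ('a, 'b set) module"
  where "quotient_module M N =
    \<lparr>carrier = a_rcosets\<^bsub>M\<^esub> N, monoid.mult = undefined, monoid.one = undefined,
     ring.zero = N, ring.add = set_add M, smult = (\<lambda>a C. \<Union>x\<in>C. N +>\<^bsub>M\<^esub> (a \<odot>\<^bsub>M\<^esub> x))\<rparr>"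

definition fraction_rel ::
  "('a, 'x) ring_scheme \<Rightarrow> ('a, 'b, 'y) module_scheme \<Rightarrow> 'a set \<Rightarrow> (('b \<times> 'a) \<times> ('b \<times> 'a)) set"
  where "fraction_rel R M P =
    {((x, s), (y, t)). x \<in> carrier M \<and> y \<in> carrier M \<and> s \<in> carrier R - P \<and> t \<in> carrier R - P \<and>
       (\<exists>u\<in>carrier R - P. u \<odot>\<^bsub>M\<^esub> (t \<odot>\<^bsub>M\<^esub> x \<ominus>\<^bsub>M\<^esub> s \<odot>\<^bsub>M\<^esub> y) = \<zero>\<^bsub>M\<^esub>)}"

(* M_P for a prime P, as an R-module. *)
definition localized_module ::
  "('a, 'x) ring_scheme \<Rightarrow> ('a, 'b, 'y) module_scheme \<Rightarrow> 'a set \<Rightarrow> ('a, ('b \<times> 'a) set) module"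
  where "localized_module R M P =
    \<lparr>carrier = (carrier M \<times> (carrier R - P)) // fraction_rel R M P,
     monoid.mult = undefined, monoid.one = undefined,
     ring.zero = fraction_rel R M P `` {(\<zero>\<^bsub>M\<^esub>, \<one>\<^bsub>R\<^esub>)},
     ring.add = (\<lambda>S T. \<Union>(x, s)\<in>S. \<Union>(y, t)\<in>T.
              fraction_rel R M P `` {(t \<odot>\<^bsub>M\<^esub> x \<oplus>\<^bsub>M\<^esub> s \<odot>\<^bsub>M\<^esub> y, s \<otimes>\<^bsub>R\<^esub> t)}),
     smult = (\<lambda>a S. \<Union>(x, s)\<in>S. fraction_rel R M P `` {(a \<odot>\<^bsub>M\<^esub> x, s)})\<rparr>"

definition annihilator ::
  "('a, 'x) ring_scheme \<Rightarrow> ('a, 'b, 'y) module_scheme \<Rightarrow> 'b \<Rightarrow> 'a set"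
  where "annihilator R M x = {a \<in> carrier R. a \<odot>\<^bsub>M\<^esub> x = \<zero>\<^bsub>M\<^esub>}"

definition Ass :: "('a, 'x) ring_scheme \<Rightarrow> ('a, 'b, 'y) module_scheme \<Rightarrow> 'a set set"
  where "Ass R M = {P. primeideal P R \<and> (\<exists>x\<in>carrier M. P = annihilator R M x)}"

definition local_ring :: "('a, 'x) ring_scheme \<Rightarrow> 'a set \<Rightarrow> bool"
  where "local_ring A \<mm> \<longleftrightarrow>
    cring A \<and> maximalideal \<mm> A \<and> (\<forall>J. maximalideal J A \<longrightarrow> J = \<mm>)"

section \<open>Gradings\<close>

definition decomposition ::
  "('b, 'y) ring_scheme \<Rightarrow> ('n \<Rightarrow> 'b set) \<Rightarrow> ('n \<Rightarrow> 'b) \<Rightarrow> 'b \<Rightarrow> bool"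
  where "decomposition G g c x \<longleftrightarrow>
    (\<forall>n. c n \<in> g n) \<and> finite {n. c n \<noteq> \<zero>\<^bsub>G\<^esub>} \<and> x = (\<Oplus>\<^bsub>G\<^esub>n\<in>{n. c n \<noteq> \<zero>\<^bsub>G\<^esub>}. c n)"

definition direct_sum_decomposition :: "('b, 'y) ring_scheme \<Rightarrow> ('n \<Rightarrow> 'b set) \<Rightarrow> bool"
  where "direct_sum_decomposition G g \<longleftrightarrow>
    (\<forall>n. additive_subgroup (g n) G) \<and> (\<forall>x\<in>carrier G. \<exists>!c. decomposition G g c x)"

definition int_vec :: "nat ^ 'r \<Rightarrow> int ^ 'r::finite"
  where "int_vec m = (\<chi> i. int (m $ i))"

locale multigraded_ring = cring R for R (structure) +
  fixes Rg :: "nat ^ 'r::finite \<Rightarrow> 'a set"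
  assumes ring_decomposition: "direct_sum_decomposition R Rg"
    and mult_degree: "\<lbrakk>a \<in> Rg m; b \<in> Rg n\<rbrakk> \<Longrightarrow> a \<otimes> b \<in> Rg (m + n)"

abbreviation degree_zero_ring ::
  "('a, 'x) ring_scheme \<Rightarrow> (nat ^ 'r \<Rightarrow> 'a set) \<Rightarrow> ('a, 'x) ring_scheme"
  where "degree_zero_ring R Rg \<equiv> R\<lparr>carrier := Rg 0\<rparr>"

locale standard_multigraded_ring = multigraded_ring +
  assumes generated: "generate_ring R (Rg 0 \<union> (\<Union>i. Rg (axis i 1))) = carrier R"
    and nonzero: "Rg (axis i 1) \<noteq> {\<zero>}"

locale multigraded_module = R?: multigraded_ring R Rg + M?: Module.module R M
  for R (structure) and Rg :: "nat ^ 'r::finite \<Rightarrow> 'a set"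
    and M :: "('a, 'b, 'y) module_scheme" (structure) +
  fixes Mg :: "int ^ 'r \<Rightarrow> 'b set"
  assumes module_decomposition: "direct_sum_decomposition M Mg"
    and smult_degree: "\<lbrakk>a \<in> Rg m; x \<in> Mg n\<rbrakk> \<Longrightarrow> a \<odot>\<^bsub>M\<^esub> x \<in> Mg (int_vec m + n)"

definition homogeneous :: "(nat ^ 'r \<Rightarrow> 'a set) \<Rightarrow> 'a \<Rightarrow> bool"
  where "homogeneous Rg a \<longleftrightarrow> (\<exists>n. a \<in> Rg n)"

definition graded_ideal ::
  "('a, 'x) ring_scheme \<Rightarrow> (nat ^ 'r \<Rightarrow> 'a set) \<Rightarrow> 'a set \<Rightarrow> bool"
  where "graded_ideal R Rg P \<longleftrightarrow>
    ideal P R \<and> (\<forall>x\<in>P. \<forall>c. decomposition R Rg c x \<longrightarrow> (\<forall>n. c n \<in> P))"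

(* The ideal R_{++} *)
definition irrelevant_ideal ::
  "('a, 'x) ring_scheme \<Rightarrow> (nat ^ 'r::finite \<Rightarrow> 'a set) \<Rightarrow> 'a set"
  where "irrelevant_ideal R Rg = Idl\<^bsub>R\<^esub> (Rg 1)"

section \<open>Relevant support and spread\<close>

definition Supp_pp ::
  "('a, 'x) ring_scheme \<Rightarrow> (nat ^ 'r::finite \<Rightarrow> 'a set) \<Rightarrow> ('a, 'b, 'y) module_scheme \<Rightarrow> 'a set set"
  where "Supp_pp R Rg M =
    {P. primeideal P R \<and>
        carrier (localized_module R M P) \<noteq> {\<zero>\<^bsub>localized_module R M P\<^esub>} \<and>
        graded_ideal R Rg P \<and> \<not> irrelevant_ideal R Rg \<subseteq> P}"

(* A chain P_0 < ... < P_l has length l. In the extended reals the supremum of the empty set is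
   -\<infinity>, so the empty set needs its own clause. *)
definition chain_dim :: "'a set set \<Rightarrow> ereal"
  where "chain_dim \<S> =
    (if \<S> = {} then -1
     else Sup {ereal (real l) | l. \<exists>Ps. length Ps = Suc l \<and> set Ps \<subseteq> \<S> \<and> sorted_wrt (\<subset>) Ps})"

definition spread ::
  "('a, 'x) ring_scheme \<Rightarrow> (nat ^ 'r::finite \<Rightarrow> 'a set) \<Rightarrow> 'a set \<Rightarrow> ('a, 'b, 'y) module_scheme \<Rightarrow> ereal"
  where "spread R Rg \<mm> M =
    chain_dim (Supp_pp R Rg (quotient_module M (set_times_module R \<mm> M))) + 1"

section \<open>Filter-regular sequences and reductions\<close>

definition filter_regular ::
  "('a, 'x) ring_scheme \<Rightarrow> (nat ^ 'r::finite \<Rightarrow> 'a set) \<Rightarrow> ('a, 'b, 'y) module_scheme \<Rightarrow> 'a \<Rightarrow> bool"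
  where "filter_regular R Rg M a \<longleftrightarrow>
    homogeneous Rg a \<and> (\<forall>P\<in>Ass R M. \<not> irrelevant_ideal R Rg \<subseteq> P \<longrightarrow> a \<notin> P)"

definition filter_regular_seq ::
  "('a, 'x) ring_scheme \<Rightarrow> (nat ^ 'r::finite \<Rightarrow> 'a set) \<Rightarrow> ('a, 'b, 'y) module_scheme \<Rightarrow> 'a list \<Rightarrow> bool"
  where "filter_regular_seq R Rg M as \<longleftrightarrow>
    (\<forall>i<length as. filter_regular R Rg
       (quotient_module M (set_times_module R (Idl\<^bsub>R\<^esub> (set (take i as))) M)) (as ! i))"

definition for_large_degrees :: "(int ^ 'r::finite \<Rightarrow> bool) \<Rightarrow> bool"
  where "for_large_degrees Q \<longleftrightarrow> (\<exists>N. \<forall>n\<ge>N. Q n)"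

(* The degree n component of a graded submodule N of M is Mg n \<inter> N. The cases of length 0 and
   type 0 follow the convention that the empty family is always a reduction. *)

definition complete_reduction ::
  "('a, 'x) ring_scheme \<Rightarrow> (nat ^ 'r::finite \<Rightarrow> 'a set) \<Rightarrow>
   ('a, 'b, 'y) module_scheme \<Rightarrow> (int ^ 'r \<Rightarrow> 'b set) \<Rightarrow> nat \<Rightarrow> ('r \<Rightarrow> nat \<Rightarrow> 'a) \<Rightarrow> bool"
  where "complete_reduction R Rg M Mg l a \<longleftrightarrow>
    (\<forall>i. \<forall>j\<in>{1..l}. a i j \<in> Rg (axis i 1)) \<and>
    (l = 0 \<or> for_large_degrees (\<lambda>n.
       Mg n = Mg n \<inter>
         set_times_module R (Idl\<^bsub>R\<^esub> {\<Otimes>\<^bsub>R\<^esub>i\<in>UNIV. a i j | j. j \<in> {1..l}}) M))"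

definition joint_reduction ::
  "('a, 'x) ring_scheme \<Rightarrow> (nat ^ 'r::finite \<Rightarrow> 'a set) \<Rightarrow>
   ('a, 'b, 'y) module_scheme \<Rightarrow> (int ^ 'r \<Rightarrow> 'b set) \<Rightarrow> nat ^ 'r \<Rightarrow> ('r \<Rightarrow> nat \<Rightarrow> 'a) \<Rightarrow> bool"
  where "joint_reduction R Rg M Mg q a \<longleftrightarrow>
    (\<forall>i. \<forall>j\<in>{1..q $ i}. a i j \<in> Rg (axis i 1)) \<and>
    (q = 0 \<or> for_large_degrees (\<lambda>n.
       Mg n = Mg n \<inter> set_times_module R (Idl\<^bsub>R\<^esub> {a i j | i j. j \<in> {1..q $ i}}) M))"

(* a_{11}, ..., a_{1 q_1}, a_{21}, ..., a_{2 q_2}, ..., a_{r q_r} *)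
definition lex_list :: "nat ^ 'r::{finite, linorder} \<Rightarrow> ('r \<Rightarrow> nat \<Rightarrow> 'a) \<Rightarrow> 'a list"
  where "lex_list q a =
    concat (map (\<lambda>i. map (a i) [1..<Suc (q $ i)]) (sorted_list_of_set UNIV))"

end

theory Submission
  imports Defs "HOL-Library.Fun_Lexorder"
begin

text \<open>Choose the elements column by column: since the residue field is infinite, some element of
  \<open>Rg (axis i 1)\<close> avoids the finitely many relevant associated primes of all quotients of M and of
  \<open>M / \<mm> M\<close> by the submodules \<open>F M\<close>, where F runs through the subsets of the elements chosen before
  and of their column products \<open>b\<^sub>j\<close>. This gives filter-regularity for every selection of rows. Every
  prime in the relevant support of \<open>M / (\<mm>, b\<^sub>1, \<dots>, b\<^sub>j\<^sub>-\<^sub>1) M\<close> contains a graded relevant associated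
  prime, which avoids \<open>b\<^sub>j\<close>; so dividing out \<open>b\<^sub>j\<close> lowers the length of chains, and after \<open>s\<close> columns
  the relevant support is empty. Then the quotient vanishes in large degrees, and Nakayama's lemma
  removes \<open>\<mm>\<close>. The spread is finite because the chains consist of primes containing \<open>\<mm>\<close>, and
  \<open>R / \<mm> R\<close> is a finitely generated algebra over the residue field. Quotients
  are replaced by submodules N of M: the associated primes of \<open>M / N\<close> are the primes of the form
  \<open>(N : x)\<close>, and P lies in the support iff it contains some \<open>(N : x)\<close>.\<close>

section \<open>Homogeneous components\<close>

text \<open>The entries of a column have to serve two kinds of quotients at once: those by a
  selection of earlier entries, for filter-regularity, and those by \<open>\<mm>\<close> and the
  earlier column products, for the drop of the support. Both amount to avoiding finitely many
  primes, so each entry can be chosen generically for all of them together. The entries of one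
  column are chosen independently of each other, which is why every selection of rows works. A prime
  avoided by all entries of a column is avoided by their product, so no separate condition on
  \<open>b\<^sub>j\<close> is imposed. The support contains only graded primes, so a prime
  \<open>(N : x)\<close> below a given one is of use for chains only if it is graded. The
  maximal-annihilator argument is therefore run on homogeneous elements \<open>x\<close>, and
  primality is tested on homogeneous elements by comparing leading components. For a joint
  reduction, the \<open>s\<close> columns are distributed among the rows according to
  \<open>q\<close>. Each column product has a factor among the chosen entries, so the complete
  reduction lies in the ideal of the joint one.\<close>

definition gcomp :: "('b, 'y) ring_scheme \<Rightarrow> ('n \<Rightarrow> 'b set) \<Rightarrow> 'n \<Rightarrow> 'b \<Rightarrow> 'b"
  where "gcomp G g n x = (THE c. decomposition G g c x) n"

locale graded_group = abelian_group G for G (structure) +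
  fixes g :: "'n \<Rightarrow> 'a set"
  assumes direct_sum: "direct_sum_decomposition G g"
begin

lemma additive_subgroup_g: "additive_subgroup (g n) G"
  using direct_sum by (simp add: direct_sum_decomposition_def)

lemma g_carrier: "x \<in> g n \<Longrightarrow> x \<in> carrier G"
  using additive_subgroup.a_Hcarr[OF additive_subgroup_g] .

lemma g_zero [simp]: "\<zero> \<in> g n"
  using additive_subgroup.zero_closed[OF additive_subgroup_g] .

lemma g_add: "x \<in> g n \<Longrightarrow> y \<in> g n \<Longrightarrow> x \<oplus> y \<in> g n"
  using additive_subgroup.a_closed[OF additive_subgroup_g] .

lemma g_a_inv: "x \<in> g n \<Longrightarrow> \<ominus> x \<in> g n"
  using additive_subgroup.a_inv_closed[OF additive_subgroup_g] .

lemma decomposition_gcomp: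
  assumes "x \<in> carrier G" shows "decomposition G g (\<lambda>n. gcomp G g n x) x"
proof -
  have "\<exists>!c. decomposition G g c x"
    using direct_sum assms by (simp add: direct_sum_decomposition_def)
  from theI'[OF this] show ?thesis by (simp add: gcomp_def)
qed

lemma gcomp_eqI:
  assumes "x \<in> carrier G" "decomposition G g c x" shows "gcomp G g n x = c n"
proof -
  have "\<exists>!c. decomposition G g c x"
    using direct_sum assms by (simp add: direct_sum_decomposition_def)
  from the1_equality[OF this, of c] assms(2) show ?thesis by (simp add: gcomp_def)
qed

lemma gcomp_in: "x \<in> carrier G \<Longrightarrow> gcomp G g n x \<in> g n"
  using decomposition_gcomp by (simp add: decomposition_def)

lemma gcomp_closed [simp]: "x \<in> carrier G \<Longrightarrow> gcomp G g n x \<in> carrier G"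
  using gcomp_in g_carrier by blast

lemma finite_gcomp: "x \<in> carrier G \<Longrightarrow> finite {n. gcomp G g n x \<noteq> \<zero>}"
  using decomposition_gcomp by (simp add: decomposition_def)

text \<open>Any finite index set outside of which \<open>c\<close> vanishes may replace the exact
  support used in the definition, so supports never have to be computed.\<close>

lemma decompositionI:
  assumes "finite A" "\<And>n. c n \<in> g n" "\<And>n. n \<notin> A \<Longrightarrow> c n = \<zero>" "x = (\<Oplus>n\<in>A. c n)"
  shows "decomposition G g c x"
proof -
  have sub: "{n. c n \<noteq> \<zero>} \<subseteq> A" using assms(3) by blast
  have "(\<Oplus>n\<in>A. c n) = (\<Oplus>n\<in>{n. c n \<noteq> \<zero>}. c n)"
    using assms(1,2) sub g_carrier by (intro add.finprod_mono_neutral_cong_right) auto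
  then show ?thesis
    using assms finite_subset[OF sub] by (simp add: decomposition_def)
qed

lemma decompositionE:
  assumes "decomposition G g c x" "finite A" "{n. c n \<noteq> \<zero>} \<subseteq> A"
  shows "x = (\<Oplus>n\<in>A. c n)"
proof -
  have "(\<Oplus>n\<in>A. c n) = (\<Oplus>n\<in>{n. c n \<noteq> \<zero>}. c n)"
    using assms g_carrier by (intro add.finprod_mono_neutral_cong_right) (auto simp: decomposition_def)
  then show ?thesis using assms by (simp add: decomposition_def)
qed

lemma gcomp_homogeneous:
  assumes "x \<in> g m" shows "gcomp G g n x = (if n = m then x else \<zero>)"
proof (rule gcomp_eqI)
  show "x \<in> carrier G" using assms g_carrier by blast
  then show "decomposition G g (\<lambda>n. if n = m then x else \<zero>) x"
    using assms by (intro decompositionI[of "{m}"]) auto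
qed

lemma gcomp_add:
  assumes "x \<in> carrier G" "y \<in> carrier G"
  shows "gcomp G g n (x \<oplus> y) = gcomp G g n x \<oplus> gcomp G g n y"
proof (rule gcomp_eqI)
  let ?A = "{n. gcomp G g n x \<noteq> \<zero>} \<union> {n. gcomp G g n y \<noteq> \<zero>}"
  have fin: "finite ?A" using assms finite_gcomp by simp
  have "x = (\<Oplus>n\<in>?A. gcomp G g n x)" "y = (\<Oplus>n\<in>?A. gcomp G g n y)"
    using decompositionE[OF decomposition_gcomp fin] assms by blast+
  moreover have "(\<Oplus>n\<in>?A. gcomp G g n x \<oplus> gcomp G g n y)
      = (\<Oplus>n\<in>?A. gcomp G g n x) \<oplus> (\<Oplus>n\<in>?A. gcomp G g n y)"
    using assms by (intro finsum_addf) auto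
  ultimately show "decomposition G g (\<lambda>n. gcomp G g n x \<oplus> gcomp G g n y) (x \<oplus> y)"
    using assms fin by (intro decompositionI[of ?A]) (auto intro: g_add gcomp_in)
qed (use assms in simp)

lemma gcomp_zero [simp]: "gcomp G g n \<zero> = \<zero>"
  using gcomp_homogeneous[of \<zero> n] by simp

lemma gcomp_a_inv: "x \<in> carrier G \<Longrightarrow> gcomp G g n (\<ominus> x) = \<ominus> gcomp G g n x"
  by (metis a_inv_closed gcomp_add gcomp_closed gcomp_zero minus_unique r_neg l_neg minus_equality)

lemma gcomp_minus:
  "x \<in> carrier G \<Longrightarrow> y \<in> carrier G \<Longrightarrow> gcomp G g n (x \<ominus> y) = gcomp G g n x \<ominus> gcomp G g n y"
  by (simp add: a_minus_def gcomp_add gcomp_a_inv)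

text \<open>The tool for reducing to homogeneous elements: \<open>H\<close> is instantiated with the
  set of all elements having some additive property, which then has to be checked on components
  only.\<close>

lemma mem_if_gcomp_mem:
  assumes x: "x \<in> carrier G" and "\<zero> \<in> H" "\<And>y z. y \<in> H \<Longrightarrow> z \<in> H \<Longrightarrow> y \<oplus> z \<in> H"
    and comp: "\<And>n. gcomp G g n x \<in> H"
  shows "x \<in> H"
proof -
  have "finite A \<Longrightarrow> (\<Oplus>n\<in>A. gcomp G g n x) \<in> H" for A
    by (induct A rule: finite_induct) (use assms in auto)
  moreover have "x = (\<Oplus>n\<in>{n. gcomp G g n x \<noteq> \<zero>}. gcomp G g n x)"
    using decomposition_gcomp[OF x] by (simp add: decomposition_def)
  ultimately show ?thesis using finite_gcomp[OF x] by metis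
qed

end

lemma (in multigraded_ring) graded_group_R: "graded_group R Rg"
  using ring_decomposition by (simp add: graded_group_def graded_group_axioms_def abelian_group_axioms)

sublocale multigraded_ring \<subseteq> RG: graded_group R Rg
  by (rule graded_group_R)

lemma (in multigraded_module) graded_group_M: "graded_group M Mg"
  using module_decomposition
  by (simp add: graded_group_def graded_group_axioms_def M.abelian_group_axioms)

sublocale multigraded_module \<subseteq> MG: graded_group M Mg
  by (rule graded_group_M)

section \<open>Submodules, products with sets of scalars, and colon ideals\<close>

lemma (in Module.module) submodule_iff:
  "submodule H R M \<longleftrightarrow> H \<subseteq> carrier M \<and> \<zero>\<^bsub>M\<^esub> \<in> H \<and> (\<forall>a\<in>H. \<forall>b\<in>H. a \<oplus>\<^bsub>M\<^esub> b \<in> H) \<and>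
     (\<forall>r\<in>carrier R. \<forall>x\<in>H. r \<odot>\<^bsub>M\<^esub> x \<in> H)" (is "_ \<longleftrightarrow> ?r")
proof
  assume a: "submodule H R M"
  note s = submoduleE[OF a]
  obtain x where "x \<in> H" using s(2) by blast
  then have "\<zero>\<^bsub>M\<^esub> \<in> H" using s(1) s(4)[of "\<zero>" x] by (metis R.zero_closed smult_l_null subsetD)
  then show ?r using s by blast
next
  assume r: ?r
  have "\<ominus>\<^bsub>M\<^esub> a \<in> H" if "a \<in> H" for a
  proof -
    have "(\<ominus> \<one>) \<odot>\<^bsub>M\<^esub> a \<in> H" using r that by simp
    moreover have "(\<ominus> \<one>) \<odot>\<^bsub>M\<^esub> a = \<ominus>\<^bsub>M\<^esub> a" using r that smult_l_minus[of "\<one>\<^bsub>R\<^esub>" a] by auto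
    ultimately show ?thesis by simp
  qed
  then show "submodule H R M" using r by (intro submoduleI) auto
qed

lemma (in Module.module) submodule_minus:
  "submodule H R M \<Longrightarrow> a \<in> H \<Longrightarrow> b \<in> H \<Longrightarrow> a \<ominus>\<^bsub>M\<^esub> b \<in> H"
  using submoduleE(3,5)[of H] by (simp add: a_minus_def)

lemma (in Module.module) submodule_add_cancel:
  assumes "submodule H R M" "a \<in> H" "b \<in> carrier M" "a \<oplus>\<^bsub>M\<^esub> b \<in> H" shows "b \<in> H"
proof -
  have "a \<in> carrier M" using assms submoduleE(1) by blast
  then have "b = (a \<oplus>\<^bsub>M\<^esub> b) \<ominus>\<^bsub>M\<^esub> a"
    using assms(3) by (metis a_minus_def M.add.inv_closed M.add.m_assoc M.add.m_comm M.r_neg1)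
  then show ?thesis using submodule_minus[OF assms(1,4,2)] by simp
qed

lemma (in Module.module) gen_submodule_is_submodule:
  assumes "S \<subseteq> carrier M" shows "submodule (gen_submodule R M S) R M"
  using carrier_is_submodule assms unfolding submodule_iff gen_submodule_def by auto

lemma gen_submodule_incl: "S \<subseteq> gen_submodule R M S"
  by (auto simp: gen_submodule_def)

lemma gen_submodule_least: "submodule N R M \<Longrightarrow> S \<subseteq> N \<Longrightarrow> gen_submodule R M S \<subseteq> N"
  by (auto simp: gen_submodule_def)

lemma (in Module.module) set_times_module_is_submodule:
  "I \<subseteq> carrier R \<Longrightarrow> submodule (set_times_module R I M) R M"
  unfolding set_times_module_def by (rule gen_submodule_is_submodule) auto

lemma set_times_module_incl: "a \<in> I \<Longrightarrow> x \<in> carrier M \<Longrightarrow> a \<odot>\<^bsub>M\<^esub> x \<in> set_times_module R I M"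
  unfolding set_times_module_def by (rule subsetD[OF gen_submodule_incl]) auto

lemma set_times_module_least:
  "submodule N R M \<Longrightarrow> (\<And>a x. a \<in> I \<Longrightarrow> x \<in> carrier M \<Longrightarrow> a \<odot>\<^bsub>M\<^esub> x \<in> N) \<Longrightarrow>
    set_times_module R I M \<subseteq> N"
  unfolding set_times_module_def by (rule gen_submodule_least) auto

lemma (in Module.module) set_times_module_mono:
  "I \<subseteq> J \<Longrightarrow> J \<subseteq> carrier R \<Longrightarrow> set_times_module R I M \<subseteq> set_times_module R J M"
  by (rule set_times_module_least[OF set_times_module_is_submodule]) (auto intro: set_times_module_incl)

lemma (in Module.module) ideal_smult_mem:
  assumes N: "submodule N R M" and x: "x \<in> carrier M"
  shows "ideal {r \<in> carrier R. r \<odot>\<^bsub>M\<^esub> x \<in> N} R"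
proof (rule idealI[OF R.ring_axioms])
  note N' = N[unfolded submodule_iff]
  show "subgroup {r \<in> carrier R. r \<odot>\<^bsub>M\<^esub> x \<in> N} (add_monoid R)"
    using N' submoduleE(3)[OF N] x
    by unfold_locales (auto simp: smult_l_distr smult_l_minus a_inv_def[symmetric])
  fix a b assume "a \<in> {r \<in> carrier R. r \<odot>\<^bsub>M\<^esub> x \<in> N}" "b \<in> carrier R"
  then show "b \<otimes> a \<in> {r \<in> carrier R. r \<odot>\<^bsub>M\<^esub> x \<in> N}" "a \<otimes> b \<in> {r \<in> carrier R. r \<odot>\<^bsub>M\<^esub> x \<in> N}"
    using N' x by (auto simp: smult_assoc1 R.m_comm[of a b])
qed

text \<open>For fixed \<open>x\<close> the scalars carrying \<open>x\<close> into \<open>F M\<close>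
  form an ideal, which contains \<open>Idl F\<close> because it contains \<open>F\<close>. Hence
  submodules can be indexed by finite sets \<open>F\<close> of elements instead of ideals.\<close>

lemma (in Module.module) set_times_module_genideal:
  assumes F: "F \<subseteq> carrier R"
  shows "set_times_module R (Idl F) M = set_times_module R F M"
proof
  have sub: "submodule (set_times_module R F M) R M" by (rule set_times_module_is_submodule[OF F])
  show "set_times_module R (Idl F) M \<subseteq> set_times_module R F M"
  proof (rule set_times_module_least[OF sub])
    fix a x assume a: "a \<in> Idl F" and x: "x \<in> carrier M"
    have "Idl F \<subseteq> {r \<in> carrier R. r \<odot>\<^bsub>M\<^esub> x \<in> set_times_module R F M}"
      using F x by (intro R.genideal_minimal ideal_smult_mem sub) (auto intro: set_times_module_incl)
    then show "a \<odot>\<^bsub>M\<^esub> x \<in> set_times_module R F M" using a by blast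
  qed
  show "set_times_module R F M \<subseteq> set_times_module R (Idl F) M"
    using R.genideal_self[OF F] ideal.Icarr[OF R.genideal_ideal[OF F]]
    by (intro set_times_module_mono) auto
qed

definition colon :: "('a, 'x) ring_scheme \<Rightarrow> ('a, 'b, 'y) module_scheme \<Rightarrow> 'b set \<Rightarrow> 'b \<Rightarrow> 'a set"
  where "colon R M N x = {a \<in> carrier R. a \<odot>\<^bsub>M\<^esub> x \<in> N}"

lemma (in Module.module) ideal_colon:
  "submodule N R M \<Longrightarrow> x \<in> carrier M \<Longrightarrow> ideal (colon R M N x) R"
  unfolding colon_def by (rule ideal_smult_mem)

lemma (in Module.module) colon_smult_mono:
  assumes "submodule N R M" "x \<in> carrier M" "a \<in> carrier R"
  shows "colon R M N x \<subseteq> colon R M N (a \<odot>\<^bsub>M\<^esub> x)"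
  using assms(1)[unfolded submodule_iff] assms(2,3)
  by (auto simp: colon_def smult_assoc1[symmetric] R.m_comm[of _ a]) (simp add: smult_assoc1)

definition graded_subset :: "('b, 'y) ring_scheme \<Rightarrow> ('n \<Rightarrow> 'b set) \<Rightarrow> 'b set \<Rightarrow> bool"
  where "graded_subset G g N \<longleftrightarrow> (\<forall>x\<in>N. \<forall>n. gcomp G g n x \<in> N)"

lemma (in multigraded_ring) graded_ideal_iff:
  "graded_ideal R Rg P \<longleftrightarrow> ideal P R \<and> graded_subset R Rg P"
proof (cases "ideal P R")
  case True
  then have c: "x \<in> carrier R" if "x \<in> P" for x using ideal.Icarr that by metis
  show ?thesis unfolding graded_ideal_def graded_subset_def
    using True RG.gcomp_eqI[OF c] RG.decomposition_gcomp[OF c] by metis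
qed (simp add: graded_ideal_def)

lemma int_vec_inj: "int_vec m = int_vec n \<longleftrightarrow> m = n"
  by (simp add: int_vec_def vec_eq_iff)

lemma int_vec_zero [simp]: "int_vec 0 = 0"
  by (simp add: int_vec_def vec_eq_iff)

section \<open>Graded submodules and graded colon ideals\<close>

context multigraded_module begin

text \<open>Both sides are additive in \<open>x\<close>, so \<open>x\<close> may be taken
  homogeneous. Degrees of \<open>M\<close> are integer vectors, hence every degree has the form
  \<open>int_vec k + n\<close>.\<close>

lemma gcomp_smult_left:
  assumes r: "r \<in> Rg k" and x: "x \<in> carrier M"
  shows "gcomp M Mg (int_vec k + n) (r \<odot>\<^bsub>M\<^esub> x) = r \<odot>\<^bsub>M\<^esub> gcomp M Mg n x"
proof -
  have rc: "r \<in> carrier R" using r RG.g_carrier by blast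
  have "x \<in> {x \<in> carrier M. \<forall>n. gcomp M Mg (int_vec k + n) (r \<odot>\<^bsub>M\<^esub> x) = r \<odot>\<^bsub>M\<^esub> gcomp M Mg n x}"
    (is "x \<in> ?H")
  proof (rule MG.mem_if_gcomp_mem[OF x])
    fix m
    let ?y = "gcomp M Mg m x"
    have y: "?y \<in> Mg m" "?y \<in> carrier M" using x MG.gcomp_in by auto
    have "r \<odot>\<^bsub>M\<^esub> ?y \<in> Mg (int_vec k + m)" using smult_degree[OF r y(1)] .
    from MG.gcomp_homogeneous[OF this] MG.gcomp_homogeneous[OF y(1)]
    show "?y \<in> ?H" using rc y by auto
  qed (use rc in \<open>auto simp: MG.gcomp_add smult_r_distr\<close>)
  then show ?thesis by blast
qed

text \<open>Here the module element is homogeneous and the scalar is not: the components of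
  \<open>a x\<close> come from those of \<open>a\<close>, with no two colliding because
  \<open>int_vec\<close> is injective. This makes \<open>(N : x)\<close> graded for homogeneous
  \<open>x\<close>.\<close>

lemma gcomp_smult_right:
  assumes x: "x \<in> Mg d" and a: "a \<in> carrier R"
  shows "gcomp M Mg (int_vec k + d) (a \<odot>\<^bsub>M\<^esub> x) = gcomp R Rg k a \<odot>\<^bsub>M\<^esub> x"
proof -
  have xc: "x \<in> carrier M" using x MG.g_carrier by blast
  have "a \<in> {a \<in> carrier R. gcomp M Mg (int_vec k + d) (a \<odot>\<^bsub>M\<^esub> x) = gcomp R Rg k a \<odot>\<^bsub>M\<^esub> x}"
    (is "a \<in> ?H")
  proof (rule RG.mem_if_gcomp_mem[OF a])
    fix m
    let ?b = "gcomp R Rg m a"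
    have y: "?b \<in> Rg m" "?b \<in> carrier R" using a RG.gcomp_in by auto
    have "?b \<odot>\<^bsub>M\<^esub> x \<in> Mg (int_vec m + d)" using smult_degree[OF y(1) x] .
    from MG.gcomp_homogeneous[OF this] RG.gcomp_homogeneous[OF y(1)]
    show "?b \<in> ?H" using xc y by (auto simp: int_vec_inj)
  qed (use xc in \<open>auto simp: RG.gcomp_add MG.gcomp_add smult_l_distr\<close>)
  then show ?thesis by blast
qed

text \<open>The elements all of whose components lie in the generated submodule form a submodule
  themselves; closure under scalars follows by splitting the scalar into components.\<close>

lemma graded_gen_submodule:
  assumes S: "S \<subseteq> carrier M"
    and comps: "\<And>s n. s \<in> S \<Longrightarrow> gcomp M Mg n s \<in> gen_submodule R M S"
  shows "graded_subset M Mg (gen_submodule R M S)"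
proof -
  let ?G = "gen_submodule R M S"
  have G: "submodule ?G R M" by (rule gen_submodule_is_submodule[OF S])
  note G' = G[unfolded submodule_iff]
  let ?K = "{x \<in> carrier M. \<forall>n. gcomp M Mg n x \<in> ?G}"
  have "r \<odot>\<^bsub>M\<^esub> x \<in> ?K" if r: "r \<in> carrier R" and x: "x \<in> ?K" for r x
  proof -
    have xc: "x \<in> carrier M" using x by blast
    have "r \<in> {r \<in> carrier R. \<forall>n. gcomp M Mg n (r \<odot>\<^bsub>M\<^esub> x) \<in> ?G}" (is "r \<in> ?H")
    proof (rule RG.mem_if_gcomp_mem[OF r])
      fix m
      let ?b = "gcomp R Rg m r"
      have y: "?b \<in> Rg m" "?b \<in> carrier R" using r RG.gcomp_in by auto
      have "gcomp M Mg n (?b \<odot>\<^bsub>M\<^esub> x) \<in> ?G" for n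
        using gcomp_smult_left[OF y(1) xc, of "n - int_vec m"] x y G' by simp
      then show "?b \<in> ?H" using y by blast
    qed (use xc G' in \<open>auto simp: MG.gcomp_add smult_l_distr\<close>)
    then show ?thesis using xc by simp
  qed
  then have "submodule ?K R M" using G' by (auto simp: submodule_iff MG.gcomp_add)
  then have "?G \<subseteq> ?K" using S comps by (intro gen_submodule_least) auto
  then show ?thesis by (auto simp: graded_subset_def)
qed

lemma graded_set_times_module:
  assumes I: "\<And>a. a \<in> I \<Longrightarrow> homogeneous Rg a"
  shows "graded_subset M Mg (set_times_module R I M)"
  unfolding set_times_module_def
proof (rule graded_gen_submodule)
  show "{a \<odot>\<^bsub>M\<^esub> x |a x. a \<in> I \<and> x \<in> carrier M} \<subseteq> carrier M"
    using I RG.g_carrier by (fastforce simp: homogeneous_def)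
  fix s n assume "s \<in> {a \<odot>\<^bsub>M\<^esub> x |a x. a \<in> I \<and> x \<in> carrier M}"
  then obtain a x where s: "s = a \<odot>\<^bsub>M\<^esub> x" "a \<in> I" "x \<in> carrier M" by blast
  obtain k where k: "a \<in> Rg k" using I s by (auto simp: homogeneous_def)
  have "gcomp M Mg n s = a \<odot>\<^bsub>M\<^esub> gcomp M Mg (n - int_vec k) x"
    using gcomp_smult_left[OF k s(3), of "n - int_vec k"] s(1) by simp
  moreover have "a \<odot>\<^bsub>M\<^esub> gcomp M Mg (n - int_vec k) x \<in> {a \<odot>\<^bsub>M\<^esub> x |a x. a \<in> I \<and> x \<in> carrier M}"
    using s by (intro CollectI exI[of _ a] exI[of _ "gcomp M Mg (n - int_vec k) x"]) auto
  ultimately show "gcomp M Mg n s \<in> gen_submodule R M {a \<odot>\<^bsub>M\<^esub> x |a x. a \<in> I \<and> x \<in> carrier M}"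
    using gen_submodule_incl[of "{a \<odot>\<^bsub>M\<^esub> x |a x. a \<in> I \<and> x \<in> carrier M}" R M] by auto
qed

lemma graded_colon:
  assumes N: "submodule N R M" "graded_subset M Mg N" and x: "x \<in> Mg d"
  shows "graded_ideal R Rg (colon R M N x)"
  unfolding graded_ideal_iff graded_subset_def
proof (intro conjI ballI allI)
  have xc: "x \<in> carrier M" using x MG.g_carrier by blast
  show "ideal (colon R M N x) R" by (rule ideal_colon[OF N(1) xc])
  fix a n assume "a \<in> colon R M N x"
  then have a: "a \<in> carrier R" "a \<odot>\<^bsub>M\<^esub> x \<in> N" by (auto simp: colon_def)
  have "gcomp R Rg n a \<odot>\<^bsub>M\<^esub> x = gcomp M Mg (int_vec n + d) (a \<odot>\<^bsub>M\<^esub> x)"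
    using gcomp_smult_right[OF x a(1)] by simp
  then show "gcomp R Rg n a \<in> colon R M N x"
    using N(2) a by (simp add: colon_def graded_subset_def)
qed

end

section \<open>Graded primes\<close>

text \<open>A total order on degrees compatible with addition, so that leading components exist and
  multiply; the componentwise order is total only in rank one.\<close>

definition lexless :: "nat ^ 'r::{finite, linorder} \<Rightarrow> nat ^ 'r::{finite, linorder} \<Rightarrow> bool"
  where "lexless m n \<longleftrightarrow> less_fun (vec_nth m) (vec_nth n)"

lemma lexless_trichotomy: "lexless m n \<or> m = n \<or> lexless n m"
  using less_fun_trichotomy[of "vec_nth m" "vec_nth n"] by (auto simp: lexless_def vec_nth_inject)

lemma lexless_trans: "lexless m n \<Longrightarrow> lexless n k \<Longrightarrow> lexless m k"
  unfolding lexless_def by (rule less_fun_trans)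

lemma lexless_irrefl: "\<not> lexless m m"
  unfolding lexless_def by (rule less_fun_irrefl)

text \<open>At the first index where \<open>i\<close> and \<open>m\<close> differ, the smaller entry
  of \<open>i\<close> must be compensated by a larger entry of \<open>j\<close>. This is the
  cancellation behind the product of leading components.\<close>

lemma lexless_of_sum_eq:
  assumes "i + j = m + n" "lexless i m" shows "lexless n j"
proof -
  obtain k where k: "i $ k < m $ k" "\<And>k'. k' < k \<Longrightarrow> i $ k' = m $ k'"
    using assms(2) by (auto simp: lexless_def elim: less_funE)
  have e: "i $ l + j $ l = m $ l + n $ l" for l using assms(1) by (metis vector_add_component)
  have "n $ k < j $ k" using k(1) e[of k] by linarith
  moreover have "n $ k' = j $ k'" if "k' < k" for k' using k(2)[OF that] e[of k'] by linarith
  ultimately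
  show ?thesis unfolding lexless_def by (intro less_funI) blast
qed

lemma lexless_max:
  assumes "finite A" "A \<noteq> {}" shows "\<exists>m\<in>A. \<forall>i\<in>A. i = m \<or> lexless i m"
  using assms
proof (induct rule: finite_ne_induct)
  case (insert x F)
  then obtain m where m: "m \<in> F" "\<forall>i\<in>F. i = m \<or> lexless i m" by blast
  show ?case
  proof (cases "lexless m x")
    case True
    then have "\<forall>i\<in>insert x F. i = x \<or> lexless i x" using m(2) lexless_trans[OF _ True] True by auto
    then show ?thesis by blast
  next
    case False
    then have "\<forall>i\<in>insert x F. i = m \<or> lexless i m" using m(2) lexless_trichotomy[of m x] by blast
    then show ?thesis using m(1) by blast
  qed
qed simp

text \<open>Ring degrees are natural vectors, so \<open>k\<close> need not be of the form
  \<open>i + j\<close>; in that case nothing of \<open>r x\<close> reaches degree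
  \<open>k\<close>.\<close>

lemma (in multigraded_ring) gcomp_mult:
  assumes r: "r \<in> Rg i" and x: "x \<in> carrier R"
  shows "gcomp R Rg k (r \<otimes> x) = \<zero> \<and> (\<nexists>j. k = i + j) \<or> (\<exists>j. k = i + j \<and> gcomp R Rg k (r \<otimes> x) = r \<otimes> gcomp R Rg j x)"
proof -
  have rc: "r \<in> carrier R" using r RG.g_carrier by blast
  have "x \<in> {x \<in> carrier R. (\<forall>j. gcomp R Rg (i + j) (r \<otimes> x) = r \<otimes> gcomp R Rg j x) \<and> 
     (\<forall>k. (\<nexists>j. k = i + j) \<longrightarrow> gcomp R Rg k (r \<otimes> x) = \<zero>)}"
    (is "x \<in> ?H")
  proof (rule RG.mem_if_gcomp_mem[OF x])
    fix m
    let ?y = "gcomp R Rg m x"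
    have y: "?y \<in> Rg m" "?y \<in> carrier R" using x RG.gcomp_in by auto
    have "r \<otimes> ?y \<in> Rg (i + m)" using mult_degree[OF r y(1)] .
    from RG.gcomp_homogeneous[OF this] RG.gcomp_homogeneous[OF y(1)]
    show "?y \<in> ?H" using rc y by auto
  qed (use rc in \<open>auto simp: RG.gcomp_add r_distr\<close>)
  then show ?thesis by (cases "\<exists>j. k = i + j") auto
qed

locale lex_multigraded_ring = multigraded_ring R Rg
  for R (structure) and Rg :: "nat ^ 'r::{finite, linorder} \<Rightarrow> 'a set"
begin

text \<open>If \<open>a\<close> and \<open>b\<close> lie outside \<open>Q\<close>, take their
  lexicographically largest components outside \<open>Q\<close>, in degrees \<open>m\<close> and
  \<open>n\<close>. Modulo \<open>Q\<close>, the component of \<open>a b\<close> in degree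
  \<open>m + n\<close> is the product of these two, to which the homogeneous hypothesis
  applies.\<close>

lemma primeideal_if_prime_on_homogeneous:
  assumes Q: "graded_ideal R Rg Q" and one: "\<one> \<notin> Q"
    and hom: "\<And>a b. homogeneous Rg a \<Longrightarrow> homogeneous Rg b \<Longrightarrow> a \<otimes> b \<in> Q \<Longrightarrow> a \<in> Q \<or> b \<in> Q"
  shows "primeideal Q R"
proof -
  have id: "ideal Q R" and gr: "\<And>x n. x \<in> Q \<Longrightarrow> gcomp R Rg n x \<in> Q"
    using Q by (auto simp: graded_ideal_iff graded_subset_def)
  interpret Q: ideal Q R by (rule id)
  have ex: "\<exists>m. gcomp R Rg m a \<notin> Q \<and> (\<forall>i. gcomp R Rg i a \<notin> Q \<longrightarrow> i = m \<or> lexless i m)"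
    if a: "a \<in> carrier R" "a \<notin> Q" for a
  proof -
    let ?S = "{m. gcomp R Rg m a \<notin> Q}"
    have "finite ?S" by (rule finite_subset[OF _ RG.finite_gcomp[OF a(1)]]) auto
    moreover have "?S \<noteq> {}"
      using RG.mem_if_gcomp_mem[OF a(1), of Q] a(2) by auto
    ultimately show ?thesis using lexless_max[of ?S] by blast
  qed
  have "a \<in> Q \<or> b \<in> Q" if ab: "a \<in> carrier R" "b \<in> carrier R" "a \<otimes> b \<in> Q" for a b
  proof (rule ccontr)
    assume "\<not> (a \<in> Q \<or> b \<in> Q)"
    then have nQ: "a \<notin> Q" "b \<notin> Q" by auto
    obtain m where m: "gcomp R Rg m a \<notin> Q" "\<And>i. gcomp R Rg i a \<notin> Q \<Longrightarrow> i = m \<or> lexless i m"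
      using ex[OF ab(1) nQ(1)] by auto
    obtain n where n: "gcomp R Rg n b \<notin> Q" "\<And>i. gcomp R Rg i b \<notin> Q \<Longrightarrow> i = n \<or> lexless i n"
      using ex[OF ab(2) nQ(2)] by auto
    let ?am = "gcomp R Rg m a"
    define a' where "a' = a \<ominus> ?am"
    have amc: "?am \<in> Rg m" "?am \<in> carrier R" using ab RG.gcomp_in by auto
    then have a'c: "a' \<in> carrier R" using ab by (simp add: a'_def)
    have a'comp: "gcomp R Rg i a' = (if i = m then \<zero> else gcomp R Rg i a)" for i
      using ab amc by (simp add: a'_def RG.gcomp_minus RG.gcomp_homogeneous[OF amc(1)]) (auto simp: a_minus_def r_neg)
    \<comment> \<open>A component of \<open>a'\<close> outside \<open>Q\<close> has degree below
      \<open>m\<close>; its partner in \<open>b\<close> then has degree above \<open>n\<close> and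
      lies in \<open>Q\<close>.\<close>
    have low: "gcomp R Rg (m + n) (a' \<otimes> b) \<in> Q"
    proof -
      have "a' \<in> {x \<in> carrier R. gcomp R Rg (m + n) (x \<otimes> b) \<in> Q}" (is "a' \<in> ?H")
      proof (rule RG.mem_if_gcomp_mem[OF a'c])
        fix i
        let ?y = "gcomp R Rg i a'"
        have y: "?y \<in> Rg i" "?y \<in> carrier R" using a'c RG.gcomp_in by auto
        have "gcomp R Rg (m + n) (?y \<otimes> b) \<in> Q"
        proof (cases "?y \<in> Q")
          case True
          then show ?thesis using gr ab Q.I_r_closed by blast
        next
          case False
          then have "i \<noteq> m" "lexless i m" using a'comp m(2) by (auto split: if_splits)
          show ?thesis
          proof (cases "\<exists>j. m + n = i + j")
            case True
            then obtain j where j: "i + j = m + n" by metis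
            have "lexless n j" using lexless_of_sum_eq[OF j \<open>lexless i m\<close>] .
            then have "gcomp R Rg j b \<in> Q" using n(2) lexless_trans lexless_irrefl by blast
            moreover have "gcomp R Rg (m + n) (?y \<otimes> b) = ?y \<otimes> gcomp R Rg j b"
              using gcomp_mult[OF y(1) ab(2), of "m + n"] j by (metis add_left_cancel)
            ultimately show ?thesis using y Q.I_l_closed by simp
          qed (use gcomp_mult[OF y(1) ab(2), of "m + n"] in auto)
        qed
        then show "?y \<in> ?H" using y by blast
      qed (use ab in \<open>auto simp: RG.gcomp_add l_distr\<close>)
      then show ?thesis by blast
    qed
    have "a = a' \<oplus> ?am" using ab amc by (simp add: a'_def a_minus_def a_assoc l_neg)
    then have "a \<otimes> b = a' \<otimes> b \<oplus> ?am \<otimes> b" using ab amc a'c l_distr by metis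
    then have "gcomp R Rg (m + n) (a \<otimes> b) = gcomp R Rg (m + n) (a' \<otimes> b) \<oplus> gcomp R Rg (m + n) (?am \<otimes> b)"
      using ab amc a'c by (simp add: RG.gcomp_add)
    moreover have "gcomp R Rg (m + n) (?am \<otimes> b) = ?am \<otimes> gcomp R Rg n b"
      using gcomp_mult[OF amc(1) ab(2), of "m + n"] by (metis add_left_cancel)
    ultimately have "gcomp R Rg (m + n) (a' \<otimes> b) \<oplus> ?am \<otimes> gcomp R Rg n b \<in> Q"
      using gr[OF ab(3)] by metis
    then have "?am \<otimes> gcomp R Rg n b \<in> Q"
      using low a'c amc ab by (metis Q.Icarr Q.a_closed Q.a_inv_closed r_neg1 RG.gcomp_closed m_closed)
    moreover have "homogeneous Rg ?am" "homogeneous Rg (gcomp R Rg n b)"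
      using ab RG.gcomp_in by (auto simp: homogeneous_def)
    ultimately show False using hom m(1) n(1) by blast
  qed
  then show ?thesis using id one by (auto intro!: primeidealI is_cring)
qed

end

section \<open>Quotients and localizations\<close>

text \<open>For a submodule \<open>K\<close> containing \<open>N\<close> these are the associated
  primes of \<open>K/N\<close>. The parameter \<open>K\<close> is what varies in the proof of
  finiteness.\<close>

definition colon_primes ::
  "('a, 'x) ring_scheme \<Rightarrow> ('a, 'b, 'y) module_scheme \<Rightarrow> 'b set \<Rightarrow> 'b set \<Rightarrow> 'a set set"
  where "colon_primes R M N K = {P. primeideal P R \<and> (\<exists>x\<in>K. P = colon R M N x)}"

locale submodule_quotient = Module.module R M for R (structure) and M (structure) +
  fixes N assumes sub: "submodule N R M"
begin

lemma additive_subgroup_N: "additive_subgroup N M"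
  using submodule.axioms(1)[OF sub] by (simp add: additive_subgroup_def)

lemma abelian_subgroup_N: "abelian_subgroup N M"
  by (rule abelian_subgroupI3[OF additive_subgroup_N M.abelian_group_axioms])

sublocale N: abelian_subgroup N M by (rule abelian_subgroup_N)

abbreviation "Q \<equiv> quotient_module M N"

lemma carrier_Q: "carrier Q = {N +>\<^bsub>M\<^esub> x | x. x \<in> carrier M}"
  by (auto simp: quotient_module_def A_RCOSETS_def')

lemma coset_in_Q [simp]: "x \<in> carrier M \<Longrightarrow> N +>\<^bsub>M\<^esub> x \<in> carrier Q"
  by (auto simp: carrier_Q)

lemma zero_Q: "\<zero>\<^bsub>Q\<^esub> = N" by (simp add: quotient_module_def)

lemma add_Q: "x \<in> carrier M \<Longrightarrow> y \<in> carrier M \<Longrightarrow>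
    (N +>\<^bsub>M\<^esub> x) \<oplus>\<^bsub>Q\<^esub> (N +>\<^bsub>M\<^esub> y) = N +>\<^bsub>M\<^esub> (x \<oplus>\<^bsub>M\<^esub> y)"
  by (simp add: quotient_module_def N.a_rcos_sum)

lemma coset_eq_iff:
  assumes "x \<in> carrier M" "y \<in> carrier M"
  shows "N +>\<^bsub>M\<^esub> x = N +>\<^bsub>M\<^esub> y \<longleftrightarrow> x \<ominus>\<^bsub>M\<^esub> y \<in> N"
proof
  assume "N +>\<^bsub>M\<^esub> x = N +>\<^bsub>M\<^esub> y"
  then have "x \<in> N +>\<^bsub>M\<^esub> y" using N.a_rcos_self[OF assms(1)] by simp
  then show "x \<ominus>\<^bsub>M\<^esub> y \<in> N" using assms
    N.a_rcos_module[of y x] by (simp add: a_minus_def)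
next
  assume "x \<ominus>\<^bsub>M\<^esub> y \<in> N"
  then have "x \<in> N +>\<^bsub>M\<^esub> y" using N.a_rcos_module[of y x] assms by (simp add: a_minus_def)
  then show "N +>\<^bsub>M\<^esub> x = N +>\<^bsub>M\<^esub> y" using M.a_repr_independence[OF _ _ N.a_subgroup] assms by metis
qed

text \<open>The scalar multiplication of the quotient is a union over all representatives of a
  coset; it is a single coset because all representatives yield the same one.\<close>

lemma smult_Q:
  assumes a: "a \<in> carrier R" and x: "x \<in> carrier M"
  shows "a \<odot>\<^bsub>Q\<^esub> (N +>\<^bsub>M\<^esub> x) = N +>\<^bsub>M\<^esub> (a \<odot>\<^bsub>M\<^esub> x)"
proof -
  have "N +>\<^bsub>M\<^esub> (a \<odot>\<^bsub>M\<^esub> y) = N +>\<^bsub>M\<^esub> (a \<odot>\<^bsub>M\<^esub> x)" if "y \<in> N +>\<^bsub>M\<^esub> x" for y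
  proof -
    have y: "y \<in> carrier M" using that N.a_elemrcos_carrier x by blast
    have "y \<ominus>\<^bsub>M\<^esub> x \<in> N" using that N.a_rcos_module[of x y] x y by (simp add: a_minus_def)
    then have "a \<odot>\<^bsub>M\<^esub> (y \<ominus>\<^bsub>M\<^esub> x) \<in> N" using submoduleE(4)[OF sub] a by blast
    then have "a \<odot>\<^bsub>M\<^esub> y \<ominus>\<^bsub>M\<^esub> a \<odot>\<^bsub>M\<^esub> x \<in> N"
      using a x y by (simp add: a_minus_def smult_r_distr smult_r_minus)
    then show ?thesis using a x y coset_eq_iff by simp
  qed
  moreover have "x \<in> N +>\<^bsub>M\<^esub> x" using N.a_rcos_self[OF x] .
  ultimately have "(\<Union>y\<in>N +>\<^bsub>M\<^esub> x. N +>\<^bsub>M\<^esub> (a \<odot>\<^bsub>M\<^esub> y)) = N +>\<^bsub>M\<^esub> (a \<odot>\<^bsub>M\<^esub> x)" by blast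
  then show ?thesis by (simp only: quotient_module_def module.simps)
qed

lemma module_Q: "Module.module R Q"
proof (rule Module.moduleI)
  show "cring R" by (rule R.is_cring)
  have z: "\<zero>\<^bsub>Q\<^esub> = N +>\<^bsub>M\<^esub> \<zero>\<^bsub>M\<^esub>"
    using N.a_subset by (simp add: zero_Q)
  show "abelian_group Q"
  proof (rule abelian_groupI)
    fix C assume "C \<in> carrier Q"
    then obtain x where x: "C = N +>\<^bsub>M\<^esub> x" "x \<in> carrier M" by (auto simp: carrier_Q)
    show "\<exists>D\<in>carrier Q. D \<oplus>\<^bsub>Q\<^esub> C = \<zero>\<^bsub>Q\<^esub>"
      using x by (intro bexI[of _ "N +>\<^bsub>M\<^esub> (\<ominus>\<^bsub>M\<^esub> x)"]) (auto simp: z add_Q M.l_neg)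
    show "\<zero>\<^bsub>Q\<^esub> \<oplus>\<^bsub>Q\<^esub> C = C" using x by (simp add: z add_Q)
  next
    fix C D assume "C \<in> carrier Q" "D \<in> carrier Q"
    then show "C \<oplus>\<^bsub>Q\<^esub> D = D \<oplus>\<^bsub>Q\<^esub> C" by (auto simp: carrier_Q add_Q M.a_comm simp del: coset_in_Q)
  qed (auto simp: carrier_Q add_Q M.a_assoc z simp del: coset_in_Q)
qed (auto simp: carrier_Q smult_Q add_Q smult_l_distr smult_r_distr smult_assoc1 simp del: coset_in_Q)

lemma annihilator_Q: "x \<in> carrier M \<Longrightarrow> annihilator R Q (N +>\<^bsub>M\<^esub> x) = colon R M N x"
proof -
  assume x: "x \<in> carrier M"
  have "N +>\<^bsub>M\<^esub> y = N \<longleftrightarrow> y \<in> N" if "y \<in> carrier M" for y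
    using that M.a_coset_join1[OF _ that N.a_subgroup] M.a_coset_join2[OF that N.a_subgroup] by blast
  then have "a \<odot>\<^bsub>Q\<^esub> (N +>\<^bsub>M\<^esub> x) = N \<longleftrightarrow> a \<odot>\<^bsub>M\<^esub> x \<in> N" if "a \<in> carrier R" for a
    using x that smult_Q[OF that x] by simp
  then show ?thesis unfolding annihilator_def colon_def zero_Q by blast
qed

lemma Ass_Q: "Ass R Q = colon_primes R M N (carrier M)"
  unfolding Ass_def colon_primes_def carrier_Q using annihilator_Q by fastforce

end

text \<open>A fraction \<open>x/s\<close> has the class of \<open>0/1\<close> exactly when some
  \<open>u\<close> outside \<open>P\<close> kills \<open>x\<close>. So the localization is nonzero
  iff some \<open>x\<close> is killed by nothing outside \<open>P\<close>.\<close>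

lemma (in Module.module) localized_module_nonzero_iff:
  assumes P: "primeideal P R"
  shows "carrier (localized_module R M P) \<noteq> {\<zero>\<^bsub>localized_module R M P\<^esub>} \<longleftrightarrow>
    (\<exists>x\<in>carrier M. \<forall>u\<in>carrier R - P. u \<odot>\<^bsub>M\<^esub> x \<noteq> \<zero>\<^bsub>M\<^esub>)" (is "?l \<longleftrightarrow> ?rhs")
proof -
  interpret P: primeideal P R by (rule P)
  let ?S = "carrier R - P"
  have one: "\<one> \<in> ?S" using P.I_notcarr P.one_imp_carrier by auto
  have mult: "u \<otimes> v \<in> ?S" if "u \<in> ?S" "v \<in> ?S" for u v using that P.I_prime by auto
  let ?r = "fraction_rel R M P"
  have zero_diff: "t \<odot>\<^bsub>M\<^esub> \<zero>\<^bsub>M\<^esub> \<ominus>\<^bsub>M\<^esub> \<one> \<odot>\<^bsub>M\<^esub> y = \<ominus>\<^bsub>M\<^esub> y" if "t \<in> carrier R" "y \<in> carrier M" for t y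
    using that by (simp add: a_minus_def)
  have zero_class: "((\<zero>\<^bsub>M\<^esub>, \<one>), (y, t)) \<in> ?r \<longleftrightarrow> y \<in> carrier M \<and> t \<in> ?S \<and> (\<exists>u\<in>?S. u \<odot>\<^bsub>M\<^esub> y = \<zero>\<^bsub>M\<^esub>)" for y t
  proof -
    have "u \<odot>\<^bsub>M\<^esub> (\<ominus>\<^bsub>M\<^esub> y) = \<zero>\<^bsub>M\<^esub> \<longleftrightarrow> u \<odot>\<^bsub>M\<^esub> y = \<zero>\<^bsub>M\<^esub>" if "u \<in> carrier R" "y \<in> carrier M" for u
      using that by (metis M.add.inv_eq_1_iff smult_closed smult_r_minus)
    then show ?thesis using one zero_diff by (fastforce simp: fraction_rel_def)
  qed
  have class_iff: "?r `` {(x, s)} = ?r `` {(\<zero>\<^bsub>M\<^esub>, \<one>)} \<longleftrightarrow> (\<exists>u\<in>?S. u \<odot>\<^bsub>M\<^esub> x = \<zero>\<^bsub>M\<^esub>)"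
    if x: "x \<in> carrier M" and s: "s \<in> ?S" for x s
  proof
    assume eq: "?r `` {(x, s)} = ?r `` {(\<zero>\<^bsub>M\<^esub>, \<one>)}"
    have "s \<odot>\<^bsub>M\<^esub> x \<ominus>\<^bsub>M\<^esub> s \<odot>\<^bsub>M\<^esub> x = \<zero>\<^bsub>M\<^esub>" using x s by (simp add: a_minus_def M.r_neg)
    then have "((x, s), (x, s)) \<in> ?r" using x s one by (auto simp: fraction_rel_def intro!: bexI[of _ \<one>])
    then have "((\<zero>\<^bsub>M\<^esub>, \<one>), (x, s)) \<in> ?r" using eq by blast
    then show "\<exists>u\<in>?S. u \<odot>\<^bsub>M\<^esub> x = \<zero>\<^bsub>M\<^esub>" using zero_class by blast
  next
    assume "\<exists>u\<in>?S. u \<odot>\<^bsub>M\<^esub> x = \<zero>\<^bsub>M\<^esub>"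
    then obtain u where u: "u \<in> ?S" "u \<odot>\<^bsub>M\<^esub> x = \<zero>\<^bsub>M\<^esub>" by blast
    have "((x, s), (y, t)) \<in> ?r \<longleftrightarrow> ((\<zero>\<^bsub>M\<^esub>, \<one>), (y, t)) \<in> ?r" for y t
    proof (cases "y \<in> carrier M \<and> t \<in> ?S")
      case True
      \<comment> \<open>The factor \<open>u\<close> kills the term with \<open>x\<close>, so only
        the term with \<open>y\<close> survives; comparison of \<open>x/s\<close> with
        \<open>y/t\<close> becomes a condition on \<open>y\<close> alone.\<close>
      have expand: "(v \<otimes> u) \<odot>\<^bsub>M\<^esub> (t \<odot>\<^bsub>M\<^esub> x \<ominus>\<^bsub>M\<^esub> s \<odot>\<^bsub>M\<^esub> y) = \<ominus>\<^bsub>M\<^esub> ((v \<otimes> u \<otimes> s) \<odot>\<^bsub>M\<^esub> y)" if "v \<in> carrier R" for v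
      proof -
        have "(v \<otimes> u) \<odot>\<^bsub>M\<^esub> (t \<odot>\<^bsub>M\<^esub> x) = (v \<otimes> t) \<odot>\<^bsub>M\<^esub> (u \<odot>\<^bsub>M\<^esub> x)"
        proof -
          have "v \<otimes> u \<otimes> t = v \<otimes> t \<otimes> u" using that True u m_ac by simp
          then show ?thesis using that True u x by (metis DiffD1 m_closed smult_assoc1)
        qed
        also have "\<dots> = \<zero>\<^bsub>M\<^esub>" using u that True by simp
        finally show ?thesis
          using that True u x s by (simp add: a_minus_def smult_r_distr smult_r_minus smult_assoc1)
      qed
      show ?thesis
      proof
        assume "((x, s), (y, t)) \<in> ?r"
        then obtain v where v: "v \<in> ?S" "v \<odot>\<^bsub>M\<^esub> (t \<odot>\<^bsub>M\<^esub> x \<ominus>\<^bsub>M\<^esub> s \<odot>\<^bsub>M\<^esub> y) = \<zero>\<^bsub>M\<^esub>"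
          by (auto simp: fraction_rel_def)
        have "(v \<otimes> u) \<odot>\<^bsub>M\<^esub> (t \<odot>\<^bsub>M\<^esub> x \<ominus>\<^bsub>M\<^esub> s \<odot>\<^bsub>M\<^esub> y) = u \<odot>\<^bsub>M\<^esub> (v \<odot>\<^bsub>M\<^esub> (t \<odot>\<^bsub>M\<^esub> x \<ominus>\<^bsub>M\<^esub> s \<odot>\<^bsub>M\<^esub> y))"
          using v(1) u s x True by (simp add: smult_assoc1[symmetric] m_comm[of u v])
        then have "\<ominus>\<^bsub>M\<^esub> ((v \<otimes> u \<otimes> s) \<odot>\<^bsub>M\<^esub> y) = \<zero>\<^bsub>M\<^esub>" using v u expand by simp
        moreover have S: "v \<otimes> u \<otimes> s \<in> ?S" using v u s mult by blast
        ultimately have "(v \<otimes> u \<otimes> s) \<odot>\<^bsub>M\<^esub> y = \<zero>\<^bsub>M\<^esub>"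
          using True by (metis DiffD1 M.add.inv_eq_1_iff smult_closed)
        then show "((\<zero>\<^bsub>M\<^esub>, \<one>), (y, t)) \<in> ?r" using S True zero_class by blast
      next
        assume "((\<zero>\<^bsub>M\<^esub>, \<one>), (y, t)) \<in> ?r"
        then obtain v where v: "v \<in> ?S" "v \<odot>\<^bsub>M\<^esub> y = \<zero>\<^bsub>M\<^esub>" using zero_class by blast
        have "(v \<otimes> u \<otimes> s) \<odot>\<^bsub>M\<^esub> y = (u \<otimes> s) \<odot>\<^bsub>M\<^esub> (v \<odot>\<^bsub>M\<^esub> y)"
        proof -
          have "v \<otimes> u \<otimes> s = u \<otimes> s \<otimes> v" using v(1) s u m_ac by simp
          then show ?thesis using v(1) s u True by (metis DiffD1 m_closed smult_assoc1)
        qed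
        then have "(v \<otimes> u) \<odot>\<^bsub>M\<^esub> (t \<odot>\<^bsub>M\<^esub> x \<ominus>\<^bsub>M\<^esub> s \<odot>\<^bsub>M\<^esub> y) = \<zero>\<^bsub>M\<^esub>"
          using expand v u s by simp
        moreover have "v \<otimes> u \<in> ?S" using mult v u by blast
        ultimately show "((x, s), (y, t)) \<in> ?r" using x s True unfolding fraction_rel_def by blast
      qed
    qed (auto simp: fraction_rel_def)
    then show "?r `` {(x, s)} = ?r `` {(\<zero>\<^bsub>M\<^esub>, \<one>)}" by auto
  qed
  have c: "carrier (localized_module R M P) = {?r `` {(x, s)} | x s. x \<in> carrier M \<and> s \<in> ?S}"
    by (auto simp: localized_module_def quotient_def)
  have z: "\<zero>\<^bsub>localized_module R M P\<^esub> = ?r `` {(\<zero>\<^bsub>M\<^esub>, \<one>)}" by (simp add: localized_module_def)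
  have "?r `` {(\<zero>\<^bsub>M\<^esub>, \<one>)} \<in> carrier (localized_module R M P)" using one unfolding c by blast
  then have "?l \<longleftrightarrow> (\<exists>C\<in>carrier (localized_module R M P). C \<noteq> ?r `` {(\<zero>\<^bsub>M\<^esub>, \<one>)})"
    unfolding z by blast
  also have "\<dots> \<longleftrightarrow> (\<exists>x s. x \<in> carrier M \<and> s \<in> ?S \<and> ?r `` {(x, s)} \<noteq> ?r `` {(\<zero>\<^bsub>M\<^esub>, \<one>)})"
    unfolding c by blast
  also have "\<dots> \<longleftrightarrow> (\<exists>x s. x \<in> carrier M \<and> s \<in> ?S \<and> (\<forall>u\<in>?S. u \<odot>\<^bsub>M\<^esub> x \<noteq> \<zero>\<^bsub>M\<^esub>))"
    by (intro ex_cong1 conj_cong refl) (simp add: class_iff)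
  also have "\<dots> \<longleftrightarrow> ?rhs" using one by blast
  finally show ?thesis .
qed

lemma (in Module.module) Ass_quotient_module:
  assumes "submodule N R M"
  shows "Ass R (quotient_module M N) = colon_primes R M N (carrier M)"
proof -
  interpret submodule_quotient R M N
    by (intro submodule_quotient.intro submodule_quotient_axioms.intro assms module_axioms)
  show ?thesis by (rule Ass_Q)
qed

lemma (in Module.module) Supp_pp_quotient_module:
  assumes "submodule N R M"
  shows "P \<in> Supp_pp R Rg (quotient_module M N) \<longleftrightarrow> primeideal P R \<and> graded_ideal R Rg P \<and>
    \<not> irrelevant_ideal R Rg \<subseteq> P \<and> (\<exists>x\<in>carrier M. colon R M N x \<subseteq> P)"
proof (cases "primeideal P R")
  case True
  interpret submodule_quotient R M N
    by (intro submodule_quotient.intro submodule_quotient_axioms.intro assms module_axioms)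
  have eq: "colon R M N x = {u \<in> carrier R. u \<odot>\<^bsub>Q\<^esub> (N +>\<^bsub>M\<^esub> x) = \<zero>\<^bsub>Q\<^esub>}" if "x \<in> carrier M" for x
    using annihilator_Q[OF that] by (simp add: annihilator_def)
  have "(\<exists>C\<in>carrier Q. \<forall>u\<in>carrier R - P. u \<odot>\<^bsub>Q\<^esub> C \<noteq> \<zero>\<^bsub>Q\<^esub>) \<longleftrightarrow> (\<exists>x\<in>carrier M. colon R M N x \<subseteq> P)"
    unfolding carrier_Q using eq by fastforce
  then show ?thesis
    using module.localized_module_nonzero_iff[OF module_Q True] True by (auto simp: Supp_pp_def)
qed (simp add: Supp_pp_def)

section \<open>Noetherian modules\<close>

text \<open>Without a maximal member above \<open>A\<close>, dependent choice would give a strictly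
  increasing sequence. Stated for families of plain sets so as to serve both ideals of
  \<open>R\<close> and submodules of \<open>M\<close>.\<close>

lemma maximal_of_stable_sequences:
  assumes stable: "\<And>N :: nat \<Rightarrow> 'c set. (\<And>n. N n \<in> F) \<Longrightarrow> (\<And>n. N n \<subseteq> N (Suc n)) \<Longrightarrow> \<exists>k. \<forall>n\<ge>k. N n = N k"
    and A: "A \<in> F"
  shows "\<exists>K\<in>F. A \<subseteq> K \<and> (\<forall>K'\<in>F. K \<subseteq> K' \<longrightarrow> K' = K)"
proof (rule ccontr)
  assume "\<not> ?thesis"
  then have neg: "\<forall>K\<in>F. A \<subseteq> K \<longrightarrow> (\<exists>K'\<in>F. K \<subseteq> K' \<and> K' \<noteq> K)" by simp
  have step: "\<exists>K'. (K' \<in> F \<and> A \<subseteq> K') \<and> K \<subset> K'" if K: "K \<in> F \<and> A \<subseteq> K" for K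
  proof -
    have "A \<subseteq> K \<longrightarrow> (\<exists>K'\<in>F. K \<subseteq> K' \<and> K' \<noteq> K)" using bspec[OF neg conjunct1[OF K]] .
    then obtain K' where K': "K' \<in> F" "K \<subseteq> K'" "K' \<noteq> K" using K by (elim impE bexE conjE) simp
    have "A \<subseteq> K'" using K K'(2) by (elim conjE) (rule subset_trans)
    then show ?thesis using K' by (intro exI[of _ K'] conjI psubsetI) simp_all
  qed
  have "\<exists>f. \<forall>n. (f n \<in> F \<and> A \<subseteq> f n) \<and> f n \<subset> f (Suc n)"
    by (rule dependent_nat_choice) (use A step in auto)
  then obtain f :: "nat \<Rightarrow> 'c set" where f: "\<And>n. f n \<in> F" "\<And>n. f n \<subset> f (Suc n)" by blast
  then obtain k where "\<forall>n\<ge>k. f n = f k" using stable[of f] by blast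
  then show False using f(2)[of k] by (metis le_SucI less_irrefl order_refl)
qed

lemma (in noetherian_ring) ideal_seq_stable:
  fixes I :: "nat \<Rightarrow> 'a set"
  assumes id: "\<And>n. ideal (I n) R" and mono: "\<And>n. I n \<subseteq> I (Suc n)"
  shows "\<exists>k. \<forall>n\<ge>k. I n = I k"
proof -
  have m: "m \<le> n \<Longrightarrow> I m \<subseteq> I n" for m n using lift_Suc_mono_le[of I] mono by blast
  have "subset.chain {I. ideal I R} (range I)"
    unfolding subset_chain_def using id m by (auto simp: image_def) (metis nle_le subsetD)
  then have "\<Union>(range I) \<in> range I" by (intro ideal_chain_is_trivial) auto
  then obtain k where "\<Union>(range I) = I k" by blast
  then show ?thesis using m by blast
qed

lemma (in noetherian_ring) ideal_maximal:
  assumes "A \<in> F" "\<And>I. I \<in> F \<Longrightarrow> ideal I R"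
  shows "\<exists>K\<in>F. A \<subseteq> K \<and> (\<forall>K'\<in>F. K \<subseteq> K' \<longrightarrow> K' = K)"
  by (rule maximal_of_stable_sequences[OF ideal_seq_stable assms(1)]) (use assms(2) in blast)+

text \<open>The span is built one generator at a time, the shape required for induction on the
  number of generators.\<close>

fun lincombs :: "('a, 'x) ring_scheme \<Rightarrow> ('a, 'b, 'y) module_scheme \<Rightarrow> 'b list \<Rightarrow> 'b set" where
  "lincombs R M [] = {\<zero>\<^bsub>M\<^esub>}"
| "lincombs R M (x # xs) = {r \<odot>\<^bsub>M\<^esub> x \<oplus>\<^bsub>M\<^esub> s | r s. r \<in> carrier R \<and> s \<in> lincombs R M xs}"

context Module.module begin

lemma add_add_add: "a \<in> carrier M \<Longrightarrow> b \<in> carrier M \<Longrightarrow> c \<in> carrier M \<Longrightarrow> d \<in> carrier M \<Longrightarrow>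
   (a \<oplus>\<^bsub>M\<^esub> b) \<oplus>\<^bsub>M\<^esub> (c \<oplus>\<^bsub>M\<^esub> d) = (a \<oplus>\<^bsub>M\<^esub> c) \<oplus>\<^bsub>M\<^esub> (b \<oplus>\<^bsub>M\<^esub> d)"
  by (simp add: M.a_ac)

lemma submodule_add_cyclic:
  assumes N: "submodule N R M" and x: "x \<in> carrier M"
  shows "submodule {r \<odot>\<^bsub>M\<^esub> x \<oplus>\<^bsub>M\<^esub> s | r s. r \<in> carrier R \<and> s \<in> N} R M" (is "submodule ?S R M")
    and "N \<subseteq> {r \<odot>\<^bsub>M\<^esub> x \<oplus>\<^bsub>M\<^esub> s | r s. r \<in> carrier R \<and> s \<in> N}"
    and "x \<in> {r \<odot>\<^bsub>M\<^esub> x \<oplus>\<^bsub>M\<^esub> s | r s. r \<in> carrier R \<and> s \<in> N}"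
proof -
  note N' = N[unfolded submodule_iff]
  have Nc: "s \<in> carrier M" if "s \<in> N" for s using N' that by blast
  show incl: "N \<subseteq> ?S"
  proof
    fix s assume "s \<in> N"
    then have "s = \<zero> \<odot>\<^bsub>M\<^esub> x \<oplus>\<^bsub>M\<^esub> s" "s \<in> N" using x Nc by auto
    then show "s \<in> ?S" by blast
  qed
  have "x = \<one> \<odot>\<^bsub>M\<^esub> x \<oplus>\<^bsub>M\<^esub> \<zero>\<^bsub>M\<^esub>" using x by simp
  then show "x \<in> ?S" using N' by blast
  show "submodule ?S R M"
    unfolding submodule_iff
  proof (intro conjI ballI)
    show "?S \<subseteq> carrier M" using x Nc by auto
    show "\<zero>\<^bsub>M\<^esub> \<in> ?S" using incl N' by blast
    fix a b assume "a \<in> ?S" "b \<in> ?S"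
    then obtain r s r' s' where e: "a = r \<odot>\<^bsub>M\<^esub> x \<oplus>\<^bsub>M\<^esub> s" "b = r' \<odot>\<^bsub>M\<^esub> x \<oplus>\<^bsub>M\<^esub> s'"
      "r \<in> carrier R" "r' \<in> carrier R" "s \<in> N" "s' \<in> N" by blast
    have "a \<oplus>\<^bsub>M\<^esub> b = (r \<oplus> r') \<odot>\<^bsub>M\<^esub> x \<oplus>\<^bsub>M\<^esub> (s \<oplus>\<^bsub>M\<^esub> s')"
      using e x Nc by (simp add: smult_l_distr add_add_add)
    then show "a \<oplus>\<^bsub>M\<^esub> b \<in> ?S" using e N' by blast
  next
    fix c a assume c: "c \<in> carrier R" "a \<in> ?S"
    then obtain r s where e: "a = r \<odot>\<^bsub>M\<^esub> x \<oplus>\<^bsub>M\<^esub> s" "r \<in> carrier R" "s \<in> N" by blast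
    have "c \<odot>\<^bsub>M\<^esub> a = (c \<otimes> r) \<odot>\<^bsub>M\<^esub> x \<oplus>\<^bsub>M\<^esub> c \<odot>\<^bsub>M\<^esub> s"
      using e x Nc c by (simp add: smult_r_distr smult_assoc1)
    then show "c \<odot>\<^bsub>M\<^esub> a \<in> ?S" using e N' c by blast
  qed
qed

lemma submodule_zero: "submodule {\<zero>\<^bsub>M\<^esub>} R M"
  by (auto simp: submodule_iff)

lemma submodule_lincombs: "set xs \<subseteq> carrier M \<Longrightarrow> submodule (lincombs R M xs) R M"
  by (induct xs) (auto simp: submodule_zero intro: submodule_add_cyclic(1))

lemma set_subset_lincombs: "set xs \<subseteq> carrier M \<Longrightarrow> set xs \<subseteq> lincombs R M xs"
proof (induct xs)
  case (Cons x xs)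
  have s: "submodule (lincombs R M xs) R M" using Cons by (intro submodule_lincombs) auto
  then show ?case using Cons submodule_add_cyclic(2,3)[OF s, of x] by simp
qed simp

end

locale fg_module = Module.module R M for R (structure) and M (structure) +
  assumes noetherian: "noetherian_ring R" and fg: "finitely_generated_module R M"
begin

text \<open>Adding one generator \<open>x\<close>, a submodule of \<open>R x + L\<close> is
  controlled by its intersection with \<open>L\<close> and by the ideal of coefficients of
  \<open>x\<close>; both sequences become stable.\<close>

lemma submodule_seq_stable_lincombs:
  assumes "set xs \<subseteq> carrier M" "\<And>n. submodule (N n) R M" "\<And>n. N n \<subseteq> N (Suc n)"
  shows "\<exists>k. \<forall>n\<ge>k. N n \<inter> lincombs R M xs = N k \<inter> lincombs R M xs"
  using assms(1)
proof (induct xs)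
  case Nil
  have "\<zero>\<^bsub>M\<^esub> \<in> N n" for n using assms(2)[of n] by (simp add: submodule_iff)
  then show ?case by auto
next
  case (Cons x xs)
  let ?L = "lincombs R M xs"
  have x: "x \<in> carrier M" and L: "submodule ?L R M" using Cons by (auto intro: submodule_lincombs)
  note L' = L[unfolded submodule_iff]
  have m: "m \<le> n \<Longrightarrow> N m \<subseteq> N n" for m n using lift_Suc_mono_le[of N] assms(3) by blast
  obtain k1 where k1: "\<And>n. n \<ge> k1 \<Longrightarrow> N n \<inter> ?L = N k1 \<inter> ?L" using Cons by auto
  \<comment> \<open>The coefficients of \<open>x\<close> in elements of \<open>N n\<close> that lie
    in \<open>R x + L\<close>.\<close>
  let ?J = "\<lambda>n. {r \<in> carrier R. r \<odot>\<^bsub>M\<^esub> x \<in> {y \<in> carrier M. \<exists>s\<in>?L. y \<oplus>\<^bsub>M\<^esub> s \<in> N n}}"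
  have "ideal (?J n) R" for n
  proof (rule ideal_smult_mem[OF _ x])
    note N' = assms(2)[of n, unfolded submodule_iff]
    show "submodule {y \<in> carrier M. \<exists>s\<in>?L. y \<oplus>\<^bsub>M\<^esub> s \<in> N n} R M"
      unfolding submodule_iff
    proof (intro conjI ballI)
      show "\<zero>\<^bsub>M\<^esub> \<in> {y \<in> carrier M. \<exists>s\<in>?L. y \<oplus>\<^bsub>M\<^esub> s \<in> N n}" using L' N' by force
      fix a b assume "a \<in> {y \<in> carrier M. \<exists>s\<in>?L. y \<oplus>\<^bsub>M\<^esub> s \<in> N n}" "b \<in> {y \<in> carrier M. \<exists>s\<in>?L. y \<oplus>\<^bsub>M\<^esub> s \<in> N n}"
      then obtain s t where st: "a \<in> carrier M" "b \<in> carrier M" "s \<in> ?L" "t \<in> ?L" "a \<oplus>\<^bsub>M\<^esub> s \<in> N n" "b \<oplus>\<^bsub>M\<^esub> t \<in> N n" by blast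
      then have "(a \<oplus>\<^bsub>M\<^esub> b) \<oplus>\<^bsub>M\<^esub> (s \<oplus>\<^bsub>M\<^esub> t) = (a \<oplus>\<^bsub>M\<^esub> s) \<oplus>\<^bsub>M\<^esub> (b \<oplus>\<^bsub>M\<^esub> t)"
        using L' by (intro add_add_add) auto
      then show "a \<oplus>\<^bsub>M\<^esub> b \<in> {y \<in> carrier M. \<exists>s\<in>?L. y \<oplus>\<^bsub>M\<^esub> s \<in> N n}"
        using st L' N' by (intro CollectI conjI bexI[of _ "s \<oplus>\<^bsub>M\<^esub> t"]) auto
    next
      fix r a assume r: "r \<in> carrier R" "a \<in> {y \<in> carrier M. \<exists>s\<in>?L. y \<oplus>\<^bsub>M\<^esub> s \<in> N n}"
      then obtain s where s: "a \<in> carrier M" "s \<in> ?L" "a \<oplus>\<^bsub>M\<^esub> s \<in> N n" by blast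
      have "r \<odot>\<^bsub>M\<^esub> a \<oplus>\<^bsub>M\<^esub> r \<odot>\<^bsub>M\<^esub> s = r \<odot>\<^bsub>M\<^esub> (a \<oplus>\<^bsub>M\<^esub> s)" using s r L' by (subst smult_r_distr) auto
      then show "r \<odot>\<^bsub>M\<^esub> a \<in> {y \<in> carrier M. \<exists>s\<in>?L. y \<oplus>\<^bsub>M\<^esub> s \<in> N n}"
        using r s L' N' by (intro CollectI conjI bexI[of _ "r \<odot>\<^bsub>M\<^esub> s"]) auto
    qed auto
  qed
  moreover have "?J n \<subseteq> ?J (Suc n)" for n using assms(3) by blast
  ultimately obtain k2 where k2: "\<And>n. n \<ge> k2 \<Longrightarrow> ?J n = ?J k2"
    using noetherian_ring.ideal_seq_stable[OF noetherian, of ?J] by blast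
  let ?k = "max k1 k2"
  have "N n \<inter> lincombs R M (x # xs) \<subseteq> N ?k" if n: "n \<ge> ?k" for n
  proof
    fix y assume y: "y \<in> N n \<inter> lincombs R M (x # xs)"
    then obtain r s where rs: "y = r \<odot>\<^bsub>M\<^esub> x \<oplus>\<^bsub>M\<^esub> s" "r \<in> carrier R" "s \<in> ?L" by auto
    then have "r \<in> ?J n" using y x by auto
    moreover have "?J n = ?J ?k" using k2[of n] k2[OF max.cobounded2] n by simp
    ultimately have "r \<in> ?J ?k" by (rule subst[rotated])
    then obtain t where t: "t \<in> ?L" "r \<odot>\<^bsub>M\<^esub> x \<oplus>\<^bsub>M\<^esub> t \<in> N ?k" by blast
    have c: "s \<in> carrier M" "t \<in> carrier M" "r \<odot>\<^bsub>M\<^esub> x \<in> carrier M" using t rs L' x by auto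
    \<comment> \<open>Subtracting an element of \<open>N ?k\<close> with the same coefficient of
      \<open>x\<close> leaves an element of \<open>N n\<close> inside \<open>L\<close>, where the
      induction hypothesis applies.\<close>
    have yst: "y = (r \<odot>\<^bsub>M\<^esub> x \<oplus>\<^bsub>M\<^esub> t) \<oplus>\<^bsub>M\<^esub> (s \<ominus>\<^bsub>M\<^esub> t)"
      using c rs(1) by (simp add: a_minus_def M.a_ac M.r_neg1 M.r_neg2)
    have "s \<ominus>\<^bsub>M\<^esub> t \<in> N n"
      by (rule submodule_add_cancel[OF assms(2), of "r \<odot>\<^bsub>M\<^esub> x \<oplus>\<^bsub>M\<^esub> t"]) (use t m[OF n] c y yst in auto)
    moreover have "s \<ominus>\<^bsub>M\<^esub> t \<in> ?L" by (rule submodule_minus[OF L rs(3) t(1)])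
    ultimately have "s \<ominus>\<^bsub>M\<^esub> t \<in> N ?k" using k1[of n] k1[of ?k] n by auto
    then show "y \<in> N ?k" using yst t(2) assms(2)[of ?k] by (auto simp: submodule_iff)
  qed
  then show ?case using m by blast
qed

lemma submodule_seq_stable:
  assumes "\<And>n. submodule (N n) R M" "\<And>n. N n \<subseteq> N (Suc n)"
  shows "\<exists>k. \<forall>n\<ge>k. N n = N k"
proof -
  obtain S where S: "S \<subseteq> carrier M" "finite S" "gen_submodule R M S = carrier M"
    using fg by (auto simp: finitely_generated_module_def)
  then obtain xs where xs: "set xs = S" using finite_list by blast
  have "gen_submodule R M S \<subseteq> lincombs R M xs"
    using xs S(1) by (intro gen_submodule_least submodule_lincombs) (auto dest: set_subset_lincombs)
  then have sub: "carrier M \<subseteq> lincombs R M xs" using S by simp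
  have "N n \<subseteq> carrier M" for n using assms(1)[of n] by (simp add: submodule_iff)
  then have "N n \<inter> lincombs R M xs = N n" for n using sub by blast
  then show ?thesis using submodule_seq_stable_lincombs[of xs N] xs S(1) assms by simp
qed

lemma submodule_maximal:
  assumes "A \<in> F" "\<And>I. I \<in> F \<Longrightarrow> submodule I R M"
  shows "\<exists>K\<in>F. A \<subseteq> K \<and> (\<forall>K'\<in>F. K \<subseteq> K' \<longrightarrow> K' = K)"
  by (rule maximal_of_stable_sequences[OF submodule_seq_stable assms(1)]) (use assms(2) in blast)+

lemma colon_maximal:
  assumes y: "y0 \<in> Y" and Y: "Y \<subseteq> carrier M" and N: "submodule N R M"
  shows "\<exists>y\<in>Y. \<forall>z\<in>Y. colon R M N y \<subseteq> colon R M N z \<longrightarrow> colon R M N z = colon R M N y"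
proof -
  have "\<exists>K\<in>colon R M N ` Y. colon R M N y0 \<subseteq> K \<and> (\<forall>K'\<in>colon R M N ` Y. K \<subseteq> K' \<longrightarrow> K' = K)"
    by (rule noetherian_ring.ideal_maximal[OF noetherian]) (use y Y ideal_colon[OF N] in auto)
  then obtain K where "K \<in> colon R M N ` Y" and r: "\<forall>K'\<in>colon R M N ` Y. K \<subseteq> K' \<longrightarrow> K' = K"
    by (elim bexE conjE)
  then obtain z where "z \<in> Y" "K = colon R M N z" by (elim imageE)
  then show ?thesis using r by (intro bexI[of _ z]) simp_all
qed

text \<open>Among the elements outside \<open>N\<close> choose \<open>y\<close> with maximal colon.
  If \<open>a y\<close> is outside \<open>N\<close>, then \<open>(N : a y)\<close> contains
  \<open>(N : y)\<close> and so equals it, whence \<open>a b\<close> in the colon forces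
  \<open>b\<close> into it.\<close>

lemma exists_prime_colon:
  assumes N: "submodule N R M" and ne: "N \<noteq> carrier M"
  shows "\<exists>y\<in>carrier M. y \<notin> N \<and> primeideal (colon R M N y) R"
proof -
  obtain y0 where y0: "y0 \<in> carrier M - N" using ne N by (auto simp: submodule_iff)
  from colon_maximal[OF y0 _ N] obtain y where y: "y \<in> carrier M - N"
    and max: "\<And>z. z \<in> carrier M - N \<Longrightarrow> colon R M N y \<subseteq> colon R M N z \<Longrightarrow> colon R M N z = colon R M N y"
    by blast
  have "primeideal (colon R M N y) R"
  proof (rule primeidealI)
    show "ideal (colon R M N y) R" using y by (intro ideal_colon[OF N]) auto
    show "cring R" by (rule R.is_cring)
    have "\<one> \<notin> colon R M N y" using y by (simp add: colon_def)
    then show "carrier R \<noteq> colon R M N y" by blast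
    fix a b assume ab: "a \<in> carrier R" "b \<in> carrier R" "a \<otimes> b \<in> colon R M N y"
    show "a \<in> colon R M N y \<or> b \<in> colon R M N y"
    proof (cases "a \<odot>\<^bsub>M\<^esub> y \<in> N")
      case True
      then show ?thesis using ab by (simp add: colon_def)
    next
      case False
      then have "colon R M N (a \<odot>\<^bsub>M\<^esub> y) = colon R M N y"
        using ab y colon_smult_mono[OF N, of y a] by (intro max) auto
      moreover have "b \<in> colon R M N (a \<odot>\<^bsub>M\<^esub> y)"
        using ab y by (auto simp: colon_def smult_assoc1[symmetric] R.m_comm)
      ultimately show ?thesis by blast
    qed
  qed
  then show ?thesis using y by blast
qed

text \<open>The cyclic module generated by the class of \<open>x\<close> is \<open>R/P\<close> with
  \<open>P\<close> prime, and every nonzero element of \<open>R/P\<close> has annihilator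
  \<open>P\<close>.\<close>

lemma colon_smult_prime:
  assumes "primeideal (colon R M N x) R" "x \<in> carrier M" "a \<in> carrier R" "a \<notin> colon R M N x"
    and N: "submodule N R M"
  shows "colon R M N (a \<odot>\<^bsub>M\<^esub> x) = colon R M N x"
proof
  show "colon R M N (a \<odot>\<^bsub>M\<^esub> x) \<subseteq> colon R M N x"
  proof
    fix b assume "b \<in> colon R M N (a \<odot>\<^bsub>M\<^esub> x)"
    then have "b \<in> carrier R" "b \<otimes> a \<in> colon R M N x" using assms by (auto simp: colon_def smult_assoc1)
    then show "b \<in> colon R M N x" using primeideal.I_prime[OF assms(1)] assms by blast
  qed
qed (rule colon_smult_mono[OF N assms(2,3)])

text \<open>Extending a submodule K by a cyclic module whose image in M/K is R/P adds at most the prime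
  P to the primes of the form (N : z) with z in K.\<close>

lemma finite_colon_primes:
  assumes N: "submodule N R M"
  shows "finite (colon_primes R M N (carrier M))"
proof -
  let ?F = "{K. submodule K R M \<and> N \<subseteq> K \<and> finite (colon_primes R M N K)}"
  note N' = N[unfolded submodule_iff]
  have "colon_primes R M N N = {}"
  proof -
    have "colon R M N x = carrier R" if "x \<in> N" for x using that N' by (auto simp: colon_def)
    then show ?thesis using primeideal.I_notcarr by (fastforce simp: colon_primes_def)
  qed
  then have "N \<in> ?F" using N by simp
  then have "\<exists>K\<in>?F. N \<subseteq> K \<and> (\<forall>K'\<in>?F. K \<subseteq> K' \<longrightarrow> K' = K)" by (rule submodule_maximal) simp
  then obtain K where K: "K \<in> ?F" and maxK: "\<forall>K'\<in>?F. K \<subseteq> K' \<longrightarrow> K' = K" by (elim bexE conjE)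
  have max: "K' = K" if "K' \<in> ?F" "K \<subseteq> K'" for K' using maxK that by simp
  have Ks: "submodule K R M" using K by blast
  note K' = Ks[unfolded submodule_iff]
  have "K = carrier M"
  proof (rule ccontr)
    assume "K \<noteq> carrier M"
    then obtain y where y: "y \<in> carrier M" "y \<notin> K" "primeideal (colon R M K y) R"
      using exists_prime_colon[OF Ks] by blast
    let ?K' = "{r \<odot>\<^bsub>M\<^esub> y \<oplus>\<^bsub>M\<^esub> s | r s. r \<in> carrier R \<and> s \<in> K}"
    note s = submodule_add_cyclic[OF Ks y(1)]
    have "colon_primes R M N ?K' \<subseteq> insert (colon R M K y) (colon_primes R M N K)"
    proof
      fix Q assume "Q \<in> colon_primes R M N ?K'"
      then obtain z where z: "primeideal Q R" "z \<in> ?K'" "Q = colon R M N z" unfolding colon_primes_def by blast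
      have zc: "z \<in> carrier M" using z(2) s(1) by (auto simp only: submodule_iff)
      \<comment> \<open>If some multiple of \<open>z\<close> lies in \<open>K\<close> but not in
        \<open>N\<close>, it has the same prime colon as \<open>z\<close>, which is thus counted for
        \<open>K\<close>. Otherwise \<open>(N : z) = (K : z)\<close>, and modulo \<open>K\<close>
        the element \<open>z\<close> is a multiple \<open>c y\<close>, whose colon is the prime
        \<open>(K : y)\<close>.\<close>
      show "Q \<in> insert (colon R M K y) (colon_primes R M N K)"
      proof (cases "\<exists>a\<in>carrier R. a \<odot>\<^bsub>M\<^esub> z \<in> K \<and> a \<odot>\<^bsub>M\<^esub> z \<notin> N")
        case True
        then obtain a where a: "a \<in> carrier R" "a \<odot>\<^bsub>M\<^esub> z \<in> K" "a \<odot>\<^bsub>M\<^esub> z \<notin> N" by blast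
        then have "colon R M N (a \<odot>\<^bsub>M\<^esub> z) = Q"
          unfolding z(3) using z zc by (intro colon_smult_prime N) (auto simp: colon_def)
        then have "Q \<in> colon_primes R M N K" using z(1) a(2) by (auto simp: colon_primes_def)
        then show ?thesis by blast
      next
        case False
        obtain c n where c: "z = c \<odot>\<^bsub>M\<^esub> y \<oplus>\<^bsub>M\<^esub> n" "c \<in> carrier R" "n \<in> K" using z(2) by blast
        have nc: "n \<in> carrier M" using c K' by blast
        have iff: "a \<odot>\<^bsub>M\<^esub> z \<in> K \<longleftrightarrow> a \<odot>\<^bsub>M\<^esub> (c \<odot>\<^bsub>M\<^esub> y) \<in> K" if a: "a \<in> carrier R" for a
        proof -
          have e: "a \<odot>\<^bsub>M\<^esub> z = a \<odot>\<^bsub>M\<^esub> n \<oplus>\<^bsub>M\<^esub> a \<odot>\<^bsub>M\<^esub> (c \<odot>\<^bsub>M\<^esub> y)"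
            using a c nc y by (simp add: smult_r_distr M.a_comm)
          have an: "a \<odot>\<^bsub>M\<^esub> n \<in> K" using a c K' by blast
          have ac: "a \<odot>\<^bsub>M\<^esub> (c \<odot>\<^bsub>M\<^esub> y) \<in> carrier M" using a c y by simp
          show ?thesis
          proof
            assume "a \<odot>\<^bsub>M\<^esub> z \<in> K"
            then show "a \<odot>\<^bsub>M\<^esub> (c \<odot>\<^bsub>M\<^esub> y) \<in> K" unfolding e by (rule submodule_add_cancel[OF Ks an ac])
          next
            assume "a \<odot>\<^bsub>M\<^esub> (c \<odot>\<^bsub>M\<^esub> y) \<in> K"
            then show "a \<odot>\<^bsub>M\<^esub> z \<in> K" unfolding e by (rule submoduleE(5)[OF Ks an])
          qed
        qed
        have "Q = colon R M K z" using False z(3) K by (auto simp: colon_def)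
        also have "\<dots> = colon R M K (c \<odot>\<^bsub>M\<^esub> y)" using iff by (auto simp: colon_def)
        finally have Q: "Q = colon R M K (c \<odot>\<^bsub>M\<^esub> y)" .
        have "c \<notin> colon R M K y"
        proof
          assume "c \<in> colon R M K y"
          then have "c \<odot>\<^bsub>M\<^esub> y \<in> K" by (simp add: colon_def)
          then have "Q = carrier R" unfolding Q using K' by (auto simp: colon_def)
          then show False using primeideal.I_notcarr[OF z(1)] by simp
        qed
        then have "Q = colon R M K y" unfolding Q using y c(2) by (intro colon_smult_prime Ks) auto
        then show ?thesis by blast
      qed
    qed
    then have "finite (colon_primes R M N ?K')" using K finite_subset by auto
    then have "?K' \<in> ?F" using s(1,2) K by blast
    then have "?K' = K" using max s(2) by blast
    then show False using s(3) y(2) by blast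
  qed
  then show ?thesis using K by simp
qed

end

section \<open>Standard rings over a local ring\<close>

lemma (in cring) exists_maximalideal:
  assumes I: "ideal I R" "\<one> \<notin> I"
  shows "\<exists>J. maximalideal J R \<and> I \<subseteq> J"
proof -
  let ?F = "{J. ideal J R \<and> I \<subseteq> J \<and> \<one> \<notin> J}"
  have "\<exists>J\<in>?F. \<forall>V\<in>?F. J \<subseteq> V \<longrightarrow> V = J"
  proof (rule subset_Zorn_nonempty)
    show "?F \<noteq> {}" using I by blast
    fix C assume C: "C \<noteq> {}" "subset.chain ?F C"
    then have "subset.chain {J. ideal J R} C" by (auto simp: subset_chain_def)
    from chain_Union_is_ideal[OF this] C(1) have "ideal (\<Union>C) R" by simp
    then show "\<Union>C \<in> ?F" using C by (auto simp: subset_chain_def)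
  qed
  then obtain J where JF: "J \<in> ?F" and max: "\<forall>V\<in>?F. J \<subseteq> V \<longrightarrow> V = J" by (elim bexE)
  then have J: "ideal J R" "I \<subseteq> J" "\<one> \<notin> J" by auto
  have "maximalideal J R"
  proof (rule maximalidealI[OF J(1)])
    show "carrier R \<noteq> J" using J(3) by blast
    fix K assume K: "ideal K R" "J \<subseteq> K" "K \<subseteq> carrier R"
    show "K = J \<or> K = carrier R"
    proof (cases "\<one> \<in> K")
      case True
      then show ?thesis using ideal.one_imp_carrier[OF K(1)] by blast
    next
      case False
      then have "K \<in> ?F" using K J(2) by (intro CollectI conjI) auto
      then show ?thesis using max K(2) by simp
    qed
  qed
  then show ?thesis using J(2) by blast
qed

text \<open>The finite sums of elements of \<open>V\<close>. Negatives are not built in; for the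
  sets of products considered below they are obtained by negating a factor.\<close>

inductive_set add_closure :: "('a, 'x) ring_scheme \<Rightarrow> 'a set \<Rightarrow> 'a set" for G V where
  zero: "\<zero>\<^bsub>G\<^esub> \<in> add_closure G V"
| incl: "x \<in> V \<Longrightarrow> x \<in> add_closure G V"
| add: "x \<in> add_closure G V \<Longrightarrow> y \<in> add_closure G V \<Longrightarrow> x \<oplus>\<^bsub>G\<^esub> y \<in> add_closure G V"

locale standard_local_ring = standard_multigraded_ring R Rg
  for R (structure) and Rg :: "nat ^ 'r::{finite, linorder} \<Rightarrow> 'a set" +
  fixes \<mm> :: "'a set"
  assumes noetherian: "noetherian_ring R"
    and local: "local_ring (degree_zero_ring R Rg) \<mm>"
    and infinite_residue: "infinite (carrier (degree_zero_ring R Rg Quot \<mm>))"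
begin

sublocale lex_multigraded_ring R Rg ..

abbreviation "A \<equiv> degree_zero_ring R Rg"

sublocale A: cring A using local by (simp add: local_ring_def)

lemma one_degree: "\<one> \<in> Rg 0" using A.one_closed by simp

lemma a_inv_A: "a \<in> Rg 0 \<Longrightarrow> \<ominus>\<^bsub>A\<^esub> a = \<ominus> a"
proof -
  assume a: "a \<in> Rg 0"
  then have "\<ominus>\<^bsub>A\<^esub> a \<oplus> a = \<zero>" "\<ominus>\<^bsub>A\<^esub> a \<in> Rg 0" using A.l_neg[of a] A.a_inv_closed[of a] by auto
  then show ?thesis using a RG.g_carrier minus_equality by metis
qed

lemma maximalideal_m: "maximalideal \<mm> A" using local by (simp add: local_ring_def)

lemma ideal_m: "ideal \<mm> A" using maximalideal.axioms(1)[OF maximalideal_m] .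

lemma m_degree: "a \<in> \<mm> \<Longrightarrow> a \<in> Rg 0" using ideal.Icarr[OF ideal_m] by simp

lemma m_carrier: "\<mm> \<subseteq> carrier R" using m_degree RG.g_carrier by blast

lemma m_mult: "a \<in> \<mm> \<Longrightarrow> b \<in> Rg 0 \<Longrightarrow> b \<otimes> a \<in> \<mm>" using ideal.I_l_closed[OF ideal_m] by simp

lemma one_notin_m: "\<one> \<notin> \<mm>"
  using maximalideal.I_notcarr[OF maximalideal_m] ideal.one_imp_carrier[OF ideal_m] by auto

lemma m_add: "a \<in> \<mm> \<Longrightarrow> b \<in> \<mm> \<Longrightarrow> a \<oplus> b \<in> \<mm>"
  using additive_subgroup.a_closed[OF ideal.axioms(1)[OF ideal_m]] by simp

text \<open>An element without inverse generates a proper ideal, which lies in a maximal ideal, and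
  \<open>\<mm>\<close> is the only one.\<close>

lemma A_unit:
  assumes "a \<in> Rg 0" "a \<notin> \<mm>" shows "\<exists>b\<in>Rg 0. b \<otimes> a = \<one>"
proof (rule ccontr)
  assume n: "\<not> ?thesis"
  have id: "ideal (PIdl\<^bsub>A\<^esub> a) A" using assms A.cgenideal_ideal by simp
  have "\<one>\<^bsub>A\<^esub> \<notin> PIdl\<^bsub>A\<^esub> a" using n by (auto simp: cgenideal_def)
  then obtain J where J: "maximalideal J A" "PIdl\<^bsub>A\<^esub> a \<subseteq> J" using A.exists_maximalideal[OF id] by blast
  then have "J = \<mm>" using local by (simp add: local_ring_def)
  moreover have "a \<in> PIdl\<^bsub>A\<^esub> a" using assms A.cgenideal_self by simp
  ultimately show False using J(2) assms(2) by blast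
qed

lemma one_minus_unit:
  assumes "a \<in> \<mm>" shows "\<exists>b\<in>Rg 0. b \<otimes> (\<one> \<ominus> a) = \<one>"
proof (rule A_unit)
  have a: "a \<in> Rg 0" "a \<in> carrier R" using assms m_degree RG.g_carrier by auto
  show "\<one> \<ominus> a \<in> Rg 0" unfolding a_minus_def using a one_degree by (intro RG.g_add RG.g_a_inv)
  show "\<one> \<ominus> a \<notin> \<mm>"
  proof
    assume "\<one> \<ominus> a \<in> \<mm>"
    then have "(\<one> \<ominus> a) \<oplus> a \<in> \<mm>" using assms by (rule m_add)
    moreover have "(\<one> \<ominus> a) \<oplus> a = \<one>" using a by (simp add: a_minus_def a_assoc l_neg)
    ultimately show False using one_notin_m by simp
  qed
qed

text \<open>A system of representatives of the residue field. By \<open>A_unit\<close>, two distinct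
  members differ by a unit; this is the form in which infiniteness is used for avoiding
  primes.\<close>

lemma infinite_unit_differences:
  "\<exists>T\<subseteq>Rg 0. infinite T \<and> (\<forall>c\<in>T. \<forall>d\<in>T. c \<noteq> d \<longrightarrow> c \<ominus> d \<notin> \<mm>)"
proof -
  have "\<exists>c\<in>Rg 0. C = \<mm> +>\<^bsub>A\<^esub> c" if "C \<in> carrier (A Quot \<mm>)" for C
    using that by (auto simp: FactRing_def A_RCOSETS_def')
  then obtain f where f: "\<And>C. C \<in> carrier (A Quot \<mm>) \<Longrightarrow> f C \<in> Rg 0 \<and> C = \<mm> +>\<^bsub>A\<^esub> f C" by metis
  have inj: "inj_on f (carrier (A Quot \<mm>))"
    by (rule inj_onI) (metis f)
  show ?thesis
  proof (intro exI[of _ "f ` carrier (A Quot \<mm>)"] conjI ballI impI)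
    show "f ` carrier (A Quot \<mm>) \<subseteq> Rg 0" using f by blast
    show "infinite (f ` carrier (A Quot \<mm>))" using inj infinite_residue finite_imageD by blast
    fix c d assume "c \<in> f ` carrier (A Quot \<mm>)" "d \<in> f ` carrier (A Quot \<mm>)" "c \<noteq> d"
    then obtain C D where CD: "C \<in> carrier (A Quot \<mm>)" "D \<in> carrier (A Quot \<mm>)" "c = f C" "d = f D" "C \<noteq> D" by blast
    have cd: "c \<in> Rg 0" "d \<in> Rg 0" using CD f by auto
    show "c \<ominus> d \<notin> \<mm>"
    proof
      assume "c \<ominus> d \<in> \<mm>"
      then have "c \<ominus>\<^bsub>A\<^esub> d \<in> \<mm>" using cd a_inv_A[of d] by (simp add: a_minus_def)
      then have "\<mm> +>\<^bsub>A\<^esub> c = \<mm> +>\<^bsub>A\<^esub> d"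
        using A.quotient_eq_iff_same_a_r_cos[OF ideal_m] cd by simp
      then show False using CD f by metis
    qed
  qed
qed

section \<open>Splitting elements along a decomposition of their degree\<close>

abbreviation prods :: "nat ^ 'r::{finite, linorder} \<Rightarrow> nat ^ 'r::{finite, linorder} \<Rightarrow> 'a set"
  where "prods u v \<equiv> {b \<otimes> c | b c. b \<in> Rg u \<and> c \<in> Rg v}"

lemma sums_prods_mult:
  assumes "x \<in> add_closure R (prods p1 p2)" "y \<in> add_closure R (prods q1 q2)"
  shows "x \<otimes> y \<in> add_closure R (prods (p1 + q1) (p2 + q2))"
proof -
  have c: "z \<in> carrier R" if "z \<in> add_closure R (prods u v)" for z u v
    using that by induct (auto dest: RG.g_carrier)
  have *: "(b \<otimes> b') \<otimes> y \<in> add_closure R (prods (p1 + q1) (p2 + q2))" if b: "b \<in> Rg p1" "b' \<in> Rg p2" for b b'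
    using assms(2)
  proof induct
    case zero
    then show ?case using b RG.g_carrier by (simp add: add_closure.zero)
  next
    case (incl z)
    then obtain d e where z: "z = d \<otimes> e" "d \<in> Rg q1" "e \<in> Rg q2" by blast
    have "b \<otimes> b' \<otimes> z = (b \<otimes> d) \<otimes> (b' \<otimes> e)" using b z RG.g_carrier by (simp add: m_ac)
    then show ?case using b z mult_degree by (intro add_closure.incl) blast
  next
    case (add z w)
    then show ?case using b RG.g_carrier c by (simp add: r_distr add_closure.add)
  qed
  show ?thesis using assms(1)
  proof induct
    case zero
    then show ?case using c[OF assms(2)] by (simp add: add_closure.zero)
  next
    case (incl z)
    then show ?case using * by blast
  next
    case (add z w)
    then show ?case using c assms(2) by (simp add: l_distr add_closure.add)
  qed
qed

text \<open>This is how the ring being standard is exploited: the degree \<open>u + v\<close> part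
  is spanned by products of degree \<open>u\<close> and degree \<open>v\<close> elements. The
  elements whose components split in this way for all \<open>u\<close> and \<open>v\<close> contain
  the generators and are closed under the ring operations.\<close>

lemma degree_sum_decomposes:
  assumes x: "x \<in> Rg (u + v)" shows "x \<in> add_closure R (prods u v)"
proof -
  let ?H = "{x \<in> carrier R. \<forall>u v. gcomp R Rg (u + v) x \<in> add_closure R (prods u v)}"
  have neg: "\<ominus> z \<in> add_closure R (prods u v)" if "z \<in> add_closure R (prods u v)" for z u v
    using that
  proof induct
    case (incl z)
    then obtain b c where "z = b \<otimes> c" "b \<in> Rg u" "c \<in> Rg v" by blast
    then show ?case using RG.g_a_inv[of b u] RG.g_carrier by (intro add_closure.incl) (auto simp: l_minus[symmetric])
  next
    case (add y z)
    have "w \<in> carrier R" if "w \<in> add_closure R (prods u v)" for w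
      using that by induct (auto dest: RG.g_carrier)
    then show ?case using add by (simp add: minus_add add_closure.add)
  qed (simp add: add_closure.zero)
  have homog: "a \<in> ?H" if a: "a \<in> Rg w" and "\<And>u v. u + v = w \<Longrightarrow> a \<in> prods u v" for a w
    using that RG.g_carrier RG.gcomp_homogeneous[OF a] by (auto intro: add_closure.incl add_closure.zero)
  have gens: "Rg 0 \<union> (\<Union>i. Rg (axis i 1)) \<subseteq> ?H"
  proof
    fix a assume "a \<in> Rg 0 \<union> (\<Union>i. Rg (axis i 1))"
    then consider "a \<in> Rg 0" | i where "a \<in> Rg (axis i 1)" by blast
    then show "a \<in> ?H"
    proof cases
      case 1
      have "u = 0 \<and> v = 0" if "u + v = 0" for u v :: "nat ^ 'r::{finite, linorder}"
        using that by (auto simp: vec_eq_iff)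
      moreover have "a \<in> prods 0 0" using 1 one_degree RG.g_carrier by (intro CollectI exI[of _ a] exI[of _ \<one>]) auto
      ultimately show ?thesis using homog[OF 1] by blast
    next
      case (2 i)
      have "(u = 0 \<and> v = axis i 1) \<or> (u = axis i 1 \<and> v = 0)" if e: "u + v = axis i 1" for u v :: "nat ^ 'r::{finite, linorder}"
      proof -
        have c: "u $ j + v $ j = (if j = i then 1 else 0)" for j
          using arg_cong[OF e, of "\<lambda>w. w $ j"] by (simp add: axis_def)
        have o: "u $ j = 0" "v $ j = 0" if "j \<noteq> i" for j using c[of j] that by auto
        consider "u $ i = 0" "v $ i = 1" | "u $ i = 1" "v $ i = 0" using c[of i] by fastforce
        then show ?thesis
        proof cases
          case 1
          then have "u = 0" "v = axis i 1" using o by (auto simp: vec_eq_iff axis_def) metis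
          then show ?thesis by blast
        next
          case 2
          then have "v = 0" "u = axis i 1" using o by (auto simp: vec_eq_iff axis_def) metis
          then show ?thesis by blast
        qed
      qed
      moreover have "a \<in> prods 0 (axis i 1)" using 2 one_degree RG.g_carrier by (intro CollectI exI[of _ a] exI[of _ \<one>]) auto
      moreover have "a \<in> prods (axis i 1) 0" using 2 one_degree RG.g_carrier by (intro CollectI exI[of _ a] exI[of _ \<one>]) auto
      ultimately show ?thesis using homog[OF 2] by blast
    qed
  qed
  have mult: "x \<otimes> y \<in> ?H" if x: "x \<in> ?H" and y: "y \<in> ?H" for x y
  proof -
    have xc: "x \<in> carrier R" "y \<in> carrier R" using x y by auto
    have "x \<in> {x \<in> carrier R. gcomp R Rg (u + v) (x \<otimes> y) \<in> add_closure R (prods u v)}" (is "x \<in> ?K") for u v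
    proof (rule RG.mem_if_gcomp_mem[OF xc(1)])
      fix p
      let ?x = "gcomp R Rg p x"
      have xp: "?x \<in> Rg p" "?x \<in> carrier R" using xc RG.gcomp_in by auto
      have "gcomp R Rg (u + v) (?x \<otimes> y) \<in> add_closure R (prods u v)"
      proof (cases "\<exists>q. u + v = p + q")
        case True
        then obtain q where q: "u + v = p + q" by blast
        \<comment> \<open>A common refinement of the two splittings \<open>p + q = u + v\<close>:
          entrywise, \<open>p1\<close> is shared by \<open>p\<close> and \<open>u\<close>,
          \<open>p2\<close> by \<open>p\<close> and \<open>v\<close>, \<open>q1\<close> by
          \<open>q\<close> and \<open>u\<close>, and \<open>q2\<close> by \<open>q\<close> and
          \<open>v\<close>.\<close>
        define p1 p2 q1 q2 :: "nat ^ 'r::{finite, linorder}" where "p1 = (\<chi> i. min (p $ i) (u $ i))" and "p2 = (\<chi> i. p $ i - u $ i)"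
          and "q1 = (\<chi> i. u $ i - p $ i)" and "q2 = (\<chi> i. min (q $ i) (v $ i))"
        have qc: "u $ i + v $ i = p $ i + q $ i" for i using q by (metis vector_add_component)
        have e: "p = p1 + p2" "q = q1 + q2" "u = p1 + q1" "v = p2 + q2"
        proof -
          have "p $ i = min (p $ i) (u $ i) + (p $ i - u $ i)" "q $ i = (u $ i - p $ i) + min (q $ i) (v $ i)"
            "u $ i = min (p $ i) (u $ i) + (u $ i - p $ i)" "v $ i = (p $ i - u $ i) + min (q $ i) (v $ i)" for i
            using qc[of i] by linarith+
          then show "p = p1 + p2" "q = q1 + q2" "u = p1 + q1" "v = p2 + q2"
            unfolding vec_eq_iff p1_def p2_def q1_def q2_def by simp_all
        qed
        have "gcomp R Rg (p1 + p2) x \<in> add_closure R (prods p1 p2)" "gcomp R Rg (q1 + q2) y \<in> add_closure R (prods q1 q2)"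
          using x y by auto
        from sums_prods_mult[OF this] have "?x \<otimes> gcomp R Rg q y \<in> add_closure R (prods u v)" using e by simp
        moreover have "gcomp R Rg (u + v) (?x \<otimes> y) = ?x \<otimes> gcomp R Rg q y"
          using gcomp_mult[OF xp(1) xc(2), of "u + v"] q by (metis add_left_cancel)
        ultimately show ?thesis by simp
      next
        case False
        then show ?thesis using gcomp_mult[OF xp(1) xc(2), of "u + v"] add_closure.zero[of R] by auto
      qed
      then show "?x \<in> ?K" using xp by blast
    qed (use xc in \<open>auto simp: l_distr RG.gcomp_add intro: add_closure.intros\<close>)
    then show ?thesis using xc by auto
  qed
  have "generate_ring R (Rg 0 \<union> (\<Union>i. Rg (axis i 1))) \<subseteq> ?H"
  proof
    fix h assume "h \<in> generate_ring R (Rg 0 \<union> (\<Union>i. Rg (axis i 1)))"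
    then show "h \<in> ?H"
    proof induct
      case one
      then show ?case using gens one_degree by blast
    next
      case (incl h)
      then show ?case using gens by blast
    next
      case (a_inv h)
      then show ?case by (simp add: RG.gcomp_a_inv neg)
    next
      case (eng_add h1 h2)
      then show ?case by (simp add: RG.gcomp_add add_closure.add)
    next
      case (eng_mult h1 h2)
      then show ?case using mult by blast
    qed
  qed
  then have "x \<in> ?H" using generated x RG.g_carrier by blast
  then have "gcomp R Rg (u + v) x \<in> add_closure R (prods u v)" by blast
  then show ?thesis using RG.gcomp_homogeneous[OF x] by simp
qed

lemma degree_sum_mem:
  assumes "x \<in> Rg (u + v)" "\<zero> \<in> K" "\<And>y z. y \<in> K \<Longrightarrow> z \<in> K \<Longrightarrow> y \<oplus> z \<in> K"
    "\<And>b c. b \<in> Rg u \<Longrightarrow> c \<in> Rg v \<Longrightarrow> b \<otimes> c \<in> K"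
  shows "x \<in> K"
  using degree_sum_decomposes[OF assms(1)] by induct (use assms in auto)

text \<open>Degree \<open>1\<close> splits off \<open>axis i 1\<close>, so a prime containing all of
  \<open>Rg (axis i 1)\<close> contains \<open>Rg 1\<close> and hence the irrelevant ideal.\<close>

lemma relevant_axis:
  assumes P: "primeideal P R" "\<not> irrelevant_ideal R Rg \<subseteq> P"
  shows "\<exists>x\<in>Rg (axis i 1). x \<notin> P"
proof (rule ccontr)
  assume "\<not> ?thesis"
  then have sub: "Rg (axis i 1) \<subseteq> P" by blast
  interpret P: primeideal P R by (rule P)
  define v :: "nat ^ 'r::{finite, linorder}" where "v = (\<chi> j. if j = i then 0 else 1)"
  have e: "1 = axis i 1 + v" by (simp add: vec_eq_iff v_def axis_def)
  have "Rg 1 \<subseteq> P"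
  proof
    fix x assume "x \<in> Rg 1"
    then have "x \<in> Rg (axis i 1 + v)" by (simp only: e[symmetric])
    then show "x \<in> P"
      by (rule degree_sum_mem) (use sub RG.g_carrier P.I_r_closed in auto)
  qed
  then have "irrelevant_ideal R Rg \<subseteq> P"
    unfolding irrelevant_ideal_def by (rule genideal_minimal[OF P.is_ideal])
  then show False using P by blast
qed

text \<open>The usual prime avoidance multiplies elements and would leave the degree
  \<open>axis i 1\<close>. Instead, an \<open>x\<close> avoiding the earlier primes but lying in
  \<open>P\<close> is replaced by \<open>y + c x\<close> with \<open>y\<close> outside
  \<open>P\<close>. Each earlier prime excludes at most one \<open>c\<close> of the infinite set
  \<open>T\<close>: two such \<open>c\<close> and \<open>d\<close> would put the unit multiple
  \<open>(c - d) x\<close> of \<open>x\<close> into it.\<close>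

lemma avoid_relevant_primes:
  assumes "finite \<P>" "\<And>P. P \<in> \<P> \<Longrightarrow> primeideal P R" "\<And>P. P \<in> \<P> \<Longrightarrow> \<not> irrelevant_ideal R Rg \<subseteq> P"
  shows "\<exists>x\<in>Rg (axis i 1). \<forall>P\<in>\<P>. x \<notin> P"
  using assms
proof (induct \<P> rule: finite_induct)
  case empty
  then show ?case using RG.g_zero by blast
next
  case (insert P \<P>)
  then obtain x where x: "x \<in> Rg (axis i 1)" "\<And>P. P \<in> \<P> \<Longrightarrow> x \<notin> P" by blast
  have P: "primeideal P R" using insert by blast
  show ?case
  proof (cases "x \<in> P")
    case False
    then show ?thesis using x by blast
  next
    case True
    have "\<not> irrelevant_ideal R Rg \<subseteq> P" by (rule insert.prems(2)) simp
    from relevant_axis[OF P this, of i] obtain y where y: "y \<in> Rg (axis i 1)" "y \<notin> P" by (elim bexE)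
    obtain T where T: "T \<subseteq> Rg 0" "infinite T" "\<And>c d. c \<in> T \<Longrightarrow> d \<in> T \<Longrightarrow> c \<noteq> d \<Longrightarrow> c \<ominus> d \<notin> \<mm>"
      using infinite_unit_differences by (elim exE conjE) simp
    have cx: "c \<otimes> x \<in> Rg (axis i 1)" if "c \<in> T" for c using mult_degree[of c 0 x "axis i 1"] T(1) x that by auto
    have xc: "x \<in> carrier R" "y \<in> carrier R" using x y RG.g_carrier by auto
    have Tc: "c \<in> carrier R" if "c \<in> T" for c using T(1) that RG.g_carrier by blast
    have "finite {c \<in> T. y \<oplus> c \<otimes> x \<in> P'}" if P': "P' \<in> \<P>" for P'
    proof -
      interpret P': primeideal P' R using insert P' by blast
      have "c = d" if cd: "c \<in> T" "d \<in> T" "y \<oplus> c \<otimes> x \<in> P'" "y \<oplus> d \<otimes> x \<in> P'" for c d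
      proof (rule ccontr)
        assume "c \<noteq> d"
        have d0: "c \<ominus> d \<in> Rg 0" unfolding a_minus_def using T(1) cd by (intro RG.g_add RG.g_a_inv) auto
        then obtain e where e: "e \<in> Rg 0" "e \<otimes> (c \<ominus> d) = \<one>" using A_unit T(3) cd \<open>c \<noteq> d\<close> by blast
        have ec: "e \<in> carrier R" "c \<ominus> d \<in> carrier R" using e d0 RG.g_carrier by auto
        have "(y \<oplus> c \<otimes> x) \<ominus> (y \<oplus> d \<otimes> x) \<in> P'"
          unfolding a_minus_def by (rule P'.a_closed[OF cd(3) P'.a_inv_closed[OF cd(4)]])
        moreover have "(y \<oplus> c \<otimes> x) \<ominus> (y \<oplus> d \<otimes> x) = (c \<ominus> d) \<otimes> x"
          using xc Tc cd by algebra
        ultimately have "e \<otimes> ((c \<ominus> d) \<otimes> x) \<in> P'" using ec P'.I_l_closed by simp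
        moreover have "e \<otimes> ((c \<ominus> d) \<otimes> x) = x" using e ec xc by (simp add: m_assoc[symmetric])
        ultimately show False using x(2) P' by simp
      qed
      then have "\<exists>d. {c \<in> T. y \<oplus> c \<otimes> x \<in> P'} \<subseteq> {d}" by blast
      then show ?thesis using finite_subset by auto
    qed
    then have "finite (\<Union>P'\<in>\<P>. {c \<in> T. y \<oplus> c \<otimes> x \<in> P'})" using insert(1) by simp
    then have "\<not> T \<subseteq> (\<Union>P'\<in>\<P>. {c \<in> T. y \<oplus> c \<otimes> x \<in> P'})" using T(2) finite_subset by metis
    then obtain c where c: "c \<in> T" "c \<notin> (\<Union>P'\<in>\<P>. {c \<in> T. y \<oplus> c \<otimes> x \<in> P'})" unfolding subset_eq by (auto simp only: Ball_def not_all not_imp)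
    have cP: "y \<oplus> c \<otimes> x \<notin> P'" if "P' \<in> \<P>" for P' using c that by simp
    interpret P: primeideal P R by (rule P)
    have "y \<oplus> c \<otimes> x \<notin> P"
    proof
      assume "y \<oplus> c \<otimes> x \<in> P"
      moreover have cxP: "c \<otimes> x \<in> P" using True Tc[OF c(1)] P.I_l_closed by blast
      ultimately have "(y \<oplus> c \<otimes> x) \<ominus> c \<otimes> x \<in> P"
        unfolding a_minus_def by (intro P.a_closed[OF _ P.a_inv_closed])
      moreover have "(y \<oplus> c \<otimes> x) \<ominus> c \<otimes> x = y" using xc Tc[OF c(1)] by algebra
      ultimately show False using y(2) by simp
    qed
    moreover have "y \<oplus> c \<otimes> x \<in> Rg (axis i 1)" using y cx[OF c(1)] by (intro RG.g_add)
    ultimately show ?thesis using cP by (intro bexI[of _ "y \<oplus> c \<otimes> x"] ballI) auto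
  qed
qed

end

section \<open>Graded modules and relevant primes\<close>

locale standard_local_module = standard_local_ring R Rg \<mm> + multigraded_module R Rg M Mg
  for R (structure) and Rg :: "nat ^ 'r::{finite, linorder} \<Rightarrow> 'a set" and \<mm> :: "'a set"
    and M :: "('a, 'b, 'y) module_scheme" (structure) and Mg :: "int ^ 'r::{finite, linorder} \<Rightarrow> 'b set" +
  assumes finitely_generated: "finitely_generated_module R M"
begin

sublocale FG: fg_module R M
  by (intro fg_module.intro fg_module_axioms.intro module_axioms noetherian finitely_generated)

definition relevant_support :: "'b set \<Rightarrow> 'a set set"
  where "relevant_support N = {P. primeideal P R \<and> graded_ideal R Rg P \<and>
    \<not> irrelevant_ideal R Rg \<subseteq> P \<and> (\<exists>x\<in>carrier M. colon R M N x \<subseteq> P)}"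

definition relevant_colon_primes :: "'b set \<Rightarrow> 'a set set"
  where "relevant_colon_primes N = {P \<in> colon_primes R M N (carrier M). \<not> irrelevant_ideal R Rg \<subseteq> P}"

text \<open>The graded form of the maximal-annihilator argument, relative to a multiplicative set
  \<open>S\<close>. With \<open>S\<close> the homogeneous elements outside a prime \<open>P\<close>
  it yields a graded prime inside \<open>P\<close>; with \<open>S = {\<one>}\<close> it yields some
  graded associated prime.\<close>

lemma graded_prime_colon:
  assumes N: "submodule N R M" "graded_subset M Mg N"
    and S: "\<And>s. s \<in> S \<Longrightarrow> homogeneous Rg s" "\<one> \<in> S" "\<And>s t. s \<in> S \<Longrightarrow> t \<in> S \<Longrightarrow> s \<otimes> t \<in> S"
    and y0: "y0 \<in> Mg d0" "\<And>s. s \<in> S \<Longrightarrow> s \<odot>\<^bsub>M\<^esub> y0 \<notin> N"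
  shows "\<exists>y\<in>carrier M. primeideal (colon R M N y) R \<and> graded_ideal R Rg (colon R M N y) \<and> S \<inter> colon R M N y = {}"
proof -
  let ?Y = "{y. (\<exists>d. y \<in> Mg d) \<and> (\<forall>s\<in>S. s \<odot>\<^bsub>M\<^esub> y \<notin> N)}"
  have Sc: "s \<in> carrier R" if "s \<in> S" for s using S(1)[OF that] RG.g_carrier by (auto simp: homogeneous_def)
  have y0Y: "y0 \<in> ?Y" using y0 by blast
  have Yc: "?Y \<subseteq> carrier M" using MG.g_carrier by blast
  obtain y where y: "y \<in> ?Y" and max: "\<forall>z\<in>?Y. colon R M N y \<subseteq> colon R M N z \<longrightarrow> colon R M N z = colon R M N y"
    using FG.colon_maximal[OF y0Y Yc N(1)] by (elim bexE)
  obtain d where d: "y \<in> Mg d" using y by blast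
  have yc: "y \<in> carrier M" using d MG.g_carrier by blast
  have graded: "graded_ideal R Rg (colon R M N y)" by (rule graded_colon[OF N d])
  have disj: "s \<notin> colon R M N y" if "s \<in> S" for s using y that by (auto simp: colon_def)
  have max': "colon R M N (a \<odot>\<^bsub>M\<^esub> y) = colon R M N y"
    if a: "homogeneous Rg a" "\<And>s. s \<in> S \<Longrightarrow> (s \<otimes> a) \<odot>\<^bsub>M\<^esub> y \<notin> N" for a
  proof -
    obtain k where k: "a \<in> Rg k" using a by (auto simp: homogeneous_def)
    have ac: "a \<in> carrier R" using k RG.g_carrier by blast
    have "s \<odot>\<^bsub>M\<^esub> (a \<odot>\<^bsub>M\<^esub> y) \<notin> N" if "s \<in> S" for s
      using a(2)[OF that] Sc[OF that] ac yc by (simp add: smult_assoc1)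
    then have "a \<odot>\<^bsub>M\<^esub> y \<in> ?Y" using smult_degree[OF k d] by blast
    then show ?thesis using max colon_smult_mono[OF N(1) yc ac] by simp
  qed
  have "primeideal (colon R M N y) R"
  proof (rule primeideal_if_prime_on_homogeneous[OF graded disj[OF S(2)]])
    fix a b assume ab: "homogeneous Rg a" "homogeneous Rg b" "a \<otimes> b \<in> colon R M N y"
    have abc: "a \<in> carrier R" "b \<in> carrier R" using ab RG.g_carrier by (auto simp: homogeneous_def)
    have aby: "(a \<otimes> b) \<odot>\<^bsub>M\<^esub> y \<in> N" using ab(3) by (simp add: colon_def)
    show "a \<in> colon R M N y \<or> b \<in> colon R M N y"
    proof (cases "\<forall>s\<in>S. (s \<otimes> a) \<odot>\<^bsub>M\<^esub> y \<notin> N")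
      case True
      then have "colon R M N (a \<odot>\<^bsub>M\<^esub> y) = colon R M N y" using max'[OF ab(1)] by simp
      moreover have "b \<in> colon R M N (a \<odot>\<^bsub>M\<^esub> y)"
        using aby abc yc by (simp add: colon_def smult_assoc1[symmetric] m_comm)
      ultimately show ?thesis by simp
    next
      \<comment> \<open>Here \<open>a y\<close> may not compete with \<open>y\<close>, as some
        \<open>s\<close> in \<open>S\<close> carries it into \<open>N\<close>. Then
        \<open>s y\<close> competes instead; it has the same colon as \<open>y\<close>, and that
        colon contains \<open>a\<close>.\<close>
      case False
      then obtain s where s: "s \<in> S" "(s \<otimes> a) \<odot>\<^bsub>M\<^esub> y \<in> N" by blast
      have "(t \<otimes> s) \<odot>\<^bsub>M\<^esub> y \<notin> N" if "t \<in> S" for t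
        using disj[OF S(3)[OF that s(1)]] Sc[OF that] Sc[OF s(1)] by (simp add: colon_def)
      then have "colon R M N (s \<odot>\<^bsub>M\<^esub> y) = colon R M N y" using max'[OF S(1)[OF s(1)]] by simp
      moreover have "a \<in> colon R M N (s \<odot>\<^bsub>M\<^esub> y)"
        using s Sc[OF s(1)] abc yc by (simp add: colon_def smult_assoc1[symmetric] m_comm)
      ultimately show ?thesis by simp
    qed
  qed
  then show ?thesis using graded disj yc by blast
qed

lemma homogeneous_mult: "homogeneous Rg a \<Longrightarrow> homogeneous Rg b \<Longrightarrow> homogeneous Rg (a \<otimes> b)"
  using mult_degree unfolding homogeneous_def by blast

text \<open>The point is to replace the arbitrary witness \<open>x\<close> by a homogeneous one,
  after which the maximal-annihilator argument stays inside \<open>P\<close>.\<close>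

lemma relevant_support_contains_colon_prime:
  assumes N: "submodule N R M" "graded_subset M Mg N" and P: "P \<in> relevant_support N"
  shows "\<exists>Q\<in>relevant_support N. Q \<in> relevant_colon_primes N \<and> Q \<subseteq> P"
proof -
  obtain x where x: "x \<in> carrier M" "colon R M N x \<subseteq> P" and gP: "graded_ideal R Rg P"
    and primeP: "primeideal P R" and rel: "\<not> irrelevant_ideal R Rg \<subseteq> P"
    using P by (auto simp: relevant_support_def)
  interpret P: primeideal P R by (rule primeP)
  have oneP: "\<one> \<notin> P" using P.one_imp_carrier P.I_notcarr by blast
  let ?S = "{a. homogeneous Rg a \<and> a \<notin> P}"
  have Sc: "s \<in> carrier R" if "s \<in> ?S" for s using that RG.g_carrier by (auto simp: homogeneous_def)
  note N' = N(1)[unfolded submodule_iff]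
  \<comment> \<open>If every component of \<open>x\<close> were carried into \<open>N\<close> by an
    element outside \<open>P\<close>, a product of such elements would carry \<open>x\<close> itself
    into \<open>N\<close>, contradicting that \<open>(N : x)\<close> lies in
    \<open>P\<close>.\<close>
  have "\<exists>n. \<forall>s\<in>?S. s \<odot>\<^bsub>M\<^esub> gcomp M Mg n x \<notin> N"
  proof (rule ccontr)
    assume neg: "\<not> ?thesis"
    have "x \<in> {z \<in> carrier M. \<exists>s\<in>carrier R - P. s \<odot>\<^bsub>M\<^esub> z \<in> N}" (is "x \<in> ?H")
    proof (rule MG.mem_if_gcomp_mem[OF x(1)])
      show "\<zero>\<^bsub>M\<^esub> \<in> ?H" using oneP N' by (auto intro!: bexI[of _ \<one>])
      show "gcomp M Mg n x \<in> ?H" for n using neg Sc x(1) by fastforce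
      fix y z assume "y \<in> ?H" "z \<in> ?H"
      then obtain s t where st: "s \<in> carrier R - P" "t \<in> carrier R - P" "s \<odot>\<^bsub>M\<^esub> y \<in> N" "t \<odot>\<^bsub>M\<^esub> z \<in> N"
        and yz: "y \<in> carrier M" "z \<in> carrier M" by blast
      have "(s \<otimes> t) \<odot>\<^bsub>M\<^esub> (y \<oplus>\<^bsub>M\<^esub> z) = t \<odot>\<^bsub>M\<^esub> (s \<odot>\<^bsub>M\<^esub> y) \<oplus>\<^bsub>M\<^esub> s \<odot>\<^bsub>M\<^esub> (t \<odot>\<^bsub>M\<^esub> z)"
        using st yz m_comm[of s t] by (simp add: smult_r_distr smult_assoc1[symmetric])
      then have "(s \<otimes> t) \<odot>\<^bsub>M\<^esub> (y \<oplus>\<^bsub>M\<^esub> z) \<in> N" using st N' by simp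
      moreover have "s \<otimes> t \<in> carrier R - P" using st P.I_prime by blast
      ultimately show "y \<oplus>\<^bsub>M\<^esub> z \<in> ?H" using yz by blast
    qed
    then show False using x(2) by (auto simp: colon_def)
  qed
  then obtain n where n: "\<And>s. s \<in> ?S \<Longrightarrow> s \<odot>\<^bsub>M\<^esub> gcomp M Mg n x \<notin> N" by blast
  have "\<exists>y\<in>carrier M. primeideal (colon R M N y) R \<and> graded_ideal R Rg (colon R M N y) \<and> ?S \<inter> colon R M N y = {}"
  proof (rule graded_prime_colon[OF N])
    show "gcomp M Mg n x \<in> Mg n" by (rule MG.gcomp_in[OF x(1)])
    show "s \<otimes> t \<in> ?S" if "s \<in> ?S" "t \<in> ?S" for s t
      using that Sc[OF that(1)] Sc[OF that(2)] P.I_prime homogeneous_mult by blast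
    show "\<one> \<in> ?S" using one_degree oneP by (auto simp: homogeneous_def)
  qed (use n in blast)+
  then obtain y where y: "y \<in> carrier M" "primeideal (colon R M N y) R"
    "graded_ideal R Rg (colon R M N y)" "?S \<inter> colon R M N y = {}" by blast
  \<comment> \<open>The colon is graded and has no homogeneous element outside
    \<open>P\<close>.\<close>
  have "colon R M N y \<subseteq> P"
  proof
    fix a assume a: "a \<in> colon R M N y"
    then have ac: "a \<in> carrier R" by (simp add: colon_def)
    show "a \<in> P"
    proof (rule RG.mem_if_gcomp_mem[OF ac])
      fix n
      have "gcomp R Rg n a \<in> colon R M N y" using y(3) a by (auto simp: graded_ideal_iff graded_subset_def)
      moreover have "homogeneous Rg (gcomp R Rg n a)" using RG.gcomp_in[OF ac] by (auto simp: homogeneous_def)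
      ultimately show "gcomp R Rg n a \<in> P" using y(4) by blast
    qed auto
  qed
  moreover from this have "\<not> irrelevant_ideal R Rg \<subseteq> colon R M N y" using rel by blast
  ultimately show ?thesis using y unfolding relevant_support_def relevant_colon_primes_def colon_primes_def by blast
qed

lemma relevant_support_mono:
  assumes "N \<subseteq> N'" shows "relevant_support N' \<subseteq> relevant_support N"
proof -
  have "colon R M N x \<subseteq> colon R M N' x" for x using assms by (auto simp: colon_def)
  then show ?thesis unfolding relevant_support_def by blast
qed

text \<open>One link of the chain: \<open>b\<close> carries all of \<open>M\<close> into
  \<open>N'\<close>, so it lies in \<open>P\<close>; it does not lie in the prime \<open>Q\<close>
  found below \<open>P\<close>, so the inclusion is strict.\<close>

lemma relevant_support_drop:
  assumes N: "submodule N R M" "graded_subset M Mg N" and NN': "N \<subseteq> N'"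
    and b: "b \<in> carrier R" "\<And>x. x \<in> carrier M \<Longrightarrow> b \<odot>\<^bsub>M\<^esub> x \<in> N'" "\<And>Q. Q \<in> relevant_colon_primes N \<Longrightarrow> b \<notin> Q"
    and P: "P \<in> relevant_support N'"
  shows "\<exists>Q\<in>relevant_support N. Q \<subset> P"
proof -
  have bP: "b \<in> P" using P b by (auto simp: relevant_support_def colon_def)
  have "P \<in> relevant_support N" using P relevant_support_mono[OF NN'] by blast
  from relevant_support_contains_colon_prime[OF N this] obtain Q
    where "Q \<in> relevant_support N" "Q \<in> relevant_colon_primes N" "Q \<subseteq> P" by (elim bexE conjE)
  then show ?thesis using bP b(3)[of Q] by blast
qed

text \<open>Dividing the torsion with respect to the irrelevant ideal out of \<open>M/N\<close>
  leaves a module whose graded associated primes are all relevant. They would lie in the support of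
  \<open>M/N\<close>, so nothing is left, and finite generation bounds the degrees.\<close>

lemma eventually_contained_if_no_relevant_support:
  assumes N: "submodule N R M" "graded_subset M Mg N" and empty: "relevant_support N = {}"
  shows "\<exists>n0. \<forall>n\<ge>n0. Mg n \<subseteq> N"
proof -
  note N' = N(1)[unfolded submodule_iff]
  \<comment> \<open>The union of the \<open>W T\<close> is the preimage of the part of
    \<open>M/N\<close> killed by a power of the irrelevant ideal, expressed through degrees so that
    it can be compared with components.\<close>
  define W where "W = (\<lambda>T. {x \<in> carrier M. \<forall>p. (\<forall>i. T \<le> p $ i) \<longrightarrow> (\<forall>h\<in>Rg p. h \<odot>\<^bsub>M\<^esub> x \<in> N)})"
  have W_sub: "submodule (W T) R M" for T
    unfolding submodule_iff
  proof (intro conjI ballI)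
    show "W T \<subseteq> carrier M" by (auto simp: W_def)
    show "\<zero>\<^bsub>M\<^esub> \<in> W T" using N' RG.g_carrier by (auto simp: W_def)
    show "a \<oplus>\<^bsub>M\<^esub> b \<in> W T" if "a \<in> W T" "b \<in> W T" for a b
      using that N' RG.g_carrier by (auto simp: W_def smult_r_distr)
    fix r x assume r: "r \<in> carrier R" "x \<in> W T"
    have "h \<odot>\<^bsub>M\<^esub> (r \<odot>\<^bsub>M\<^esub> x) = r \<odot>\<^bsub>M\<^esub> (h \<odot>\<^bsub>M\<^esub> x)" if "h \<in> Rg p" for h p
    proof -
      have "h \<in> carrier R" "x \<in> carrier M" using that r RG.g_carrier by (auto simp: W_def)
      then show ?thesis using r m_comm[of r h] by (simp add: smult_assoc1[symmetric])
    qed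
    then show "r \<odot>\<^bsub>M\<^esub> x \<in> W T" using r N' by (auto simp: W_def)
  qed
  have W_mono: "W T \<subseteq> W (Suc T)" for T by (auto simp: W_def dest: Suc_leD)
  obtain T where T: "\<And>n. n \<ge> T \<Longrightarrow> W n = W T" using FG.submodule_seq_stable[of W, OF W_sub W_mono] by blast
  have W_graded: "graded_subset M Mg (W T)"
    unfolding graded_subset_def
  proof (intro ballI allI)
    fix x n assume x: "x \<in> W T"
    then have xc: "x \<in> carrier M" by (simp add: W_def)
    have "h \<odot>\<^bsub>M\<^esub> gcomp M Mg n x \<in> N" if "\<forall>i. T \<le> p $ i" "h \<in> Rg p" for p h
    proof -
      have "h \<odot>\<^bsub>M\<^esub> x \<in> N" using x that by (simp add: W_def)
      then have "gcomp M Mg (int_vec p + n) (h \<odot>\<^bsub>M\<^esub> x) \<in> N" using N(2) by (simp add: graded_subset_def)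
      then show ?thesis using gcomp_smult_left[OF that(2) xc, of n] by simp
    qed
    then show "gcomp M Mg n x \<in> W T" using xc by (auto simp: W_def)
  qed
  have N_W: "N \<subseteq> W T" using N' RG.g_carrier by (auto simp: W_def)
  have W_all: "W T = carrier M"
  proof (rule ccontr)
    assume "W T \<noteq> carrier M"
    then obtain x where x: "x \<in> carrier M" "x \<notin> W T" using W_sub[of T] by (auto simp: submodule_iff)
    have "\<exists>n. gcomp M Mg n x \<notin> W T"
      using MG.mem_if_gcomp_mem[OF x(1), of "W T"] x(2) W_sub[of T] by (auto simp: submodule_iff)
    then obtain n where n: "gcomp M Mg n x \<notin> W T" by blast
    have "\<exists>y\<in>carrier M. primeideal (colon R M (W T) y) R \<and> graded_ideal R Rg (colon R M (W T) y) \<and> {\<one>} \<inter> colon R M (W T) y = {}"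
      by (rule graded_prime_colon[OF W_sub W_graded _ _ _ MG.gcomp_in[OF x(1), of n]])
        (use one_degree n x in \<open>auto simp: homogeneous_def\<close>)
    then obtain y where y: "y \<in> carrier M" "primeideal (colon R M (W T) y) R"
      "graded_ideal R Rg (colon R M (W T) y)" "\<one> \<notin> colon R M (W T) y" by blast
    have yW: "y \<notin> W T" using y by (simp add: colon_def)
    \<comment> \<open>If \<open>Rg 1\<close> carried \<open>y\<close> into \<open>W T\<close>,
      splitting a degree \<open>p\<close> as \<open>(p - 1) + 1\<close> would put \<open>y\<close>
      into \<open>W (Suc T)\<close>, which equals \<open>W T\<close> by stability.\<close>
    have "\<not> irrelevant_ideal R Rg \<subseteq> colon R M (W T) y"
    proof
      assume irr: "irrelevant_ideal R Rg \<subseteq> colon R M (W T) y"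
      have "Rg 1 \<subseteq> irrelevant_ideal R Rg"
        unfolding irrelevant_ideal_def by (rule genideal_self) (use RG.g_carrier in blast)
      then have R1: "c \<odot>\<^bsub>M\<^esub> y \<in> W T" if "c \<in> Rg 1" for c using irr that by (auto simp: colon_def)
      have "h \<odot>\<^bsub>M\<^esub> y \<in> N" if p: "\<forall>i. Suc T \<le> p $ i" and h: "h \<in> Rg p" for p h
      proof -
        define v :: "nat ^ 'r::{finite, linorder}" where "v = (\<chi> i. p $ i - 1)"
        have "p $ i = (v + 1) $ i" for i using p[rule_format, of i] by (simp add: v_def)
        then have pv: "p = v + 1" unfolding vec_eq_iff by blast
        have vT: "\<forall>i. T \<le> v $ i"
        proof
          fix i show "T \<le> v $ i" using p[rule_format, of i] by (simp add: v_def)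
        qed
        have "h \<in> Rg (v + 1)" using h pv by simp
        then have "h \<in> {h \<in> carrier R. h \<odot>\<^bsub>M\<^esub> y \<in> N}"
        proof (rule degree_sum_mem)
          fix b c assume bc: "b \<in> Rg v" "c \<in> Rg 1"
          have "b \<odot>\<^bsub>M\<^esub> (c \<odot>\<^bsub>M\<^esub> y) \<in> N" using R1[OF bc(2)] bc(1) vT by (simp add: W_def)
          then show "b \<otimes> c \<in> {h \<in> carrier R. h \<odot>\<^bsub>M\<^esub> y \<in> N}"
            using bc RG.g_carrier y(1) by (simp add: smult_assoc1)
        qed (use N' y(1) in \<open>auto simp: smult_l_distr\<close>)
        then show ?thesis by blast
      qed
      then have "y \<in> W (Suc T)" using y(1) by (auto simp: W_def)
      then show False using T[of "Suc T"] yW by simp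
    qed
    moreover have "colon R M N y \<subseteq> colon R M (W T) y" using N_W by (auto simp: colon_def)
    ultimately have "colon R M (W T) y \<in> relevant_support N" using y by (auto simp: relevant_support_def)
    then show False using empty by blast
  qed
  obtain S where S: "S \<subseteq> carrier M" "finite S" "gen_submodule R M S = carrier M"
    using finitely_generated by (auto simp: finitely_generated_module_def)
  let ?D = "\<Union>s\<in>S. {d. gcomp M Mg d s \<noteq> \<zero>\<^bsub>M\<^esub>}"
  have finD: "finite ?D" using S MG.finite_gcomp by blast
  have "bdd_above ((\<lambda>(d, i). d $ i) ` (?D \<times> UNIV))" using finD by (intro bdd_above_finite finite_imageI finite_cartesian_product) auto
  then obtain b where b: "\<And>d i. d \<in> ?D \<Longrightarrow> d $ i \<le> b" unfolding bdd_above_def by fastforce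
  \<comment> \<open>\<open>b\<close> bounds all entries of the degrees occurring in the generators.
    From such a degree \<open>d\<close> a degree \<open>n\<close> above \<open>n0\<close> is reached
    only by ring elements of degree \<open>n - d\<close>, whose entries are all at least
    \<open>T\<close>.\<close>
  define n0 :: "int ^ 'r::{finite, linorder}" where "n0 = (\<chi> i. b + int T)"
  \<comment> \<open>Ranging over all multipliers \<open>r\<close> makes this a submodule, so that
    only components of the generators need to be examined.\<close>
  let ?K = "{x \<in> carrier M. \<forall>r\<in>carrier R. \<forall>n\<ge>n0. gcomp M Mg n (r \<odot>\<^bsub>M\<^esub> x) \<in> N}"
  have Kadd: "x \<oplus>\<^bsub>M\<^esub> y \<in> ?K" if "x \<in> ?K" "y \<in> ?K" for x y
    using that N' by (auto simp: smult_r_distr MG.gcomp_add)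
  have Kzero: "\<zero>\<^bsub>M\<^esub> \<in> ?K" using N' by auto
  have "submodule ?K R M"
    unfolding submodule_iff
  proof (intro conjI ballI)
    fix r x assume "r \<in> carrier R" "x \<in> ?K"
    then show "r \<odot>\<^bsub>M\<^esub> x \<in> ?K" by (auto simp: smult_assoc1[symmetric])
  qed (use Kadd Kzero in auto)
  moreover have "S \<subseteq> ?K"
  proof
    fix s assume s: "s \<in> S"
    then have sc: "s \<in> carrier M" using S by blast
    show "s \<in> ?K"
    proof (rule MG.mem_if_gcomp_mem[OF sc])
      fix d
      let ?x = "gcomp M Mg d s"
      show "?x \<in> ?K"
      proof (cases "?x = \<zero>\<^bsub>M\<^esub>")
        case True
        then show ?thesis using Kzero by simp
      next
        case False
        then have db: "d $ i \<le> b" for i using b s by blast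
        have xc: "?x \<in> carrier M" and xd: "?x \<in> Mg d" using sc MG.gcomp_in by auto
        have "gcomp M Mg n (r \<odot>\<^bsub>M\<^esub> ?x) \<in> N" if r: "r \<in> carrier R" and n: "n \<ge> n0" for r n
        proof -
          define k :: "nat ^ 'r::{finite, linorder}" where "k = (\<chi> i. nat (n $ i - d $ i))"
          have ni: "b + int T \<le> n $ i" for i using n by (simp add: less_eq_vec_def n0_def)
          have dn: "d $ i \<le> n $ i" for i using ni[of i] db[of i] by simp
          have nk: "n = int_vec k + d"
            unfolding vec_eq_iff int_vec_def k_def using dn by simp
          have kT: "\<forall>i. T \<le> k $ i"
          proof
            fix i show "T \<le> k $ i" using ni[of i] db[of i] by (simp add: k_def)
          qed
          have "?x \<in> W T" using W_all xc by simp
          then have "gcomp R Rg k r \<odot>\<^bsub>M\<^esub> ?x \<in> N" using kT RG.gcomp_in[OF r] by (simp add: W_def)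
          then show ?thesis using gcomp_smult_right[OF xd r, of k] nk by simp
        qed
        then show ?thesis using xc by blast
      qed
    qed (use Kadd Kzero in auto)
  qed
  ultimately have K: "carrier M \<subseteq> ?K" using gen_submodule_least[of ?K R M S] S(3) by simp
  have "Mg n \<subseteq> N" if "n \<ge> n0" for n
  proof
    fix x assume x: "x \<in> Mg n"
    then have "x \<in> ?K" using K MG.g_carrier by blast
    then have "gcomp M Mg n (\<one> \<odot>\<^bsub>M\<^esub> x) \<in> N" using that by blast
    then show "x \<in> N" using x MG.g_carrier MG.gcomp_homogeneous[OF x] by simp
  qed
  then show ?thesis by blast
qed

text \<open>Nakayama's lemma for the \<open>A\<close>-module \<open>Mg n / (Mg n \<inter> N)\<close>. A maximal graded submodule above
  N not containing \<open>Mg n\<close> plays the role of a maximal proper submodule, so finite generation of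
  \<open>Mg n\<close> over \<open>A\<close> is not needed.\<close>

lemma graded_nakayama:
  assumes F: "\<And>a. a \<in> F \<Longrightarrow> homogeneous Rg a"
    and sub: "Mg n \<subseteq> set_times_module R (\<mm> \<union> F) M"
  shows "Mg n \<subseteq> set_times_module R F M"
proof (rule ccontr)
  let ?N = "set_times_module R F M"
  assume nsub: "\<not> Mg n \<subseteq> ?N"
  have Fc: "F \<subseteq> carrier R" using F RG.g_carrier by (auto simp: homogeneous_def)
  let ?F = "{W. submodule W R M \<and> graded_subset M Mg W \<and> ?N \<subseteq> W \<and> \<not> Mg n \<subseteq> W}"
  have "?N \<in> ?F" using nsub graded_set_times_module[OF F] set_times_module_is_submodule[OF Fc] by blast
  then have "\<exists>W\<in>?F. ?N \<subseteq> W \<and> (\<forall>W'\<in>?F. W \<subseteq> W' \<longrightarrow> W' = W)" by (rule FG.submodule_maximal) simp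
  then obtain W where W: "W \<in> ?F" and max: "\<forall>W'\<in>?F. W \<subseteq> W' \<longrightarrow> W' = W" by (elim bexE conjE)
  have Ws: "submodule W R M" and Wg: "graded_subset M Mg W" and NW: "?N \<subseteq> W" and nW: "\<not> Mg n \<subseteq> W"
    using W by auto
  note W' = Ws[unfolded submodule_iff]
  \<comment> \<open>Adding \<open>c x\<close> to \<open>W\<close> keeps it graded, so by maximality
    the larger submodule contains \<open>x\<close>. The resulting equation
    \<open>x = r c x + s\<close> is solved for \<open>x\<close> in degree \<open>n\<close>.\<close>
  have mW: "c \<odot>\<^bsub>M\<^esub> x \<in> W" if x: "x \<in> Mg n" and c: "c \<in> \<mm>" for x c
  proof (rule ccontr)
    assume cx: "c \<odot>\<^bsub>M\<^esub> x \<notin> W"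
    have xc: "x \<in> carrier M" and cc: "c \<in> carrier R" using x MG.g_carrier c m_carrier by auto
    let ?y = "c \<odot>\<^bsub>M\<^esub> x"
    have yc: "?y \<in> carrier M" and yn: "?y \<in> Mg n" using xc cc smult_degree[OF m_degree[OF c] x] by auto
    let ?V = "{r \<odot>\<^bsub>M\<^esub> ?y \<oplus>\<^bsub>M\<^esub> s | r s. r \<in> carrier R \<and> s \<in> W}"
    note V = submodule_add_cyclic[OF Ws yc]
    note V' = V(1)[unfolded submodule_iff]
    have "gcomp M Mg k (r \<odot>\<^bsub>M\<^esub> ?y) \<in> ?V" if r: "r \<in> carrier R" for r k
    proof -
      have "r \<in> {r \<in> carrier R. gcomp M Mg k (r \<odot>\<^bsub>M\<^esub> ?y) \<in> ?V}" (is "r \<in> ?H")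
      proof (rule RG.mem_if_gcomp_mem[OF r])
        fix j
        let ?s = "gcomp R Rg j r"
        have sj: "?s \<in> Rg j" "?s \<in> carrier R" using RG.gcomp_in[OF r] r by auto
        have "?s \<odot>\<^bsub>M\<^esub> ?y \<in> ?V" using V' V(3) sj(2) by blast
        then have "gcomp M Mg k (?s \<odot>\<^bsub>M\<^esub> ?y) \<in> ?V"
          using V' MG.gcomp_homogeneous[OF smult_degree[OF sj(1) yn], of k] by (simp only: split: if_split) blast
        then show "?s \<in> ?H" using sj(2) by blast
      next
        show "\<zero> \<in> ?H" using V' yc by simp
        fix a b assume ab: "a \<in> ?H" "b \<in> ?H"
        then have "gcomp M Mg k ((a \<oplus> b) \<odot>\<^bsub>M\<^esub> ?y) = gcomp M Mg k (a \<odot>\<^bsub>M\<^esub> ?y) \<oplus>\<^bsub>M\<^esub> gcomp M Mg k (b \<odot>\<^bsub>M\<^esub> ?y)"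
          using yc by (simp add: smult_l_distr MG.gcomp_add)
        also have "\<dots> \<in> ?V" using ab V' by blast
        finally show "a \<oplus> b \<in> ?H" using ab by blast
      qed
      then show ?thesis by blast
    qed
    note comp_y = this
    have "graded_subset M Mg ?V"
      unfolding graded_subset_def
    proof (intro ballI allI)
      fix z k assume "z \<in> ?V"
      then obtain r s where rs: "z = r \<odot>\<^bsub>M\<^esub> ?y \<oplus>\<^bsub>M\<^esub> s" "r \<in> carrier R" "s \<in> W" by blast
      have sc: "s \<in> carrier M" using rs W' by blast
      have e: "gcomp M Mg k z = gcomp M Mg k (r \<odot>\<^bsub>M\<^esub> ?y) \<oplus>\<^bsub>M\<^esub> gcomp M Mg k s"
        using rs sc yc by (simp add: MG.gcomp_add)
      have "gcomp M Mg k s \<in> ?V" using Wg rs(3) V(2) unfolding graded_subset_def by blast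
      then show "gcomp M Mg k z \<in> ?V" unfolding e using comp_y[OF rs(2), of k] V' by blast
    qed
    moreover have "?V \<noteq> W" using V(3) cx by blast
    ultimately have "Mg n \<subseteq> ?V" using max V(1,2) NW by blast
    then obtain r s where rs: "x = r \<odot>\<^bsub>M\<^esub> ?y \<oplus>\<^bsub>M\<^esub> s" "r \<in> carrier R" "s \<in> W" using x by blast
    have sc: "s \<in> carrier M" using rs W' by blast
    \<comment> \<open>Since \<open>x\<close> and \<open>c x\<close> have the same degree, only the
      degree zero part of \<open>r\<close> contributes. This part times \<open>c\<close> lies in
      \<open>\<mm>\<close>, so \<open>\<one> \<ominus> ?r \<otimes> c\<close> is a unit of
      \<open>A\<close>.\<close>
    let ?r = "gcomp R Rg 0 r"
    have r0: "?r \<in> Rg 0" "?r \<in> carrier R" using RG.gcomp_in[OF rs(2)] rs(2) by auto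
    have "gcomp M Mg n x = gcomp M Mg n (r \<odot>\<^bsub>M\<^esub> ?y) \<oplus>\<^bsub>M\<^esub> gcomp M Mg n s"
      using rs sc yc by (metis MG.gcomp_add smult_closed)
    moreover have "gcomp M Mg n (r \<odot>\<^bsub>M\<^esub> ?y) = ?r \<odot>\<^bsub>M\<^esub> ?y"
      using gcomp_smult_right[OF yn rs(2), of 0] by simp
    ultimately have xe: "x = (?r \<otimes> c) \<odot>\<^bsub>M\<^esub> x \<oplus>\<^bsub>M\<^esub> gcomp M Mg n s"
      using MG.gcomp_homogeneous[OF x] r0 cc xc by (simp add: smult_assoc1)
    have rm: "?r \<otimes> c \<in> \<mm>" by (rule m_mult[OF c r0(1)])
    then have rc: "?r \<otimes> c \<in> carrier R" using m_carrier by blast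
    obtain u where u: "u \<in> Rg 0" "u \<otimes> (\<one> \<ominus> ?r \<otimes> c) = \<one>" using one_minus_unit[OF rm] by blast
    have uc: "u \<in> carrier R" using u RG.g_carrier by blast
    have "(\<one> \<ominus> ?r \<otimes> c) \<odot>\<^bsub>M\<^esub> x = x \<ominus>\<^bsub>M\<^esub> (?r \<otimes> c) \<odot>\<^bsub>M\<^esub> x"
      using rc xc by (simp add: a_minus_def smult_l_distr smult_l_minus)
    also have "\<dots> = gcomp M Mg n s"
    proof -
      have "(z \<oplus>\<^bsub>M\<^esub> t) \<ominus>\<^bsub>M\<^esub> z = t" if "z \<in> carrier M" "t \<in> carrier M" for z t
        using that by (metis M.add.inv_closed M.add.m_comm M.r_neg1 a_minus_def M.add.m_assoc)
      from this[of "(?r \<otimes> c) \<odot>\<^bsub>M\<^esub> x" "gcomp M Mg n s"] show ?thesis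
        using xe rc xc sc by simp
    qed
    finally have "(\<one> \<ominus> ?r \<otimes> c) \<odot>\<^bsub>M\<^esub> x \<in> W" using Wg rs(3) by (simp add: graded_subset_def)
    then have "u \<odot>\<^bsub>M\<^esub> ((\<one> \<ominus> ?r \<otimes> c) \<odot>\<^bsub>M\<^esub> x) \<in> W" using uc W' by blast
    then have "x \<in> W" using u uc rc xc by (simp add: smult_assoc1[symmetric])
    then show False using cx cc W' by blast
  qed
  \<comment> \<open>A submodule containing all \<open>a x\<close> with \<open>a\<close> in
    \<open>\<mm> \<union> F\<close>: for \<open>a\<close> in \<open>\<mm>\<close> by
    \<open>mW\<close>, for \<open>a\<close> in \<open>F\<close> because \<open>F M\<close> lies in
    the graded submodule \<open>W\<close>.\<close>
  let ?K = "{x \<in> carrier M. \<forall>r\<in>carrier R. gcomp M Mg n (r \<odot>\<^bsub>M\<^esub> x) \<in> W}"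
  have "submodule ?K R M"
    unfolding submodule_iff
  proof (intro conjI ballI)
    fix r x assume "r \<in> carrier R" "x \<in> ?K"
    then show "r \<odot>\<^bsub>M\<^esub> x \<in> ?K" by (auto simp: smult_assoc1[symmetric])
  next
    show "x \<oplus>\<^bsub>M\<^esub> y \<in> ?K" if "x \<in> ?K" "y \<in> ?K" for x y
      using that W' by (auto simp: smult_r_distr MG.gcomp_add)
  qed (use W' in auto)
  moreover have "a \<odot>\<^bsub>M\<^esub> x \<in> ?K" if a: "a \<in> \<mm> \<union> F" and x: "x \<in> carrier M" for a x
  proof -
    have ac: "a \<in> carrier R" using a Fc m_carrier by blast
    have comm: "r \<odot>\<^bsub>M\<^esub> (a \<odot>\<^bsub>M\<^esub> x) = a \<odot>\<^bsub>M\<^esub> (r \<odot>\<^bsub>M\<^esub> x)" if "r \<in> carrier R" for r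
      using that ac x m_comm[of a r] by (simp add: smult_assoc1[symmetric])
    have "gcomp M Mg n (a \<odot>\<^bsub>M\<^esub> (r \<odot>\<^bsub>M\<^esub> x)) \<in> W" if r: "r \<in> carrier R" for r
    proof (cases "a \<in> \<mm>")
      case True
      have "gcomp M Mg n (a \<odot>\<^bsub>M\<^esub> (r \<odot>\<^bsub>M\<^esub> x)) = a \<odot>\<^bsub>M\<^esub> gcomp M Mg n (r \<odot>\<^bsub>M\<^esub> x)"
        using gcomp_smult_left[OF m_degree[OF True], of "r \<odot>\<^bsub>M\<^esub> x" n] r x by simp
      then show ?thesis using mW[OF _ True] MG.gcomp_in r x by simp
    next
      case False
      then have "a \<in> F" using a by blast
      from set_times_module_incl[OF this smult_closed[OF r x], of R]
      have "a \<odot>\<^bsub>M\<^esub> (r \<odot>\<^bsub>M\<^esub> x) \<in> W" by (rule subsetD[OF NW])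
      then show ?thesis using Wg by (simp add: graded_subset_def)
    qed
    then show ?thesis using ac x comm by simp
  qed
  ultimately have K: "set_times_module R (\<mm> \<union> F) M \<subseteq> ?K" by (rule set_times_module_least)
  have "Mg n \<subseteq> W"
  proof
    fix x assume x: "x \<in> Mg n"
    then have "x \<in> ?K" using K sub by blast
    then have "gcomp M Mg n (\<one> \<odot>\<^bsub>M\<^esub> x) \<in> W" by blast
    then show "x \<in> W" using x MG.g_carrier MG.gcomp_homogeneous[OF x] by simp
  qed
  then show False using nW by contradiction
qed

end

section \<open>Chains of primes are bounded\<close>

context standard_local_ring
begin

text \<open>Linear algebra over \<open>A/\<mm>\<close>, phrased with \<open>A\<close>-submodules \<open>Z\<close> of \<open>R\<close> containing \<open>\<mm> R\<close>:
  \<open>aspan Z vs\<close> and \<open>aindep Z vs\<close> are span and linear independence modulo \<open>Z\<close>.\<close>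

primrec aspan :: "'a set \<Rightarrow> 'a list \<Rightarrow> 'a set" where
  "aspan Z [] = Z"
| "aspan Z (v # vs) = {a \<otimes> v \<oplus> s | a s. a \<in> Rg 0 \<and> s \<in> aspan Z vs}"

primrec aindep :: "'a set \<Rightarrow> 'a list \<Rightarrow> bool" where
  "aindep Z [] \<longleftrightarrow> True"
| "aindep Z (v # vs) \<longleftrightarrow> v \<notin> aspan Z vs \<and> aindep Z vs"

definition amodule :: "'a set \<Rightarrow> bool"
  where "amodule Z \<longleftrightarrow> Z \<subseteq> carrier R \<and> \<zero> \<in> Z \<and> (\<forall>x\<in>Z. \<forall>y\<in>Z. x \<oplus> y \<in> Z) \<and> (\<forall>a\<in>Rg 0. \<forall>x\<in>Z. a \<otimes> x \<in> Z)"

definition residual :: "'a set \<Rightarrow> bool"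
  where "residual Z \<longleftrightarrow> amodule Z \<and> (\<forall>a\<in>\<mm>. \<forall>x\<in>carrier R. a \<otimes> x \<in> Z)"

lemma amodule_cons:
  assumes Z: "amodule Z" and v: "v \<in> carrier R"
  shows "amodule {a \<otimes> v \<oplus> s | a s. a \<in> Rg 0 \<and> s \<in> Z}" (is "amodule ?S")
    and "Z \<subseteq> {a \<otimes> v \<oplus> s | a s. a \<in> Rg 0 \<and> s \<in> Z}"
    and "v \<in> {a \<otimes> v \<oplus> s | a s. a \<in> Rg 0 \<and> s \<in> Z}"
proof -
  note Z' = Z[unfolded amodule_def]
  have Zc: "s \<in> carrier R" if "s \<in> Z" for s using Z' that by blast
  show incl: "Z \<subseteq> ?S"
  proof
    fix s assume "s \<in> Z"
    then have "s = \<zero> \<otimes> v \<oplus> s" "s \<in> Z" using v Zc by auto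
    then show "s \<in> ?S" using RG.g_zero by blast
  qed
  have "v = \<one> \<otimes> v \<oplus> \<zero>" using v by simp
  then show "v \<in> ?S" using Z' one_degree by blast
  show "amodule ?S"
    unfolding amodule_def
  proof (intro conjI ballI)
    show "?S \<subseteq> carrier R" using v Zc RG.g_carrier by auto
    show "\<zero> \<in> ?S" using incl Z' by blast
    fix x y assume "x \<in> ?S" "y \<in> ?S"
    then obtain a s b t where e: "x = a \<otimes> v \<oplus> s" "y = b \<otimes> v \<oplus> t"
      "a \<in> Rg 0" "b \<in> Rg 0" "s \<in> Z" "t \<in> Z" by blast
    have "x \<oplus> y = (a \<oplus> b) \<otimes> v \<oplus> (s \<oplus> t)"
      using e v Zc RG.g_carrier by (simp add: l_distr a_ac)
    then show "x \<oplus> y \<in> ?S" using e Z' RG.g_add by blast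
  next
    fix c x assume c: "c \<in> Rg 0" "x \<in> ?S"
    then obtain a s where e: "x = a \<otimes> v \<oplus> s" "a \<in> Rg 0" "s \<in> Z" by blast
    have "c \<otimes> x = (c \<otimes> a) \<otimes> v \<oplus> c \<otimes> s"
      using e v Zc c RG.g_carrier by (simp add: r_distr m_assoc)
    moreover have "c \<otimes> a \<in> Rg 0" using mult_degree[OF c(1) e(2)] by simp
    ultimately show "c \<otimes> x \<in> ?S" using e Z' c by blast
  qed
qed

lemma amodule_aspan: "amodule Z \<Longrightarrow> set vs \<subseteq> carrier R \<Longrightarrow> amodule (aspan Z vs)"
  by (induct vs) (auto intro: amodule_cons(1))

lemma aspan_base: "amodule Z \<Longrightarrow> set vs \<subseteq> carrier R \<Longrightarrow> Z \<subseteq> aspan Z vs"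
proof (induct vs)
  case (Cons v vs)
  then show ?case using amodule_cons(2)[OF amodule_aspan[of Z vs], of v] by simp
qed simp

lemma aspan_set: "amodule Z \<Longrightarrow> set vs \<subseteq> carrier R \<Longrightarrow> set vs \<subseteq> aspan Z vs"
proof (induct vs)
  case (Cons v vs)
  then show ?case using amodule_cons(2,3)[OF amodule_aspan[of Z vs], of v] by simp
qed simp

lemma aspan_least: "amodule W \<Longrightarrow> Z \<subseteq> W \<Longrightarrow> set vs \<subseteq> W \<Longrightarrow> aspan Z vs \<subseteq> W"
  by (induct vs) (auto simp: amodule_def)

lemma aspan_subset_aspan:
  assumes "amodule W" "set ws \<subseteq> carrier R" "Z \<subseteq> aspan W ws" "set vs \<subseteq> aspan W ws"
  shows "aspan Z vs \<subseteq> aspan W ws"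
  using assms by (intro aspan_least amodule_aspan)

lemma residual_mono: "residual Z \<Longrightarrow> amodule W \<Longrightarrow> Z \<subseteq> W \<Longrightarrow> residual W"
  by (auto simp: residual_def)

text \<open>Steinitz exchange: enlarging the base by one vector costs at most one independent
  vector. The clause \<open>w \<in> aspan Z us\<close> serves the induction: if the vector is
  dropped from the tail, \<open>w\<close> already lies in the span of the tail, so the head stays
  independent.\<close>

lemma aindep_exchange:
  assumes Z: "residual Z" and w: "w \<in> carrier R" and "set us \<subseteq> carrier R" "aindep Z us"
  shows "aindep (aspan Z [w]) us \<or>
    (\<exists>us'. set us' \<subseteq> set us \<and> length us = Suc (length us') \<and> aindep (aspan Z [w]) us' \<and> w \<in> aspan Z us)"
  using assms(3,4)
proof (induct us)
  case (Cons v vs)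
  let ?Z = "aspan Z [w]"
  have am: "amodule Z" using Z by (simp add: residual_def)
  have vc: "v \<in> carrier R" and vsc: "set vs \<subseteq> carrier R" using Cons by auto
  have aZ: "amodule ?Z" using am w by (intro amodule_aspan) auto
  have aS: "amodule (aspan Z vs)" by (rule amodule_aspan[OF am vsc])
  have mono: "aspan Z vs \<subseteq> aspan Z (v # vs)" using amodule_cons(2)[OF aS vc] by simp
  have vnot: "v \<notin> aspan Z vs" using Cons by simp
  consider "aindep ?Z vs" | us' where "set us' \<subseteq> set vs" "length vs = Suc (length us')" "aindep ?Z us'" "w \<in> aspan Z vs"
    using Cons by auto
  then show ?case
  proof cases
    case 1
    show ?thesis
    proof (cases "v \<in> aspan ?Z vs")
      case False
      then show ?thesis using 1 by simp
    next
      case True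
      have "aspan ?Z vs \<subseteq> aspan Z (w # vs)"
      proof (rule aspan_subset_aspan[OF am])
        show "?Z \<subseteq> aspan Z (w # vs)" using aspan_base[OF am vsc] by auto
        have "set vs \<subseteq> aspan Z vs" by (rule aspan_set[OF am vsc])
        then show "set vs \<subseteq> aspan Z (w # vs)" using amodule_cons(2)[OF aS w] by simp
      qed (use w vsc in auto)
      then obtain a s where as: "v = a \<otimes> w \<oplus> s" "a \<in> Rg 0" "s \<in> aspan Z vs" using True by auto
      have ac: "a \<in> carrier R" "s \<in> carrier R" using as RG.g_carrier aS by (auto simp: amodule_def)
      \<comment> \<open>A coefficient in \<open>\<mm>\<close> would put \<open>a w\<close> into the
        base and hence \<open>v\<close> into the span of \<open>vs\<close>. So \<open>a\<close> is
        invertible and \<open>w\<close> can be solved for.\<close>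
      have "a \<notin> \<mm>"
      proof
        assume "a \<in> \<mm>"
        then have "a \<otimes> w \<in> aspan Z vs" using Z w aspan_base[OF am vsc] by (auto simp: residual_def)
        then show False using vnot as aS by (simp add: amodule_def)
      qed
      then obtain b where b: "b \<in> Rg 0" "b \<otimes> a = \<one>" using A_unit as by blast
      have bc: "b \<in> carrier R" using b RG.g_carrier by blast
      have "b \<otimes> v = (b \<otimes> a) \<otimes> w \<oplus> b \<otimes> s" using as(1) bc ac w by (simp add: r_distr m_assoc)
      then have "b \<otimes> v = w \<oplus> b \<otimes> s" using b(2) w by simp
      then have "w = b \<otimes> v \<oplus> (\<ominus> b) \<otimes> s" using bc ac w by algebra
      moreover have "(\<ominus> b) \<otimes> s \<in> aspan Z vs" using aS as(3) b(1) RG.g_a_inv by (simp add: amodule_def)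
      ultimately have "w \<in> aspan Z (v # vs)" using b(1) by auto
      then show ?thesis using 1 by (intro disjI2 exI[of _ vs]) auto
    qed
  next
    case 2
    have us'c: "set us' \<subseteq> carrier R" using 2 vsc by blast
    have "set vs \<subseteq> aspan Z vs" by (rule aspan_set[OF am vsc])
    then have "set us' \<subseteq> aspan Z vs" using 2(1) by blast
    moreover have "?Z \<subseteq> aspan Z vs"
      using aspan_base[OF am vsc] 2(4) by (intro aspan_least[OF aS]) auto
    ultimately have "aspan ?Z us' \<subseteq> aspan Z vs" by (rule aspan_least[OF aS, rotated])
    then have "aindep ?Z (v # us')" using vnot 2(3) by auto
    then show ?thesis using 2 mono by (intro disjI2 exI[of _ "v # us'"]) auto
  qed
qed simp

text \<open>The vectors of the spanning list are moved one by one into the base \<open>Z\<close>,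
  each time losing at most one vector of \<open>us\<close>; therefore \<open>Z\<close> and
  \<open>us\<close> vary in the induction.\<close>

lemma aindep_length_le:
  assumes "residual Z" "set ws \<subseteq> carrier R" "set us \<subseteq> carrier R" "aindep Z us" "set us \<subseteq> aspan Z ws"
  shows "length us \<le> length ws"
  using assms
proof (induct ws arbitrary: Z us)
  case Nil
  show ?case
  proof (cases us)
    case (Cons v vs)
    then have "v \<in> aspan Z vs" using Nil aspan_base[of Z vs] by (auto simp: residual_def)
    then show ?thesis using Nil Cons by simp
  qed simp
next
  case (Cons w ws)
  let ?Z = "aspan Z [w]"
  have am: "amodule Z" using Cons by (simp add: residual_def)
  have w: "w \<in> carrier R" and wsc: "set ws \<subseteq> carrier R" using Cons by auto
  have aZ: "amodule ?Z" using am w by (intro amodule_aspan) auto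
  have "Z \<subseteq> ?Z" "w \<in> ?Z" using aspan_base[OF am, of "[w]"] aspan_set[OF am, of "[w]"] w by (auto simp del: aspan.simps)
  then have rZ: "residual ?Z" using residual_mono[OF _ aZ] Cons by blast
  have "?Z \<subseteq> aspan ?Z ws" by (rule aspan_base[OF aZ wsc])
  then have "aspan Z (w # ws) \<subseteq> aspan ?Z ws"
    using \<open>Z \<subseteq> ?Z\<close> \<open>w \<in> ?Z\<close> aspan_set[OF aZ wsc]
    by (intro aspan_subset_aspan[OF aZ wsc]) (auto simp del: aspan.simps)
  then have us: "set us \<subseteq> aspan ?Z ws" using Cons by (auto simp del: aspan.simps)
  consider "aindep ?Z us" | us' where "set us' \<subseteq> set us" "length us = Suc (length us')" "aindep ?Z us'"
    using aindep_exchange[OF Cons(2) w Cons(4,5)] by blast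
  then show ?case
  proof cases
    case 1
    then show ?thesis using Cons(1)[OF rZ wsc Cons(4) _ us] by simp
  next
    case 2
    then have "length us' \<le> length ws" using us Cons by (intro Cons(1)[OF rZ wsc]) auto
    then show ?thesis using 2 by simp
  qed
qed

section \<open>Independent vectors gained from a strict inclusion of primes\<close>

primrec blocks :: "'a \<Rightarrow> 'a list \<Rightarrow> nat \<Rightarrow> 'a list" where
  "blocks x vs 0 = []"
| "blocks x vs (Suc n) = vs @ map (\<lambda>y. x \<otimes> y) (blocks x vs n)"

lemma length_blocks: "length (blocks x vs n) = n * length vs"
  by (induct n) auto

lemma blocks_carrier: "x \<in> carrier R \<Longrightarrow> set vs \<subseteq> carrier R \<Longrightarrow> set (blocks x vs n) \<subseteq> carrier R"
  by (induct n) auto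

text \<open>Multiplication by \<open>x\<close> is injective on \<open>R/P\<close> because
  \<open>P\<close> is prime; a relation between the images can be divided by
  \<open>x\<close>.\<close>

lemma aindep_map_mult:
  assumes P: "primeideal P R" and aP: "amodule P" and x: "x \<in> carrier R" "x \<notin> P"
    and "set us \<subseteq> carrier R" "aindep P us"
  shows "aindep P (map (\<lambda>y. x \<otimes> y) us)"
  using assms(5,6)
proof (induct us)
  case (Cons v us)
  interpret P: primeideal P R by (rule P)
  have usc: "set us \<subseteq> carrier R" and v: "v \<in> carrier R" using Cons by auto
  let ?V = "aspan P us"
  have aV: "amodule ?V" by (rule amodule_aspan[OF aP usc])
  then have Vc: "?V \<subseteq> carrier R" by (simp add: amodule_def)
  let ?W = "{x \<otimes> y \<oplus> p | y p. y \<in> ?V \<and> p \<in> P}"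
  have "amodule ?W"
    unfolding amodule_def
  proof (intro conjI ballI)
    show "?W \<subseteq> carrier R" using Vc x by auto
    have "\<zero> = x \<otimes> \<zero> \<oplus> \<zero>" using x by simp
    moreover have "\<zero> \<in> ?V" "\<zero> \<in> P" using aV by (auto simp: amodule_def)
    ultimately show "\<zero> \<in> ?W" by blast
    fix y z assume "y \<in> ?W" "z \<in> ?W"
    then obtain s p t q where e: "y = x \<otimes> s \<oplus> p" "z = x \<otimes> t \<oplus> q" "s \<in> ?V" "t \<in> ?V" "p \<in> P" "q \<in> P" by blast
    have c: "s \<in> carrier R" "t \<in> carrier R" "p \<in> carrier R" "q \<in> carrier R" using e Vc by auto
    have "y \<oplus> z = x \<otimes> (s \<oplus> t) \<oplus> (p \<oplus> q)" using e c x by (simp add: r_distr a_ac)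
    moreover have "s \<oplus> t \<in> ?V" using aV e by (simp add: amodule_def)
    ultimately show "y \<oplus> z \<in> ?W" using e by blast
  next
    fix a y assume a: "a \<in> Rg 0" "y \<in> ?W"
    then obtain s p where e: "y = x \<otimes> s \<oplus> p" "s \<in> ?V" "p \<in> P" by blast
    have c: "s \<in> carrier R" "p \<in> carrier R" "a \<in> carrier R" using e Vc a RG.g_carrier by auto
    have "a \<otimes> y = x \<otimes> (a \<otimes> s) \<oplus> a \<otimes> p" using e(1) c x by (simp add: r_distr m_lcomm)
    moreover have "a \<otimes> s \<in> ?V" using aV e a by (simp add: amodule_def)
    ultimately show "a \<otimes> y \<in> ?W" using e c P.I_l_closed by blast
  qed
  moreover have "P \<subseteq> ?W"
  proof
    fix p assume p: "p \<in> P"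
    then have "p = x \<otimes> \<zero> \<oplus> p" using x by simp
    then show "p \<in> ?W" using p aV by (auto simp: amodule_def)
  qed
  moreover have "set (map (\<lambda>y. x \<otimes> y) us) \<subseteq> ?W"
  proof
    fix z assume "z \<in> set (map (\<lambda>y. x \<otimes> y) us)"
    then obtain y where y: "y \<in> set us" "z = x \<otimes> y" by auto
    then have "y \<in> ?V" "z = x \<otimes> y \<oplus> \<zero>" using aspan_set[OF aP usc] usc x by auto
    moreover have "\<zero> \<in> P" by (rule P.zero_closed)
    ultimately show "z \<in> ?W" by blast
  qed
  ultimately have W: "aspan P (map (\<lambda>y. x \<otimes> y) us) \<subseteq> ?W" by (rule aspan_least)
  have "x \<otimes> v \<notin> aspan P (map (\<lambda>y. x \<otimes> y) us)"
  proof
    assume "x \<otimes> v \<in> aspan P (map (\<lambda>y. x \<otimes> y) us)"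
    then obtain y p where e: "x \<otimes> v = x \<otimes> y \<oplus> p" "y \<in> ?V" "p \<in> P" using W by blast
    have c: "y \<in> carrier R" "p \<in> carrier R" using e Vc by auto
    have "x \<otimes> (v \<ominus> y) = p"
    proof -
      have "x \<otimes> (v \<ominus> y) = x \<otimes> v \<ominus> x \<otimes> y" using x v c by algebra
      also have "\<dots> = p" unfolding e(1) using x c by algebra
      finally show ?thesis .
    qed
    then have "v \<ominus> y \<in> P" using P.I_prime[OF x(1), of "v \<ominus> y"] x e v c by auto
    then have "v \<ominus> y \<in> ?V" using aspan_base[OF aP usc] by blast
    then have "(v \<ominus> y) \<oplus> y \<in> ?V" using aV e by (simp add: amodule_def)
    moreover have "(v \<ominus> y) \<oplus> y = v" using v c by algebra
    ultimately show False using Cons by simp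
  qed
  then show ?case using Cons by simp
qed simp

text \<open>All of \<open>us\<close> lies in \<open>Q\<close>, so a vector of \<open>vs\<close>
  depending on the later ones and on \<open>us\<close> modulo \<open>P\<close> would depend on the
  later ones of \<open>vs\<close> modulo \<open>Q\<close>.\<close>

lemma aindep_append:
  assumes "amodule P" "amodule Q" "P \<subseteq> Q" "set us \<subseteq> Q" "aindep P us" "set vs \<subseteq> carrier R" "aindep Q vs"
  shows "aindep P (vs @ us)"
  using assms(6,7)
proof (induct vs)
  case Nil
  then show ?case using assms by simp
next
  case (Cons v vs)
  have "Q \<subseteq> aspan Q vs" using aspan_base[OF assms(2)] Cons by simp
  moreover have "set vs \<subseteq> aspan Q vs" using aspan_set[OF assms(2)] Cons by simp
  ultimately have "aspan P (vs @ us) \<subseteq> aspan Q vs"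
    using assms Cons by (intro aspan_subset_aspan) auto
  then show ?case using Cons by auto
qed

text \<open>The list consists of \<open>vs\<close>, \<open>x vs\<close>, up to the power
  \<open>n - 1\<close> of \<open>x\<close> times \<open>vs\<close>. Multiplication by
  \<open>x\<close> preserves independence modulo \<open>P\<close> and moves everything into
  \<open>Q\<close>, where it can be joined to \<open>vs\<close>. Descending from \<open>Q\<close> to
  \<open>P\<close> multiplies the number of vectors by \<open>n\<close>.\<close>

lemma aindep_blocks:
  assumes P: "primeideal P R" and aP: "amodule P" and Q: "ideal Q R" "amodule Q" and PQ: "P \<subseteq> Q"
    and x: "x \<in> Q" "x \<notin> P" and vs: "set vs \<subseteq> carrier R" "aindep Q vs"
  shows "aindep P (blocks x vs n)"
proof (induct n)
  case (Suc n)
  have xc: "x \<in> carrier R" using x Q(1) ideal.Icarr by metis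
  have c: "set (blocks x vs n) \<subseteq> carrier R" by (rule blocks_carrier[OF xc vs(1)])
  have "aindep P (map (\<lambda>y. x \<otimes> y) (blocks x vs n))" by (rule aindep_map_mult[OF P aP xc x(2) c Suc])
  moreover have "set (map (\<lambda>y. x \<otimes> y) (blocks x vs n)) \<subseteq> Q"
    using c x(1) ideal.I_r_closed[OF Q(1)] by auto
  ultimately show ?case using aindep_append[OF aP Q(2) PQ] vs by simp
qed simp

section \<open>Growth of the ring as an algebra over its degree zero part\<close>

primrec monomials :: "'a list \<Rightarrow> nat \<Rightarrow> 'a list" where
  "monomials [] n = [\<one>]"
| "monomials (g # gs) n = concat (map (\<lambda>e. map (\<lambda>y. g [^] e \<otimes> y) (monomials gs n)) [0..<Suc n])"

text \<open>Exponents are bounded in each generator separately, not in total, and repetitions are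
  kept, which gives an exact count, polynomial in \<open>n\<close> of degree
  \<open>length gs\<close>.\<close>

lemma length_monomials: "length (monomials gs n) = Suc n ^ length gs"
  by (induct gs) (simp_all add: length_concat comp_def sum_list_triv del: upt_Suc)

lemma set_monomials_Cons: "set (monomials (g # gs) n) = {g [^] e \<otimes> y | e y. e \<le> n \<and> y \<in> set (monomials gs n)}"
  by (auto simp del: upt_Suc simp: less_Suc_eq_le) blast

lemma monomials_carrier: "set gs \<subseteq> carrier R \<Longrightarrow> set (monomials gs n) \<subseteq> carrier R"
proof (induct gs)
  case (Cons g gs)
  then show ?case unfolding set_monomials_Cons by auto
qed simp

lemma monomials_mult:
  "set gs \<subseteq> carrier R \<Longrightarrow> x \<in> set (monomials gs m) \<Longrightarrow> y \<in> set (monomials gs n) \<Longrightarrow>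
    x \<otimes> y \<in> set (monomials gs (m + n))"
proof (induct gs arbitrary: x y)
  case (Cons g gs)
  have gc: "g \<in> carrier R" "set gs \<subseteq> carrier R" using Cons by auto
  obtain e x' where x: "x = g [^] e \<otimes> x'" "e \<le> m" "x' \<in> set (monomials gs m)"
    using Cons(3) unfolding set_monomials_Cons by blast
  obtain f y' where y: "y = g [^] f \<otimes> y'" "f \<le> n" "y' \<in> set (monomials gs n)"
    using Cons(4) unfolding set_monomials_Cons by blast
  have c: "x' \<in> carrier R" "y' \<in> carrier R" using x y monomials_carrier[OF gc(2)] by auto
  have "x \<otimes> y = g [^] (e + f) \<otimes> (x' \<otimes> y')"
    using x(1) y(1) c gc by (simp add: nat_pow_mult[symmetric] m_ac)
  moreover have "x' \<otimes> y' \<in> set (monomials gs (m + n))" using Cons(1)[OF gc(2) x(3) y(3)] .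
  ultimately show ?case using x(2) y(2) unfolding set_monomials_Cons
    by (intro CollectI exI[of _ "e + f"] exI[of _ "x' \<otimes> y'"]) auto
qed simp

lemma one_monomials: "set gs \<subseteq> carrier R \<Longrightarrow> \<one> \<in> set (monomials gs n)"
proof (induct gs)
  case (Cons g gs)
  then have "\<one> = g [^] (0::nat) \<otimes> \<one>" "\<one> \<in> set (monomials gs n)" by auto
  then show ?case unfolding set_monomials_Cons by blast
qed simp

lemma gen_monomials: "set gs \<subseteq> carrier R \<Longrightarrow> h \<in> set gs \<Longrightarrow> h \<in> set (monomials gs (Suc 0))"
proof (induct gs)
  case (Cons g gs)
  have gc: "g \<in> carrier R" "set gs \<subseteq> carrier R" using Cons by auto
  show ?case
  proof (cases "h = g")
    case True
    then have "h = g [^] Suc 0 \<otimes> \<one>" using gc by simp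
    then show ?thesis unfolding set_monomials_Cons using one_monomials[OF gc(2)] by blast
  next
    case False
    then have "h \<in> set (monomials gs (Suc 0))" using Cons by auto
    moreover from this have "h \<in> carrier R" using monomials_carrier[OF gc(2)] by blast
    then have "h = g [^] (0::nat) \<otimes> h" by simp
    ultimately show ?thesis unfolding set_monomials_Cons by blast
  qed
qed simp

lemma amodule_zero: "amodule {\<zero>}"
  using RG.g_carrier by (auto simp: amodule_def)

abbreviation bounded_degree :: "'a list \<Rightarrow> nat \<Rightarrow> 'a set"
  where "bounded_degree gs n \<equiv> aspan {\<zero>} (monomials gs n)"

lemma amodule_bounded_degree: "set gs \<subseteq> carrier R \<Longrightarrow> amodule (bounded_degree gs n)"
  by (intro amodule_aspan amodule_zero monomials_carrier)

text \<open>Bilinearity in two passes: a monomial is held fixed while \<open>y\<close> varies over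
  the span, then \<open>y\<close> is held fixed while \<open>x\<close> varies.\<close>

lemma bounded_degree_mult:
  assumes gs: "set gs \<subseteq> carrier R" and x: "x \<in> bounded_degree gs m" and y: "y \<in> bounded_degree gs n"
  shows "x \<otimes> y \<in> bounded_degree gs (m + n)"
proof -
  let ?V = "bounded_degree gs (m + n)"
  note V = amodule_bounded_degree[OF gs, of "m + n", unfolded amodule_def]
  have V0: "{\<zero>} \<subseteq> ?V" using V by blast
  have step: "amodule {z \<in> carrier R. u \<otimes> z \<in> ?V}" if u: "u \<in> carrier R" for u
    unfolding amodule_def
  proof (intro conjI ballI)
    fix a z assume "a \<in> Rg 0" "z \<in> {z \<in> carrier R. u \<otimes> z \<in> ?V}"
    then show "a \<otimes> z \<in> {z \<in> carrier R. u \<otimes> z \<in> ?V}" using V u RG.g_carrier m_lcomm[of u a z] by simp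
  qed (use V u in \<open>auto simp: r_distr\<close>)
  have 1: "u \<otimes> y \<in> ?V" if u: "u \<in> set (monomials gs m)" for u
  proof -
    have uc: "u \<in> carrier R" using u monomials_carrier[OF gs] by blast
    have "set (monomials gs n) \<subseteq> {z \<in> carrier R. u \<otimes> z \<in> ?V}"
      using monomials_mult[OF gs u] monomials_carrier[OF gs] aspan_set[OF amodule_zero monomials_carrier[OF gs, of "m + n"]] by blast
    then have "bounded_degree gs n \<subseteq> {z \<in> carrier R. u \<otimes> z \<in> ?V}"
      using V uc by (intro aspan_least[OF step[OF uc]]) auto
    then show ?thesis using y by blast
  qed
  have yc: "y \<in> carrier R" using y amodule_bounded_degree[OF gs, of n] by (auto simp: amodule_def)
  have "set (monomials gs m) \<subseteq> {z \<in> carrier R. y \<otimes> z \<in> ?V}"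
  proof
    fix u assume u: "u \<in> set (monomials gs m)"
    then have "u \<in> carrier R" using monomials_carrier[OF gs] by blast
    then show "u \<in> {z \<in> carrier R. y \<otimes> z \<in> ?V}" using 1[OF u] m_comm yc by simp
  qed
  then have "bounded_degree gs m \<subseteq> {z \<in> carrier R. y \<otimes> z \<in> ?V}"
    using V yc by (intro aspan_least[OF step[OF yc]]) auto
  then have "x \<in> carrier R" "y \<otimes> x \<in> ?V" using x by auto
  then show ?thesis using m_comm yc by simp
qed

lemma one_bounded_degree: "set gs \<subseteq> carrier R \<Longrightarrow> \<one> \<in> bounded_degree gs n"
  using one_monomials aspan_set[OF amodule_zero monomials_carrier] by blast

lemma bounded_degree_mono:
  assumes gs: "set gs \<subseteq> carrier R" and x: "x \<in> bounded_degree gs m" shows "x \<in> bounded_degree gs (m + n)"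
proof -
  have "x \<in> carrier R" using x amodule_bounded_degree[OF gs, of m] by (auto simp: amodule_def)
  then show ?thesis using bounded_degree_mult[OF gs x one_bounded_degree[OF gs, of n]] by simp
qed

text \<open>A maximal one among the ideals generated by finite subsets of
  \<open>Rg (axis i 1)\<close> contains the whole piece. Comparing components in degree
  \<open>axis i 1\<close> replaces coefficients from \<open>R\<close> by coefficients from
  \<open>A\<close>.\<close>

lemma axis_finitely_generated:
  "\<exists>fs. set fs \<subseteq> Rg (axis i 1) \<and> Rg (axis i 1) \<subseteq> aspan {\<zero>} fs"
proof -
  let ?X = "Rg (axis i 1)"
  have Xc: "?X \<subseteq> carrier R" using RG.g_carrier by blast
  let ?F = "{Idl F | F. F \<subseteq> ?X \<and> finite F}"
  have "\<exists>K\<in>?F. Idl {} \<subseteq> K \<and> (\<forall>K'\<in>?F. K \<subseteq> K' \<longrightarrow> K' = K)"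
  proof (rule noetherian_ring.ideal_maximal[OF noetherian])
    show "Idl {} \<in> ?F" by blast
    show "ideal I R" if "I \<in> ?F" for I using that Xc genideal_ideal by blast
  qed
  then obtain K where K: "K \<in> ?F" and max: "\<forall>K'\<in>?F. K \<subseteq> K' \<longrightarrow> K' = K" by (elim bexE conjE)
  obtain F where F: "F \<subseteq> ?X" "finite F" "K = Idl F" using K by blast
  have Fc: "F \<subseteq> carrier R" using F Xc by blast
  have X_F: "x \<in> Idl F" if x: "x \<in> ?X" for x
  proof -
    have c: "insert x F \<subseteq> carrier R" using Fc Xc x by blast
    have "Idl F \<subseteq> Idl (insert x F)" using genideal_self[OF c] by (intro genideal_minimal genideal_ideal c) blast
    moreover have "Idl (insert x F) \<in> ?F" using F x by blast
    ultimately have "Idl (insert x F) = Idl F" using max F(3) by simp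
    then show ?thesis using genideal_self[OF c] by blast
  qed
  obtain fs where fs: "set fs = F" using F(2) finite_list by blast
  have fsc: "set fs \<subseteq> carrier R" using fs Fc by blast
  let ?V = "aspan {\<zero>} fs"
  have aV: "amodule ?V" by (rule amodule_aspan[OF amodule_zero fsc])
  note V = aV[unfolded amodule_def]
  \<comment> \<open>An ideal containing \<open>F\<close>: for \<open>f\<close> in \<open>F\<close>
    only the degree zero part of \<open>r\<close> contributes to \<open>r f\<close> in degree
    \<open>axis i 1\<close>.\<close>
  let ?K = "{y \<in> carrier R. \<forall>r\<in>carrier R. gcomp R Rg (axis i 1) (r \<otimes> y) \<in> ?V}"
  have "ideal ?K R"
  proof (rule idealI[OF ring_axioms])
    show "subgroup ?K (add_monoid R)"
    proof (rule add.subgroupI)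
      show "?K \<subseteq> carrier R" by blast
      have "\<zero> \<in> ?K" using V by simp
      then show "?K \<noteq> {}" by blast
      fix a assume a: "a \<in> ?K"
      have "r \<otimes> (\<ominus> a) = (\<ominus> r) \<otimes> a" if "r \<in> carrier R" for r using that a by (simp add: l_minus r_minus)
      then show "\<ominus> a \<in> ?K" using a by simp
      fix b assume b: "b \<in> ?K"
      show "a \<oplus> b \<in> ?K" using a b V by (simp add: r_distr RG.gcomp_add)
    qed
    fix a x assume a: "a \<in> ?K" and x: "x \<in> carrier R"
    have "r \<otimes> (x \<otimes> a) = (r \<otimes> x) \<otimes> a" if "r \<in> carrier R" for r using that a x by (simp add: m_assoc)
    then show "x \<otimes> a \<in> ?K" using a x by simp
    then show "a \<otimes> x \<in> ?K" using a x m_comm[of a x] by simp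
  qed
  moreover have "F \<subseteq> ?K"
  proof
    fix f assume f: "f \<in> F"
    then have fX: "f \<in> ?X" and fc: "f \<in> carrier R" using F Fc by auto
    have "gcomp R Rg (axis i 1) (r \<otimes> f) \<in> ?V" if r: "r \<in> carrier R" for r
    proof -
      have "gcomp R Rg (axis i 1 + 0) (f \<otimes> r) = f \<otimes> gcomp R Rg 0 r"
        using gcomp_mult[OF fX r, of "axis i 1 + 0"] by (metis add_left_cancel)
      then have "gcomp R Rg (axis i 1) (r \<otimes> f) = gcomp R Rg 0 r \<otimes> f" using m_comm r fc by simp
      moreover have "f \<in> ?V" using aspan_set[OF amodule_zero fsc] fs f by blast
      ultimately show ?thesis using V RG.gcomp_in[OF r] by simp
    qed
    then show "f \<in> ?K" using fc by simp
  qed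
  ultimately have IK: "Idl F \<subseteq> ?K" by (rule genideal_minimal)
  have "?X \<subseteq> ?V"
  proof
    fix x assume x: "x \<in> ?X"
    then have "x \<in> ?K" using X_F IK by blast
    then have "gcomp R Rg (axis i 1) (\<one> \<otimes> x) \<in> ?V" by blast
    then show "x \<in> ?V" using RG.gcomp_homogeneous[OF x] RG.g_carrier[OF x] by simp
  qed
  then show ?thesis using F fs by blast
qed

lemma ring_finitely_generated:
  "\<exists>gs. set gs \<subseteq> carrier R \<and> (\<forall>x\<in>carrier R. \<exists>n. x \<in> bounded_degree gs n)"
proof -
  obtain f where f: "\<And>i. set (f i) \<subseteq> Rg (axis i 1) \<and> Rg (axis i 1) \<subseteq> aspan {\<zero>} (f i)"
    using axis_finitely_generated by metis
  obtain js :: "'r::{finite, linorder} list" where js: "set js = UNIV" using finite_list[OF finite] by blast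
  define gs where "gs = concat (map f js)"
  have set_gs: "set gs = (\<Union>i. set (f i))" by (auto simp: gs_def js)
  have gs: "set gs \<subseteq> carrier R" using f RG.g_carrier unfolding set_gs by blast
  let ?U = "{x \<in> carrier R. \<exists>n. x \<in> bounded_degree gs n}"
  have V: "amodule (bounded_degree gs n)" for n by (rule amodule_bounded_degree[OF gs])
  have Vc: "bounded_degree gs n \<subseteq> carrier R" for n using V by (simp add: amodule_def)
  have A: "a \<in> bounded_degree gs 0" if a: "a \<in> Rg 0" for a
  proof -
    have "a \<otimes> \<one> \<in> bounded_degree gs 0" using V a one_bounded_degree[OF gs] by (simp add: amodule_def)
    then show ?thesis using a RG.g_carrier by simp
  qed
  have B: "x \<in> bounded_degree gs (Suc 0)" if x: "x \<in> Rg (axis i 1)" for x i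
  proof -
    have "set (f i) \<subseteq> set (monomials gs (Suc 0))" using gen_monomials[OF gs] set_gs by blast
    then have "set (f i) \<subseteq> bounded_degree gs (Suc 0)"
      using aspan_set[OF amodule_zero monomials_carrier[OF gs, of "Suc 0"]] by blast
    then have "aspan {\<zero>} (f i) \<subseteq> bounded_degree gs (Suc 0)"
      using V[of "Suc 0"] by (intro aspan_least) (auto simp: amodule_def)
    then show ?thesis using x f by blast
  qed
  have "generate_ring R (Rg 0 \<union> (\<Union>i. Rg (axis i 1))) \<subseteq> ?U"
  proof
    fix h assume "h \<in> generate_ring R (Rg 0 \<union> (\<Union>i. Rg (axis i 1)))"
    then show "h \<in> ?U"
    proof induct
      case one
      then show ?case using one_bounded_degree[OF gs] by blast
    next
      case (incl h)
      then show ?case using A B Vc by blast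
    next
      case (a_inv h)
      then obtain n where n: "h \<in> bounded_degree gs n" "h \<in> carrier R" by blast
      have "(\<ominus> \<one>) \<otimes> h \<in> bounded_degree gs n"
        using V[of n] n(1) RG.g_a_inv[OF one_degree] by (simp add: amodule_def)
      then have "\<ominus> h \<in> bounded_degree gs n" using n(2) by (simp add: l_minus)
      then show ?case using n(2) by blast
    next
      case (eng_add h1 h2)
      then obtain m n where mn: "h1 \<in> bounded_degree gs m" "h2 \<in> bounded_degree gs n" by blast
      have "h1 \<in> bounded_degree gs (m + n)" by (rule bounded_degree_mono[OF gs mn(1)])
      moreover have "h2 \<in> bounded_degree gs (m + n)" using bounded_degree_mono[OF gs mn(2), of m] by (simp add: add.commute)
      ultimately have "h1 \<oplus> h2 \<in> bounded_degree gs (m + n)" using V[of "m + n"] by (simp add: amodule_def)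
      then show ?case using Vc by blast
    next
      case (eng_mult h1 h2)
      then obtain m n where mn: "h1 \<in> bounded_degree gs m" "h2 \<in> bounded_degree gs n" by blast
      from bounded_degree_mult[OF gs this] show ?case using Vc by blast
    qed
  qed
  then have "carrier R \<subseteq> ?U" using generated by simp
  then show ?thesis using gs by blast
qed

lemma residual_prime:
  assumes "ideal P R" "\<mm> \<subseteq> P" shows "residual P"
proof -
  interpret P: ideal P R by (rule assms)
  show ?thesis using assms(2) RG.g_carrier P.I_l_closed P.I_r_closed P.a_closed
    unfolding residual_def amodule_def by (auto simp: P.Icarr)
qed

text \<open>Going down one step from \<open>Q\<close> to \<open>P\<close>, pick \<open>x\<close> in
  \<open>Q\<close> but not in \<open>P\<close>, of degree at most \<open>d\<close>. Forming
  \<open>n\<close> blocks multiplies the number of vectors by \<open>n\<close> and raises the degree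
  by at most \<open>d n\<close>. The constant \<open>c\<close> collects these \<open>d\<close> and
  does not depend on \<open>n\<close>.\<close>

lemma prime_chain_independent:
  assumes gs: "set gs \<subseteq> carrier R" "\<And>x. x \<in> carrier R \<Longrightarrow> \<exists>n. x \<in> bounded_degree gs n"
    and "Ps \<noteq> []" "sorted_wrt (\<subset>) Ps" "\<And>P. P \<in> set Ps \<Longrightarrow> primeideal P R \<and> \<mm> \<subseteq> P"
  shows "\<exists>c. \<forall>n. \<exists>us. aindep (hd Ps) us \<and> length us = n ^ (length Ps - 1) \<and> set us \<subseteq> bounded_degree gs (c * n)"
  using assms(3-)
proof (induct Ps rule: list_nonempty_induct)
  case (single P)
  have P: "primeideal P R" "\<mm> \<subseteq> P" using single by auto
  interpret P: primeideal P R by (rule P)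
  have "aindep P [\<one>]" using P.one_imp_carrier P.I_notcarr by auto
  moreover have "set [\<one>] \<subseteq> bounded_degree gs (0 * n)" for n using one_bounded_degree[OF gs(1)] by simp
  ultimately show ?case by (intro exI[of _ 0] allI exI[of _ "[\<one>]"]) simp
next
  case (cons P Ps)
  obtain Q Qs where Ps: "Ps = Q # Qs" using cons(1) by (cases Ps) auto
  have P: "primeideal P R" "\<mm> \<subseteq> P" and Q: "primeideal Q R" "\<mm> \<subseteq> Q" using cons(4) Ps by auto
  have PQ: "P \<subset> Q" using cons(3) Ps by simp
  have iP: "ideal P R" "ideal Q R" using P Q primeideal.axioms(1) by blast+
  have aP: "amodule P" "amodule Q" using residual_prime iP P Q by (simp_all add: residual_def)
  obtain x where x: "x \<in> Q" "x \<notin> P" using PQ by blast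
  have xc: "x \<in> carrier R" using x iP(2) ideal.Icarr by metis
  obtain d where d: "x \<in> bounded_degree gs d" using gs(2)[OF xc] by blast
  obtain c where c: "\<And>n. \<exists>us. aindep Q us \<and> length us = n ^ (length Ps - 1) \<and> set us \<subseteq> bounded_degree gs (c * n)"
    using cons Ps by auto
  have V: "bounded_degree gs n \<subseteq> carrier R" for n using amodule_bounded_degree[OF gs(1)] by (simp add: amodule_def)
  have "\<exists>vs. aindep P vs \<and> length vs = n ^ (length (P # Ps) - 1) \<and> set vs \<subseteq> bounded_degree gs ((c + d) * n)" for n
  proof -
    obtain us where us: "aindep Q us" "length us = n ^ (length Ps - 1)" "set us \<subseteq> bounded_degree gs (c * n)"
      using c by blast
    have usc: "set us \<subseteq> carrier R" using us V by blast
    have "set (blocks x us m) \<subseteq> bounded_degree gs (c * n + d * m)" for m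
    proof (induct m)
      case (Suc m)
      have "y \<in> bounded_degree gs (c * n + d * Suc m)" if "y \<in> set us" for y
        using us(3) that by (intro bounded_degree_mono[OF gs(1)]) blast
      moreover have "x \<otimes> y \<in> bounded_degree gs (c * n + d * Suc m)" if "y \<in> set (blocks x us m)" for y
      proof -
        have "x \<otimes> y \<in> bounded_degree gs (d + (c * n + d * m))"
          using Suc that by (intro bounded_degree_mult[OF gs(1) d]) blast
        then show ?thesis by (simp add: algebra_simps)
      qed
      ultimately show ?case by auto
    qed simp
    from this[of n] have "set (blocks x us n) \<subseteq> bounded_degree gs ((c + d) * n)" by (simp add: algebra_simps)
    moreover have "aindep P (blocks x us n)"
      by (rule aindep_blocks[OF P(1) aP(1) iP(2) aP(2) _ x usc us(1)]) (use PQ in blast)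
    moreover have "length (blocks x us n) = n ^ (length (P # Ps) - 1)"
      using us(2) Ps by (simp add: length_blocks)
    ultimately show ?thesis by blast
  qed
  then show ?case by (intro exI[of _ "c + d"]) simp
qed

text \<open>A chain of length \<open>l\<close> produces \<open>n ^ l\<close> independent elements of degree \<open>O(n)\<close>, but these lie in a
  space of dimension polynomial in \<open>n\<close> of degree the number of generators.\<close>

lemma prime_chain_bounded:
  "\<exists>d. \<forall>Ps. sorted_wrt (\<subset>) Ps \<and> (\<forall>P\<in>set Ps. primeideal P R \<and> \<mm> \<subseteq> P) \<longrightarrow> length Ps \<le> d"
proof -
  obtain gs where gs: "set gs \<subseteq> carrier R" "\<And>x. x \<in> carrier R \<Longrightarrow> \<exists>n. x \<in> bounded_degree gs n"
    using ring_finitely_generated by blast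
  let ?d = "length gs"
  have "length Ps \<le> Suc ?d" if Ps: "sorted_wrt (\<subset>) Ps" "\<And>P. P \<in> set Ps \<Longrightarrow> primeideal P R \<and> \<mm> \<subseteq> P" for Ps
  proof (rule ccontr)
    assume "\<not> length Ps \<le> Suc ?d"
    then have l: "Suc ?d \<le> length Ps - 1" and ne: "Ps \<noteq> []" by auto
    obtain c where c: "\<And>n. \<exists>us. aindep (hd Ps) us \<and> length us = n ^ (length Ps - 1) \<and> set us \<subseteq> bounded_degree gs (c * n)"
      using prime_chain_independent[OF gs ne Ps] by blast
    \<comment> \<open>Chosen larger than \<open>(c + 1) ^ d\<close>, so that the number of monomials
      \<open>(c n + 1) ^ d\<close>, at most \<open>(c + 1) ^ d n ^ d\<close>, stays below
      \<open>n ^ (d + 1)\<close>; here \<open>d\<close> stands for \<open>?d\<close>.\<close>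
    define n where "n = Suc (Suc c ^ ?d)"
    obtain us where us: "aindep (hd Ps) us" "length us = n ^ (length Ps - 1)" "set us \<subseteq> bounded_degree gs (c * n)"
      using c by blast
    have P: "primeideal (hd Ps) R" "\<mm> \<subseteq> hd Ps" using Ps(2) ne by auto
    then have rP: "residual (hd Ps)" using residual_prime primeideal.axioms(1) by blast
    have mc: "set (monomials gs (c * n)) \<subseteq> carrier R" by (rule monomials_carrier[OF gs(1)])
    have "length us \<le> length (monomials gs (c * n))"
    proof (rule aindep_length_le[OF rP mc _ us(1)])
      have aP: "amodule (hd Ps)" using rP by (simp add: residual_def)
      show "set us \<subseteq> carrier R"
        using us(3) amodule_bounded_degree[OF gs(1), of "c * n"] by (auto simp: amodule_def)
      have "{\<zero>} \<subseteq> aspan (hd Ps) (monomials gs (c * n))"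
        using amodule_aspan[OF aP mc] by (simp add: amodule_def)
      then have "bounded_degree gs (c * n) \<subseteq> aspan (hd Ps) (monomials gs (c * n))"
        by (intro aspan_subset_aspan[OF aP mc] aspan_set[OF aP mc])
      then show "set us \<subseteq> aspan (hd Ps) (monomials gs (c * n))" using us(3) by blast
    qed
    then have "n ^ (length Ps - 1) \<le> Suc (c * n) ^ ?d" using us(2) by (simp add: length_monomials)
    also have "\<dots> \<le> (Suc c * n) ^ ?d" by (intro power_mono) (auto simp: n_def)
    also have "\<dots> = Suc c ^ ?d * n ^ ?d" by (rule power_mult_distrib)
    also have "\<dots> < n * n ^ ?d" by (intro mult_strict_right_mono) (auto simp: n_def)
    also have "\<dots> = n ^ Suc ?d" by simp
    also have "\<dots> \<le> n ^ (length Ps - 1)" using l by (intro power_increasing) (auto simp: n_def)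
    finally show False by simp
  qed
  then show ?thesis by blast
qed

end

section \<open>Complete and joint reductions\<close>

lemma (in cring) finprod_notin_prime:
  assumes "primeideal Q R" "finite I" "\<And>i. i \<in> I \<Longrightarrow> f i \<in> carrier R" "\<And>i. i \<in> I \<Longrightarrow> f i \<notin> Q"
  shows "(\<Otimes>i\<in>I. f i) \<notin> Q"
  using assms(2-)
proof (induct I rule: finite_induct)
  case empty
  have "\<one> \<notin> Q" using ideal.one_imp_carrier[OF primeideal.axioms(1)[OF assms(1)]] primeideal.I_notcarr[OF assms(1)] by blast
  then show ?case by simp
next
  case (insert i I)
  have "(\<Otimes>i\<in>insert i I. f i) = f i \<otimes> (\<Otimes>i\<in>I. f i)" using insert by (intro finprod_insert) auto
  moreover have "(\<Otimes>i\<in>I. f i) \<in> carrier R" using insert by (intro finprod_closed) auto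
  ultimately show ?case using insert primeideal.I_prime[OF assms(1), of "f i" "\<Otimes>i\<in>I. f i"] by auto
qed

lemma (in cring) finprod_in_ideal:
  assumes "ideal J R" "finite I" "i0 \<in> I" "\<And>i. i \<in> I \<Longrightarrow> f i \<in> carrier R" "f i0 \<in> J"
  shows "(\<Otimes>i\<in>I. f i) \<in> J"
proof -
  have "(\<Otimes>i\<in>insert i0 (I - {i0}). f i) = f i0 \<otimes> (\<Otimes>i\<in>I - {i0}. f i)"
    using assms by (intro finprod_insert) auto
  moreover have "insert i0 (I - {i0}) = I" using assms(3) by blast
  moreover have "(\<Otimes>i\<in>I - {i0}. f i) \<in> carrier R" using assms by (intro finprod_closed) auto
  ultimately show ?thesis using ideal.I_r_closed[OF assms(1,5)] by simp
qed

text \<open>Each row \<open>i\<close> receives \<open>q i\<close> consecutive columns after offset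
  \<open>off i\<close>; read in the order of the rows they form one interval. The start
  \<open>t\<close> is general because the columns of the first row are consumed in the
  induction.\<close>

lemma concat_consecutive_blocks:
  fixes q :: "'i::linorder \<Rightarrow> nat"
  assumes "sorted_wrt (<) xs" "\<And>i. i \<in> set xs \<Longrightarrow> off i = t + (\<Sum>i'\<in>{i' \<in> set xs. i' < i}. q i')"
  shows "concat (map (\<lambda>i. map (\<lambda>k. off i + k) [1..<Suc (q i)]) xs) = [Suc t..<Suc (t + sum q (set xs))]"
  using assms
proof (induct xs arbitrary: t)
  case (Cons i zs)
  have shift: "map (\<lambda>k. t + k) [1..<Suc m] = [Suc t..<Suc (t + m)]" for m t :: nat
    by (rule nth_equalityI) (auto simp del: upt_Suc)
  have lt: "i < i'" if "i' \<in> set zs" for i' using Cons that by simp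
  have "{i' \<in> set (i # zs). i' < i} = {}" using lt by (auto dest: less_asym)
  then have off: "off i = t" using Cons(3)[of i] by (simp only: sum.empty) simp
  have "concat (map (\<lambda>i. map (\<lambda>k. off i + k) [1..<Suc (q i)]) zs) = [Suc (t + q i)..<Suc (t + q i + sum q (set zs))]"
  proof (rule Cons(1))
    show "sorted_wrt (<) zs" using Cons by simp
    fix j assume j: "j \<in> set zs"
    have "{i' \<in> set (i # zs). i' < j} = insert i {i' \<in> set zs. i' < j}" using lt[OF j] by auto
    moreover have "i \<notin> {i' \<in> set zs. i' < j}" using lt by blast
    ultimately show "off j = t + q i + (\<Sum>i'\<in>{i' \<in> set zs. i' < j}. q i')"
      using Cons(3)[of j] j by simp
  qed
  moreover have "i \<notin> set zs" using lt by blast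
  moreover have "[Suc t..<Suc (t + (q i + sum q (set zs)))] = [Suc t..<Suc (t + q i)] @ [Suc (t + q i)..<Suc (t + q i + sum q (set zs))]"
    using upt_add_eq_append[of "Suc t" "Suc (t + q i)" "sum q (set zs)"] by (simp del: upt_Suc add: add.assoc)
  ultimately show ?case by (simp del: upt_Suc add: off shift[unfolded One_nat_def])
qed simp

context standard_local_module
begin

abbreviation "deg_prod h \<equiv> (\<Otimes>i\<in>UNIV. h i)"

lemma homogeneous_finprod:
  "finite I \<Longrightarrow> (\<And>i. i \<in> I \<Longrightarrow> homogeneous Rg (f i)) \<Longrightarrow> homogeneous Rg (\<Otimes>i\<in>I. f i)"
proof (induct I rule: finite_induct)
  case empty
  then show ?case using one_degree by (auto simp: homogeneous_def)
next
  case (insert i I)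
  have c: "f j \<in> carrier R" if "j \<in> insert i I" for j
    using insert(4)[OF that] RG.g_carrier by (auto simp: homogeneous_def)
  have "(\<Otimes>i\<in>insert i I. f i) = f i \<otimes> (\<Otimes>i\<in>I. f i)" using insert c by (intro finprod_insert) auto
  then show ?case using insert homogeneous_mult by simp
qed

lemma Supp_pp_eq: "submodule N R M \<Longrightarrow> Supp_pp R Rg (quotient_module M N) = relevant_support N"
  using Supp_pp_quotient_module[of N] unfolding relevant_support_def by blast

text \<open>The first set is avoided for filter-regularity, with \<open>F\<close> a selection of
  earlier entries; the second for the drop of the support, with \<open>F\<close> the earlier column
  products.\<close>

definition bad_primes :: "'a set \<Rightarrow> 'a set set"
  where "bad_primes F = relevant_colon_primes (set_times_module R F M) \<union>
    relevant_colon_primes (set_times_module R (\<mm> \<union> F) M)"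

lemma exists_avoiding_family:
  assumes C: "finite C" "C \<subseteq> carrier R"
  shows "\<exists>h. \<forall>i. h i \<in> Rg (axis i 1) \<and> (\<forall>F\<subseteq>C. \<forall>Q\<in>bad_primes F. h i \<notin> Q)"
proof -
  let ?P = "\<Union>F\<in>Pow C. bad_primes F"
  have fin: "finite (bad_primes F)" if "F \<subseteq> C" for F
  proof -
    have c: "F \<subseteq> carrier R" "\<mm> \<union> F \<subseteq> carrier R" using that C m_carrier by auto
    show ?thesis unfolding bad_primes_def relevant_colon_primes_def
      using FG.finite_colon_primes[OF set_times_module_is_submodule] c by simp
  qed
  have "\<exists>x\<in>Rg (axis i 1). \<forall>Q\<in>?P. x \<notin> Q" for i
  proof (rule avoid_relevant_primes)
    show "finite ?P" using C(1) fin by auto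
  qed (auto simp: bad_primes_def relevant_colon_primes_def colon_primes_def)
  then obtain h where h: "\<And>i. h i \<in> Rg (axis i 1) \<and> (\<forall>Q\<in>?P. h i \<notin> Q)" by metis
  have "h i \<notin> Q" if "F \<subseteq> C" "Q \<in> bad_primes F" for i F Q
    using h[of i] that by (meson PowI UN_I)
  then show ?thesis using h by (intro exI[of _ h] allI conjI impI ballI) simp_all
qed

text \<open>Letting \<open>F\<close> be any subset of the earlier entries and column products covers
  both uses at once and leaves finitely many conditions per column.\<close>

lemma exists_avoiding_sequence:
  "\<exists>h :: nat \<Rightarrow> _. (\<forall>j i. h j i \<in> Rg (axis i 1)) \<and>
    (\<forall>j i. \<forall>F \<subseteq> (\<Union>m<j. range (h m)) \<union> {deg_prod (h m) | m. m < j}. \<forall>Q\<in>bad_primes F. h j i \<notin> Q)"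
proof -
  \<comment> \<open>Dependent choice passes on only the preceding state, so the set \<open>C\<close>
    of all elements to be taken into account is carried along with the current column
    \<open>h\<close>.\<close>
  let ?P = "\<lambda>n (C, h). finite C \<and> C \<subseteq> carrier R \<and>
    (\<forall>i. h i \<in> Rg (axis i 1) \<and> (\<forall>F\<subseteq>C. \<forall>Q\<in>bad_primes F. h i \<notin> Q))"
  let ?Q = "\<lambda>n (C, h) (C', h'). C' = C \<union> range h \<union> {deg_prod h}"
  have "\<exists>f. \<forall>n. ?P n (f n) \<and> ?Q n (f n) (f (Suc n))"
  proof (rule dependent_nat_choice)
    have "\<exists>h. \<forall>i. h i \<in> Rg (axis i 1) \<and> (\<forall>F\<subseteq>{}. \<forall>Q\<in>bad_primes F. h i \<notin> Q)"
      by (rule exists_avoiding_family) simp_all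
    then obtain h where "\<forall>i. h i \<in> Rg (axis i 1) \<and> (\<forall>F\<subseteq>{}. \<forall>Q\<in>bad_primes F. h i \<notin> Q)" by (elim exE)
    then show "\<exists>x. ?P 0 x" by (intro exI[of _ "({}, h)"]) simp
    fix x n assume "?P n x"
    then obtain C h where x: "x = (C, h)" "finite C" "C \<subseteq> carrier R" "\<And>i. h i \<in> Rg (axis i 1)" by (cases x) auto
    have hc: "h i \<in> carrier R" for i using x RG.g_carrier by blast
    let ?C = "C \<union> range h \<union> {deg_prod h}"
    have "finite ?C" using x by simp
    moreover have "?C \<subseteq> carrier R" using x hc by (auto intro!: finprod_closed)
    ultimately have "\<exists>h'. \<forall>i. h' i \<in> Rg (axis i 1) \<and> (\<forall>F\<subseteq>?C. \<forall>Q\<in>bad_primes F. h' i \<notin> Q)"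
      by (rule exists_avoiding_family)
    then obtain h' where "\<forall>i. h' i \<in> Rg (axis i 1) \<and> (\<forall>F\<subseteq>?C. \<forall>Q\<in>bad_primes F. h' i \<notin> Q)"
      by (elim exE)
    then show "\<exists>y. ?P (Suc n) y \<and> ?Q n x y"
      using \<open>finite ?C\<close> \<open>?C \<subseteq> carrier R\<close> x(1) by (intro exI[of _ "(?C, h')"]) simp
  qed
  then obtain f where f': "\<forall>n. ?P n (f n) \<and> ?Q n (f n) (f (Suc n))" by (elim exE)
  note f = conjunct1[OF spec[OF f']] conjunct2[OF spec[OF f']]
  define C where "C n = fst (f n)" for n
  define h where "h n = snd (f n)" for n
  have h: "h n i \<in> Rg (axis i 1)" "\<And>F Q. F \<subseteq> C n \<Longrightarrow> Q \<in> bad_primes F \<Longrightarrow> h n i \<notin> Q" for n i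
    using f(1)[of n] by (auto simp: C_def h_def split_def)
  have step: "C (Suc n) = C n \<union> range (h n) \<union> {deg_prod (h n)}" for n
    using f(2)[of n] by (simp add: C_def h_def split_def)
  have "(\<Union>m<j. range (h m)) \<union> {deg_prod (h m) | m. m < j} \<subseteq> C j" for j
  proof (induct j)
    case (Suc j)
    have "(\<Union>m<Suc j. range (h m)) \<union> {deg_prod (h m) | m. m < Suc j} =
      ((\<Union>m<j. range (h m)) \<union> {deg_prod (h m) | m. m < j}) \<union> range (h j) \<union> {deg_prod (h j)}"
      by (auto simp: less_Suc_eq lessThan_Suc)
    then show ?case using Suc step[of j] by blast
  qed simp
  note sub = this
  have "h j i \<notin> Q" if "F \<subseteq> (\<Union>m<j. range (h m)) \<union> {deg_prod (h m) | m. m < j}" "Q \<in> bad_primes F" for j i F Q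
    by (rule h(2)[OF subset_trans[OF that(1) sub] that(2)])
  then have "\<forall>j i. \<forall>F \<subseteq> (\<Union>m<j. range (h m)) \<union> {deg_prod (h m) | m. m < j}. \<forall>Q\<in>bad_primes F. h j i \<notin> Q" by simp
  moreover have "\<forall>j i. h j i \<in> Rg (axis i 1)" using h(1) by (rule allI[OF allI])
  ultimately show ?thesis by (intro exI[of _ h] conjI)
qed

lemma filter_regular_quotient:
  assumes F: "F \<subseteq> carrier R" and a: "a \<in> Rg n" "\<And>Q. Q \<in> bad_primes F \<Longrightarrow> a \<notin> Q"
  shows "filter_regular R Rg (quotient_module M (set_times_module R (Idl F) M)) a"
  unfolding filter_regular_def set_times_module_genideal[OF F]
    Ass_quotient_module[OF set_times_module_is_submodule[OF F]]
  using a by (auto simp: homogeneous_def bad_primes_def relevant_colon_primes_def)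

lemma m_subset_relevant_support:
  assumes "P \<in> relevant_support (set_times_module R \<mm> M)" shows "\<mm> \<subseteq> P"
proof -
  obtain x where x: "x \<in> carrier M" "colon R M (set_times_module R \<mm> M) x \<subseteq> P"
    using assms by (auto simp: relevant_support_def)
  have "\<mm> \<subseteq> colon R M (set_times_module R \<mm> M) x"
    using set_times_module_incl[OF _ x(1)] m_carrier by (auto simp: colon_def)
  then show ?thesis using x(2) by (rule subset_trans)
qed

text \<open>The added \<open>1\<close> in the spread turns the length of a chain into its number of
  primes, so the spread is the largest \<open>length Ps\<close>. The maximum exists since all these
  primes contain \<open>\<mm>\<close>.\<close>

lemma spread_is_maximal_chain_length:
  "\<exists>s. spread R Rg \<mm> M = ereal (real s) \<and>
    (\<forall>Ps. sorted_wrt (\<subset>) Ps \<and> set Ps \<subseteq> relevant_support (set_times_module R \<mm> M) \<longrightarrow> length Ps \<le> s)"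
proof -
  let ?S = "relevant_support (set_times_module R \<mm> M)"
  let ?chain = "\<lambda>Ps. sorted_wrt (\<subset>) Ps \<and> set Ps \<subseteq> ?S"
  obtain d where d: "\<And>Ps. sorted_wrt (\<subset>) Ps \<Longrightarrow> (\<forall>P\<in>set Ps. primeideal P R \<and> \<mm> \<subseteq> P) \<Longrightarrow> length Ps \<le> d"
    using prime_chain_bounded by blast
  have bound: "length Ps \<le> d" if "?chain Ps" for Ps
  proof (rule d)
    show "\<forall>P\<in>set Ps. primeideal P R \<and> \<mm> \<subseteq> P"
    proof
      fix P assume "P \<in> set Ps"
      then have P: "P \<in> ?S" using that by (elim conjE) (rule subsetD)
      then have "primeideal P R" by (simp add: relevant_support_def)
      then show "primeideal P R \<and> \<mm> \<subseteq> P" using m_subset_relevant_support[OF P] by (rule conjI)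
    qed
  qed (use that in simp)
  let ?L = "{length Ps | Ps. ?chain Ps}"
  have fin: "finite ?L" by (rule finite_subset[of _ "{..d}"]) (use bound in auto)
  have "0 \<in> ?L" by (intro CollectI exI[of _ "[]"]) simp
  then have ne: "?L \<noteq> {}" by blast
  define s where "s = Max ?L"
  obtain Ps where Ps: "?chain Ps" "length Ps = s" using Max_in[OF fin ne] unfolding s_def by auto
  have le: "length Qs \<le> s" if "?chain Qs" for Qs unfolding s_def using that by (intro Max_ge[OF fin]) blast
  have supp: "Supp_pp R Rg (quotient_module M (set_times_module R \<mm> M)) = ?S"
    by (rule Supp_pp_eq[OF set_times_module_is_submodule[OF m_carrier]])
  have "chain_dim ?S + 1 = ereal (real s)"
  proof (cases "?S = {}")
    case True
    then have "s = 0" using Ps by simp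
    then show ?thesis using True by (simp add: chain_dim_def one_ereal_def)
  next
    case False
    then obtain P where "P \<in> ?S" by blast
    then have "length [P] \<le> s" by (intro le) simp
    then obtain l where l: "s = Suc l" by (cases s) auto
    have "Sup {ereal (real l) | l. \<exists>Ps. length Ps = Suc l \<and> set Ps \<subseteq> ?S \<and> sorted_wrt (\<subset>) Ps} = ereal (real l)"
    proof (rule antisym)
      show "Sup {ereal (real l) | l. \<exists>Ps. length Ps = Suc l \<and> set Ps \<subseteq> ?S \<and> sorted_wrt (\<subset>) Ps} \<le> ereal (real l)"
        using le l by (intro Sup_least) fastforce
      show "ereal (real l) \<le> Sup {ereal (real l) | l. \<exists>Ps. length Ps = Suc l \<and> set Ps \<subseteq> ?S \<and> sorted_wrt (\<subset>) Ps}"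
        using Ps l by (intro Sup_upper) blast
    qed
    then show ?thesis using False l by (simp add: chain_dim_def one_ereal_def)
  qed
  then have "spread R Rg \<mm> M = ereal (real s)" by (simp add: spread_def supp)
  then show ?thesis using le by blast
qed

text \<open>The columns of both kinds of reduction come from here; \<open>h j i\<close> is the entry
  in row \<open>i\<close> and column \<open>j\<close>, and columns are counted from
  \<open>1\<close>.\<close>

lemma exists_columns:
  "\<exists>s h n0. spread R Rg \<mm> M = ereal (real s) \<and> (\<forall>j i. h j i \<in> Rg (axis i 1)) \<and>
    (\<forall>n\<ge>n0. Mg n \<subseteq> set_times_module R {deg_prod (h j) | j. j \<in> {1..s}} M) \<and>
    (\<forall>\<iota> :: nat \<Rightarrow> 'r. filter_regular_seq R Rg M (map (\<lambda>j. h j (\<iota> j)) [1..<Suc s]))"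
proof -
  obtain s where s: "spread R Rg \<mm> M = ereal (real s)"
    "\<And>Ps. sorted_wrt (\<subset>) Ps \<Longrightarrow> set Ps \<subseteq> relevant_support (set_times_module R \<mm> M) \<Longrightarrow> length Ps \<le> s"
    using spread_is_maximal_chain_length by blast
  obtain h :: "nat \<Rightarrow> _" where h: "\<And>j i. h j i \<in> Rg (axis i 1)"
    and avoid: "\<And>j i F Q. F \<subseteq> (\<Union>m<j. range (h m)) \<union> {deg_prod (h m) | m. m < j} \<Longrightarrow> Q \<in> bad_primes F \<Longrightarrow> h j i \<notin> Q"
  proof -
    note seq = exists_avoiding_sequence
    obtain h :: "nat \<Rightarrow> _" where h: "\<forall>j i. h j i \<in> Rg (axis i 1)"
      "\<forall>j i. \<forall>F \<subseteq> (\<Union>m<j. range (h m)) \<union> {deg_prod (h m) | m. m < j}. \<forall>Q\<in>bad_primes F. h j i \<notin> Q"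
      using seq by (elim exE conjE)
    show thesis
      by (rule that[of h, OF spec[OF spec[OF h(1)]]]) (rule bspec[OF mp[OF spec[OF spec[OF spec[OF h(2)]]]]])
  qed
  have hc: "h j i \<in> carrier R" for j i using h RG.g_carrier by blast
  let ?B = "\<lambda>k. {deg_prod (h j) | j. j \<in> {1..k}}"
  let ?N = "\<lambda>k. set_times_module R (\<mm> \<union> ?B k) M"
  have hom: "homogeneous Rg b" if "b \<in> \<mm> \<union> ?B k" for b k
    using that m_degree h by (auto simp: homogeneous_def intro!: homogeneous_finprod[unfolded homogeneous_def])
  have Bc: "\<mm> \<union> ?B k \<subseteq> carrier R" for k 
  proof
    fix b assume "b \<in> \<mm> \<union> ?B k"
    from hom[OF this] show "b \<in> carrier R" using RG.g_carrier by (auto simp: homogeneous_def)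
  qed
  have N: "submodule (?N k) R M" "graded_subset M Mg (?N k)" for k
    by (rule set_times_module_is_submodule[OF Bc], rule graded_set_times_module[OF hom])
  have N0: "?N 0 = set_times_module R \<mm> M" by simp
  \<comment> \<open>Each column product descends strictly from a prime of the current support to one
    of the preceding support, so \<open>P\<close> sits on top of \<open>k\<close> further
    primes.\<close>
  have chain: "\<exists>Ps. length Ps = k \<and> sorted_wrt (\<subset>) (Ps @ [P]) \<and> set Ps \<subseteq> relevant_support (?N 0)"
    if "P \<in> relevant_support (?N k)" for k P
    using that
  proof (induct k arbitrary: P)
    case 0
    then show ?case by simp
  next
    case (Suc k)
    have "\<exists>Q\<in>relevant_support (?N k). Q \<subset> P"
    proof (rule relevant_support_drop[OF N])
      show "?N k \<subseteq> ?N (Suc k)" by (rule set_times_module_mono[OF _ Bc]) auto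
      show "deg_prod (h (Suc k)) \<in> carrier R" using hc by (intro finprod_closed) auto
      show "deg_prod (h (Suc k)) \<odot>\<^bsub>M\<^esub> x \<in> ?N (Suc k)" if "x \<in> carrier M" for x
        by (rule set_times_module_incl[OF _ that]) auto
      show "P \<in> relevant_support (?N (Suc k))" by (rule Suc)
      fix Q assume Q: "Q \<in> relevant_colon_primes (?N k)"
      then have "Q \<in> bad_primes (?B k)" by (simp add: bad_primes_def)
      moreover have "?B k \<subseteq> (\<Union>m<Suc k. range (h m)) \<union> {deg_prod (h m) | m. m < Suc k}" by auto
      ultimately have "h (Suc k) i \<notin> Q" for i using avoid by blast
      then show "deg_prod (h (Suc k)) \<notin> Q"
        using Q hc by (intro finprod_notin_prime) (auto simp: relevant_colon_primes_def colon_primes_def)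
    qed
    then obtain Q where Q: "Q \<in> relevant_support (?N k)" "Q \<subset> P" by (elim bexE)
    obtain Ps where Ps: "length Ps = k" "sorted_wrt (\<subset>) (Ps @ [Q])" "set Ps \<subseteq> relevant_support (?N 0)"
      using Suc(1)[OF Q(1)] by blast
    have "?N 0 \<subseteq> ?N k" by (rule set_times_module_mono[OF _ Bc]) auto
    then have "Q \<in> relevant_support (?N 0)" using relevant_support_mono Q(1) by blast
    moreover have "sorted_wrt (\<subset>) ((Ps @ [Q]) @ [P])"
      using Ps(2) Q(2) unfolding sorted_wrt_append by auto
    ultimately show ?case using Ps by (intro exI[of _ "Ps @ [Q]"]) simp
  qed
  \<comment> \<open>A remaining prime would complete a chain of \<open>s + 1\<close> primes in the
    support of \<open>M / \<mm> M\<close>.\<close>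
  have empty: "relevant_support (?N s) = {}"
  proof (rule ccontr)
    assume "relevant_support (?N s) \<noteq> {}"
    then obtain P where P: "P \<in> relevant_support (?N s)" by blast
    obtain Ps where Ps: "length Ps = s" "sorted_wrt (\<subset>) (Ps @ [P])" "set Ps \<subseteq> relevant_support (?N 0)"
      using chain[OF P] by blast
    have "?N 0 \<subseteq> ?N s" by (rule set_times_module_mono[OF _ Bc]) auto
    then have "P \<in> relevant_support (?N 0)" using relevant_support_mono P by blast
    then have "length (Ps @ [P]) \<le> s" using Ps N0 by (intro s(2)) auto
    then show False using Ps by simp
  qed
  obtain n0 where n0: "\<And>n. n \<ge> n0 \<Longrightarrow> Mg n \<subseteq> ?N s"
    using eventually_contained_if_no_relevant_support[OF N empty] by blast
  have "Mg n \<subseteq> set_times_module R (?B s) M" if "n \<ge> n0" for n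
    by (rule graded_nakayama[OF _ n0[OF that]]) (use hom in blast)
  moreover have "filter_regular_seq R Rg M (map (\<lambda>j. h j (\<iota> j)) [1..<Suc s])" for \<iota> :: "nat \<Rightarrow> 'r"
    unfolding filter_regular_seq_def
  proof (intro allI impI)
    fix k assume k: "k < length (map (\<lambda>j. h j (\<iota> j)) [1..<Suc s])"
    let ?F = "set (take k (map (\<lambda>j. h j (\<iota> j)) [1..<Suc s]))"
    have nth: "map (\<lambda>j. h j (\<iota> j)) [1..<Suc s] ! k = h (Suc k) (\<iota> (Suc k))"
      using k by (simp del: upt_Suc)
    \<comment> \<open>The first \<open>k\<close> terms come from columns \<open>1\<close> to
      \<open>k\<close> and the next one from column \<open>Suc k\<close>, which was chosen to avoid
      the primes attached to such sets.\<close>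
    have "?F = (\<lambda>j. h j (\<iota> j)) ` {1..<Suc k}"
      using k by (simp del: upt_Suc add: take_map)
    then have F: "?F \<subseteq> (\<Union>m<Suc k. range (h m)) \<union> {deg_prod (h m) | m. m < Suc k}" "?F \<subseteq> carrier R"
      using hc by auto
    show "filter_regular R Rg (quotient_module M (set_times_module R (Idl ?F) M))
       (map (\<lambda>j. h j (\<iota> j)) [1..<Suc s] ! k)"
      unfolding nth by (rule filter_regular_quotient[OF F(2) h avoid[OF F(1)]])
  qed
  ultimately show ?thesis using s(1) h by blast
qed

end

text \<open>The spread is an extended real, so \<open>s\<close> is bound as a natural number and the
  equation for it includes finiteness. Only the values of \<open>\<iota>\<close> at \<open>1\<close>
  to \<open>s\<close> enter the sequence.\<close>

theorem theorem3p7: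
  fixes R :: "('a, 'x) ring_scheme"
    and Rg :: "nat ^ 'r::{finite, linorder} \<Rightarrow> 'a set"
    and M :: "('a, 'b, 'y) module_scheme"
    and Mg :: "int ^ 'r::{finite, linorder} \<Rightarrow> 'b set"
    and \<mm> :: "'a set"
  assumes "standard_multigraded_ring R Rg"
    and "noetherian_ring R"
    and "local_ring (degree_zero_ring R Rg) \<mm>"
    and "infinite (carrier (degree_zero_ring R Rg Quot \<mm>))"
    and "multigraded_module R Rg M Mg"
    and "finitely_generated_module R M"
  shows "\<exists>s::nat. spread R Rg \<mm> M = ereal (real s) \<and>
    (\<exists>a. complete_reduction R Rg M Mg s a \<and>
       (\<forall>\<iota> :: nat \<Rightarrow> 'r. filter_regular_seq R Rg M (map (\<lambda>j. a (\<iota> j) j) [1..<Suc s]))) \<and>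
    (\<forall>q :: nat ^ 'r::{finite, linorder}. (\<Sum>i\<in>UNIV. q $ i) = s \<longrightarrow>
       (\<exists>a. joint_reduction R Rg M Mg q a \<and> filter_regular_seq R Rg M (lex_list q a)))"
proof -
  interpret standard_local_module R Rg \<mm> M Mg
    by (intro standard_local_module.intro standard_local_ring.intro standard_local_ring_axioms.intro
        standard_local_module_axioms.intro assms)
  from exists_columns obtain s h n0
    where s: "spread R Rg \<mm> M = ereal (real s)" and h': "\<forall>j i. h j i \<in> Rg (axis i 1)"
      and n0: "\<forall>n\<ge>n0. Mg n \<subseteq> set_times_module R {\<Otimes>\<^bsub>R\<^esub>i\<in>UNIV. h j i | j. j \<in> {1..s}} M"
      and fr: "\<forall>\<iota> :: nat \<Rightarrow> 'r. filter_regular_seq R Rg M (map (\<lambda>j. h j (\<iota> j)) [1..<Suc s])"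
    by (elim exE conjE)
  note h = spec[OF spec[OF h']]
  have hc: "h j i \<in> carrier R" for j i using h RG.g_carrier by blast
  let ?B = "{\<Otimes>\<^bsub>R\<^esub>i\<in>UNIV. h j i | j. j \<in> {1..s}}"
  have Bc: "?B \<subseteq> carrier R" using hc by (auto intro!: finprod_closed)
  define a where "a i j = h j i" for i j
  have "complete_reduction R Rg M Mg s a"
    unfolding complete_reduction_def for_large_degrees_def a_def set_times_module_genideal[OF Bc]
    using h n0 by blast
  moreover have "\<exists>b. joint_reduction R Rg M Mg q b \<and> filter_regular_seq R Rg M (lex_list q b)"
    if q: "(\<Sum>i\<in>UNIV. q $ i) = s" for q :: "nat ^ 'r::{finite, linorder}"
  proof -
    \<comment> \<open>The number of columns assigned to earlier rows; row \<open>i\<close> receives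
      the \<open>q $ i\<close> columns following it.\<close>
    define off where "off i = (\<Sum>i'\<in>{i'. i' < i}. q $ i')" for i
    define b where "b i k = a i (off i + k)" for i k
    let ?xs = "sorted_list_of_set (UNIV :: 'r set)"
    \<comment> \<open>The pairs of row and column in the order of \<open>lex_list\<close>. The
      columns run through \<open>1\<close> to \<open>s\<close> exactly once, so the sequence is a
      selection of one row per column.\<close>
    define ps where "ps = concat (map (\<lambda>i. map (\<lambda>k. (i, off i + k)) [1..<Suc (q $ i)]) ?xs)"
    have "map snd ps = concat (map (\<lambda>i. map (\<lambda>k. off i + k) [1..<Suc (q $ i)]) ?xs)"
      unfolding ps_def by (simp add: map_concat comp_def del: upt_Suc)
    also have "\<dots> = [Suc 0..<Suc (0 + sum (($) q) (set ?xs))]"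
      by (rule concat_consecutive_blocks) (simp_all add: off_def)
    finally have snd: "map snd ps = [1..<Suc s]" using q by simp
    have lex: "lex_list q b = map (\<lambda>p. a (fst p) (snd p)) ps"
      unfolding lex_list_def ps_def by (simp add: map_concat comp_def b_def[abs_def] del: upt_Suc)
    have len: "length ps = s" using arg_cong[OF snd, of length] by simp
    \<comment> \<open>The row of column \<open>j\<close> is found at position \<open>j - 1\<close>,
      list positions starting at \<open>0\<close>.\<close>
    have "lex_list q b = map (\<lambda>j. h j (fst (ps ! (j - 1)))) [1..<Suc s]"
      unfolding lex
    proof (rule nth_equalityI)
      fix k assume k: "k < length (map (\<lambda>p. a (fst p) (snd p)) ps)"
      have "snd (ps ! k) = Suc k" using k len arg_cong[OF snd, of "\<lambda>l. l ! k"] by (simp del: upt_Suc)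
      then show "map (\<lambda>p. a (fst p) (snd p)) ps ! k = map (\<lambda>j. h j (fst (ps ! (j - 1)))) [1..<Suc s] ! k"
        using k len by (simp del: upt_Suc add: a_def)
    qed (simp add: len del: upt_Suc)
    then have "filter_regular_seq R Rg M (lex_list q b)" using fr by simp
    moreover have "joint_reduction R Rg M Mg q b"
    proof -
      let ?E = "{b i k | i k. k \<in> {1..q $ i}}"
      have Ec: "?E \<subseteq> carrier R" using hc by (auto simp: b_def a_def)
      \<comment> \<open>Column \<open>j\<close> is assigned to some row, and the entry there is both
        a factor of the column product and a member of the joint reduction.\<close>
      have "?B \<subseteq> Idl\<^bsub>R\<^esub> ?E"
      proof
        fix x assume "x \<in> ?B"
        then obtain j where j: "x = (\<Otimes>\<^bsub>R\<^esub>i\<in>UNIV. h j i)" "j \<in> {1..s}" by blast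
        have "j \<in> set (map snd ps)" unfolding snd using j(2) by auto
        then obtain i k where ik: "j = off i + k" "k \<in> {1..q $ i}" by (auto simp: ps_def simp del: upt_Suc)
        have "h j i \<in> ?E" using ik by (auto simp: b_def a_def)
        then have "h j i \<in> Idl\<^bsub>R\<^esub> ?E" using genideal_self[OF Ec] by blast
        then show "x \<in> Idl\<^bsub>R\<^esub> ?E"
          unfolding j(1) using hc by (intro finprod_in_ideal[OF genideal_ideal[OF Ec]]) auto
      qed
      then have "set_times_module R ?B M \<subseteq> set_times_module R (Idl\<^bsub>R\<^esub> ?E) M"
        using ideal.Icarr[OF genideal_ideal[OF Ec]] by (intro set_times_module_mono) auto
      then have "\<forall>n\<ge>n0. Mg n = Mg n \<inter> set_times_module R (Idl\<^bsub>R\<^esub> ?E) M"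
        using n0 by blast
      moreover have "\<forall>i. \<forall>k\<in>{1..q $ i}. b i k \<in> Rg (axis i 1)"
        unfolding b_def a_def using h by blast
      ultimately show ?thesis
        unfolding joint_reduction_def for_large_degrees_def by blast
    qed
    ultimately show ?thesis by blast
  qed
  moreover have "\<forall>\<iota> :: nat \<Rightarrow> 'r. filter_regular_seq R Rg M (map (\<lambda>j. a (\<iota> j) j) [1..<Suc s])"
    unfolding a_def by (rule fr)
  ultimately show ?thesis using s by blast
qed

end
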